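(* Consider the sequence (indexed by $n$, with $p=p_n\to\infty$) of regression models $Y_i=f_0(x_i)+\varepsilon_i$, $1\le i\le n$, with $\varepsilon_i$ i.i.d. $\mathcal N(0,1)$ and fixed design $\mathcal X=\{x_1,\dots,x_n\}\subset[0,1]^p$. Assume $f_0\in\mathcal H^\alpha_p\cap\mathcal C(\mathcal S_0)$ with $0<\alpha\le1$ and $0<q_0=|\mathcal S_0|$ such that $q_0\|f_0\|_{\mathcal H^\alpha}\lesssim\log n$ and $\|f_0\|_\infty\lesssim\log n$. Moreover assume $\log p\lesssim n^{q_0/(2\alpha+q_0)}$ and that $\mathcal X$ is $(M,\mathcal S_0)$-regular. Endow the space $\mathcal F_{\mathcal E}$ of additive tree step functions with the prior (T1), (T2), (T3* )--(T6* ) described in the context. Then, with $\varepsilon_n=n^{-\alpha/(2\alpha+q_0)}\log n$, $$\Pi\left(f\in\mathcal F_{\mathcal E}:\ \|f_0-f\|_n>M_n\,\varepsilon_n\ \middle|\ Y^{(n)}\right)\to0$$ in $P_{f_0}^n$-probability, as $n,p\to\infty$, for any sequence $M_n\to\infty$.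
   Context: Notation. $Y^{(n)}=(Y_1,\dots,Y_n)'$; $P_{f_0}^n$ is its law under regression function $f_0$; $\Pi(\cdot\mid Y^{(n)})$ is the posterior obtained from the prior $\Pi$ and the Gaussian likelihood $Y_i\sim\mathcal N(f(x_i),1)$ independent. $\|f\|_n^2=\frac1n\sum_{i=1}^n f(x_i)^2$. $a\lesssim b$ means inequality up to a constant not depending on $n$. The objects $p,\mathcal X,f_0,\mathcal S_0,q_0$ may depend on $n$; $\alpha$, $M$ and the prior hyperparameters are fixed. For $x\in\mathbb R^p$, $x_{\mathcal S}$ is the subvector indexed by $\mathcal S\subseteq\{1,\dots,p\}$. Function classes. For $\alpha\in(0,1]$, $\mathcal H^\alpha_p$ is the set of $f:[0,1]^p\to\mathbb R$ with $\|f\|_{\mathcal H^\alpha}=\sup_{x\ne y}|f(x)-f(y)|/\|x-y\|_2^\alpha<\infty$. $\mathcal C(\mathcal S)$ is the set of $f:[0,1]^p\to\mathbb R$ that are constant in the directions $\{1,\dots,p\}\setminus\mathcal S$. Tree partitions. For a cell $\Omega\subseteq[0,1]^p$ let $\mu(\Omega)=\frac1n\sum_{i=1}^n\mathbb I(x_i\in\Omega)$. A tree partition with $K$ cells is obtained from $[0,1]^p$ by $K-1$ successive splits; each split replaces a current cell $\Omega$ by $\{x\in\Omega:x_j\le\tau\}$ and $\{x\in\Omega:x_j>\tau\}$ for a coordinate $j$ and a threshold $\tau$ equal to the $j$-th coordinate of some point of $\mathcal X$. Fix a constant $\bar C$ with $\bar C^2\in\{1,2,\dots\}$; a partition is valid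 if $\mu(\Omega_k)\ge\bar C^2/n$ for all its cells. $\mathcal V^K_{\mathcal S}$ is the family of valid tree partitions with $K$ cells all of whose splits are along coordinates in $\mathcal S$, each coordinate in $\mathcal S$ being used at least once; partitions inducing the same partition of $\mathcal X$ are identified. For a tree partition $\mathcal T=\{\Omega_k\}_{k=1}^K$ and $\beta\in\mathbb R^K$ let $f_{\mathcal T,\beta}=\sum_{k=1}^K\beta_k\mathbb 1_{\Omega_k}$. Ensembles. For $T\ge1$, $K=(K^1,\dots,K^T)$ and subsets $(\mathcal S^1,\dots,\mathcal S^T)$, a valid ensemble is an ordered tuple $\mathcal E=(\mathcal T^1,\dots,\mathcal T^T)$ with $\mathcal T^t\in\mathcal V^{K^t}_{\mathcal S^t}$. With step heights $\mathcal B=(\beta^1,\dots,\beta^T)$, $\beta^t\in\mathbb R^{K^t}$, put $f_{\mathcal E,\mathcal B}=\sum_{t=1}^Tf_{\mathcal T^t,\beta^t}$. $\mathcal F_{\mathcal E}$ is the set of all such functions over all $T\ge1$, subsets, tree sizes, valid ensembles and step heights. $\mathcal{VE}^{K}_{\mathcal S}$ denotes the set of valid ensembles all of whose trees use the same set $\mathcal S^t=\mathcal S$, and $\Delta(\mathcal{VE}^{K}_{\mathcal S})$ its cardinality. $k$-$d$ tree and regularity. The $k$-$d$ tree partition with respect to $\mathcal S$ with $K=2^{s|\mathcal S|}$ cells is obtained by cycling $s$ times over the coordinates in $\mathcal S$; all cells at the same level are split along the same coordinate, each at a median of its data points, so that a cell with $m$ points passes $\lfloor m/2\rfloor$ and $\lceil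 m/2\rceil$ points to its two children. Let $\mathrm{diam}(\Omega;\mathcal S)=\max_{x,y\in\Omega\cap\mathcal X}\|x_{\mathcal S}-y_{\mathcal S}\|_2$. $\mathcal X$ is $(M,\mathcal S)$-regular if, with $\{\widehat\Omega_k\}_{k=1}^K$ the $k$-$d$ tree partition with $K=2^{s|\mathcal S|}$, $\max_k\mathrm{diam}(\widehat\Omega_k;\mathcal S)<M\sum_{k=1}^K\mu(\widehat\Omega_k)\,\mathrm{diam}(\widehat\Omega_k;\mathcal S)$ for all integers $s\ge1$ for which this $k$-$d$ tree belongs to $\mathcal V^K_{\mathcal S}$ and the right-hand side is nonzero. Prior. (T1) $\pi(q)\propto c^{-q}p^{-aq}$, $q=0,1,\dots,p$, for fixed $a,c>0$. (T2) Given $q$, $\mathcal S$ is uniform over the $\binom pq$ subsets of size $q$ (the same $\mathcal S$ for all trees). (T3* ) $\pi(T)\propto e^{-C_TT}$, $T=1,2,\dots$, with fixed $C_T>\log2$. (T4* ) $\pi(K\mid T)=\prod_{t=1}^T\frac{(\lambda/T)^{K^t}}{(e^{\lambda/T}-1)K^t!}$, $K^t\in\{1,2,\dots\}$, with fixed $\lambda>0$. (T5* ) $\pi(\mathcal E\mid\mathcal S,K)=\mathbb 1(\mathcal E\in\mathcal{VE}^K_{\mathcal S})/\Delta(\mathcal{VE}^K_{\mathcal S})$. (T6* ) Given $T,K$, all step heights $\beta^t_k$ are i.i.d. $\mathcal N(0,1/T)$. Configurations with no valid ensemble receive no mass (the prior being renormalized). *)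

theory Defs
  imports "HOL-Probability.Probability"
begin

(* Points of R^p are functions nat => real whose coordinates are numbered 1, ..., p; a design of
   size n is a family x of points numbered 1, ..., n. *)

type_synonym point = "nat \<Rightarrow> real"
type_synonym cell = "point set"

definition cube :: "nat \<Rightarrow> point set" where
  "cube p = {1..p} \<rightarrow>\<^sub>E {0..1}"


section \<open>Function classes\<close>

definition holder_quotients :: "nat \<Rightarrow> real \<Rightarrow> (point \<Rightarrow> real) \<Rightarrow> real set" where
  "holder_quotients p \<alpha> f =
     {\<bar>f x - f y\<bar> / L2_set (\<lambda>j. x j - y j) {1..p} powr \<alpha> | x y. x \<in> cube p \<and> y \<in> cube p \<and> x \<noteq> y}"

definition holder_norm :: "nat \<Rightarrow> real \<Rightarrow> (point \<Rightarrow> real) \<Rightarrow> real" where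
  "holder_norm p \<alpha> f = Sup (holder_quotients p \<alpha> f)"

(* Sup on the reals is unspecified for unbounded sets, hence the explicit finiteness condition.
   Values of f outside the cube are irrelevant, here and in all notions below. *)

definition holder_class :: "nat \<Rightarrow> real \<Rightarrow> (point \<Rightarrow> real) set" where
  "holder_class p \<alpha> = {f. bdd_above (holder_quotients p \<alpha> f)}"

definition sparse_class :: "nat \<Rightarrow> nat set \<Rightarrow> (point \<Rightarrow> real) set" where
  "sparse_class p S = {f. \<forall>x\<in>cube p. \<forall>y\<in>cube p. (\<forall>j\<in>S. x j = y j) \<longrightarrow> f x = f y}"

definition sup_norm :: "nat \<Rightarrow> (point \<Rightarrow> real) \<Rightarrow> real" where
  "sup_norm p f = (SUP x\<in>cube p. \<bar>f x\<bar>)"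

definition emp_norm :: "nat \<Rightarrow> (nat \<Rightarrow> point) \<Rightarrow> (point \<Rightarrow> real) \<Rightarrow> real" where
  "emp_norm n x f = sqrt (1 / real n * (\<Sum>i=1..n. (f (x i))\<^sup>2))"


section \<open>Tree partitions\<close>

(* Points are counted by their index, i.e. with multiplicity. *)

definition num_points :: "nat \<Rightarrow> (nat \<Rightarrow> point) \<Rightarrow> cell \<Rightarrow> nat" where
  "num_points n x \<Omega> = card {i \<in> {1..n}. x i \<in> \<Omega>}"

definition cell_mass :: "nat \<Rightarrow> (nat \<Rightarrow> point) \<Rightarrow> cell \<Rightarrow> real" where
  "cell_mass n x \<Omega> = real (num_points n x \<Omega>) / real n"

definition lower_cell :: "nat \<Rightarrow> real \<Rightarrow> cell \<Rightarrow> cell" where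
  "lower_cell j \<tau> \<Omega> = {z \<in> \<Omega>. z j \<le> \<tau>}"

definition upper_cell :: "nat \<Rightarrow> real \<Rightarrow> cell \<Rightarrow> cell" where
  "upper_cell j \<tau> \<Omega> = {z \<in> \<Omega>. z j > \<tau>}"

(* tree_partition p n x K J P: the partition P arises from the cube by K - 1 successive splits,
   and J is the set of coordinates used by these splits. *)

inductive tree_partition ::
  "nat \<Rightarrow> nat \<Rightarrow> (nat \<Rightarrow> point) \<Rightarrow> nat \<Rightarrow> nat set \<Rightarrow> cell set \<Rightarrow> bool" for p n x where
  root: "tree_partition p n x 1 {} {cube p}"
| split: "tree_partition p n x K J P \<Longrightarrow> \<Omega> \<in> P \<Longrightarrow> j \<in> {1..p} \<Longrightarrow> i \<in> {1..n} \<Longrightarrow> \<tau> = x i j \<Longrightarrow>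
    tree_partition p n x (Suc K) (insert j J)
      (P - {\<Omega>} \<union> {lower_cell j \<tau> \<Omega>, upper_cell j \<tau> \<Omega>})"

(* The valid partitions before identification. Validity makes all cells nonempty, so such a P
   has exactly K elements. *)

definition valid_trees ::
  "nat \<Rightarrow> nat \<Rightarrow> (nat \<Rightarrow> point) \<Rightarrow> real \<Rightarrow> nat \<Rightarrow> nat set \<Rightarrow> cell set set" where
  "valid_trees p n x Cbar K S =
     {P. tree_partition p n x K S P \<and> (\<forall>\<Omega>\<in>P. cell_mass n x \<Omega> \<ge> Cbar\<^sup>2 / real n)}"

definition data_trace :: "nat \<Rightarrow> (nat \<Rightarrow> point) \<Rightarrow> cell set \<Rightarrow> cell set" where
  "data_trace n x P = (\<lambda>\<Omega>. \<Omega> \<inter> x ` {1..n}) ` P"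

(* The family V^K_S: valid partitions inducing the same partition of the design are identified. *)

definition tree_classes ::
  "nat \<Rightarrow> nat \<Rightarrow> (nat \<Rightarrow> point) \<Rightarrow> real \<Rightarrow> nat \<Rightarrow> nat set \<Rightarrow> cell set set set" where
  "tree_classes p n x Cbar K S =
     valid_trees p n x Cbar K S //
       {(P, Q). P \<in> valid_trees p n x Cbar K S \<and> Q \<in> valid_trees p n x Cbar K S \<and>
                data_trace n x P = data_trace n x Q}"

(* An arbitrary partition representing a class; step functions of two representatives agree on
   the design. *)

definition tree_rep :: "cell set set \<Rightarrow> cell set" where
  "tree_rep c = (SOME P. P \<in> c)"


section \<open>Ensembles\<close>

(* The set VE^K_S for a tuple K = (K^1, ..., K^T), T = length Ks, and a common set S. *)

definition valid_ensembles ::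
  "nat \<Rightarrow> nat \<Rightarrow> (nat \<Rightarrow> point) \<Rightarrow> real \<Rightarrow> nat list \<Rightarrow> nat set \<Rightarrow> cell set set list set" where
  "valid_ensembles p n x Cbar Ks S =
     {E. length E = length Ks \<and> (\<forall>t<length Ks. E ! t \<in> tree_classes p n x Cbar (Ks ! t) S)}"

(* Step heights are indexed by tree number and cell rather than by tree number and cell number;
   no enumeration of the cells is needed. *)

definition ensemble_fun :: "cell set list \<Rightarrow> (nat \<times> cell \<Rightarrow> real) \<Rightarrow> point \<Rightarrow> real" where
  "ensemble_fun Ps B z = (\<Sum>t<length Ps. \<Sum>\<Omega>\<in>Ps ! t. B (t, \<Omega>) * indicator \<Omega> z)"

(* The space F_E: additive tree functions on the cube, over all T >= 1, all tree sizes, all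
   (possibly different) subsets of coordinates, all valid trees and all step heights. *)

definition forest_functions ::
  "nat \<Rightarrow> nat \<Rightarrow> (nat \<Rightarrow> point) \<Rightarrow> real \<Rightarrow> (point \<Rightarrow> real) set" where
  "forest_functions p n x Cbar =
     {restrict (ensemble_fun Ps B) (cube p) | Ps B.
        length Ps \<ge> 1 \<and> (\<forall>t<length Ps. \<exists>K S. Ps ! t \<in> valid_trees p n x Cbar K S)}"


section \<open>The k-d tree and regular designs\<close>

definition is_median :: "nat \<Rightarrow> (nat \<Rightarrow> point) \<Rightarrow> nat \<Rightarrow> cell \<Rightarrow> real \<Rightarrow> bool" where
  "is_median n x j \<Omega> \<tau> \<longleftrightarrow>
     2 * card {i \<in> {1..n}. x i \<in> \<Omega> \<and> x i j \<le> \<tau>} \<ge> num_points n x \<Omega> \<and>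
     2 * card {i \<in> {1..n}. x i \<in> \<Omega> \<and> x i j \<ge> \<tau>} \<ge> num_points n x \<Omega>"

definition balanced_split :: "nat \<Rightarrow> (nat \<Rightarrow> point) \<Rightarrow> nat \<Rightarrow> cell \<Rightarrow> real \<Rightarrow> bool" where
  "balanced_split n x j \<Omega> \<tau> \<longleftrightarrow>
     \<tau> \<in> (\<lambda>i. x i j) ` {1..n} \<and> is_median n x j \<Omega> \<tau> \<and>
     {num_points n x (lower_cell j \<tau> \<Omega>), num_points n x (upper_cell j \<tau> \<Omega>)} =
       {nat \<lfloor>real (num_points n x \<Omega>) / 2\<rfloor>, nat \<lceil>real (num_points n x \<Omega>) / 2\<rceil>}"

definition kd_level :: "nat \<Rightarrow> (nat \<Rightarrow> point) \<Rightarrow> nat \<Rightarrow> cell set \<Rightarrow> cell set \<Rightarrow> bool" where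
  "kd_level n x j P Q \<longleftrightarrow>
     (\<exists>\<tau>. (\<forall>\<Omega>\<in>P. balanced_split n x j \<Omega> (\<tau> \<Omega>)) \<and>
          Q = (\<Union>\<Omega>\<in>P. {lower_cell j (\<tau> \<Omega>) \<Omega>, upper_cell j (\<tau> \<Omega>) \<Omega>}))"

fun kd_levels :: "nat \<Rightarrow> (nat \<Rightarrow> point) \<Rightarrow> nat list \<Rightarrow> cell set \<Rightarrow> cell set \<Rightarrow> bool" where
  "kd_levels n x [] P Q \<longleftrightarrow> Q = P"
| "kd_levels n x (j # js) P Q \<longleftrightarrow> (\<exists>R. kd_level n x j P R \<and> kd_levels n x js R Q)"

(* Each cycle runs through S in increasing order; another order amounts to a renumbering of the
   coordinates. The design may have ties that leave no balanced split (then there is no P), and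
   the geometric cells need not be unique, but the partition of the design induced by a P all of
   whose cells contain data is. *)

definition kd_tree ::
  "nat \<Rightarrow> nat \<Rightarrow> (nat \<Rightarrow> point) \<Rightarrow> nat set \<Rightarrow> nat \<Rightarrow> cell set \<Rightarrow> bool" where
  "kd_tree p n x S s P \<longleftrightarrow> kd_levels n x (concat (replicate s (sorted_list_of_set S))) {cube p} P"

definition cell_diam :: "nat \<Rightarrow> (nat \<Rightarrow> point) \<Rightarrow> nat set \<Rightarrow> cell \<Rightarrow> real" where
  "cell_diam n x S \<Omega> =
     Max {L2_set (\<lambda>j. y j - z j) S | y z. y \<in> \<Omega> \<inter> x ` {1..n} \<and> z \<in> \<Omega> \<inter> x ` {1..n}}"

definition regular_design ::
  "nat \<Rightarrow> nat \<Rightarrow> (nat \<Rightarrow> point) \<Rightarrow> real \<Rightarrow> real \<Rightarrow> nat set \<Rightarrow> bool" where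
  "regular_design p n x Cbar M S \<longleftrightarrow>
     (\<forall>s\<ge>1. \<forall>P. kd_tree p n x S s P \<and> P \<in> valid_trees p n x Cbar (2 ^ (s * card S)) S \<and>
        M * (\<Sum>\<Omega>\<in>P. cell_mass n x \<Omega> * cell_diam n x S \<Omega>) \<noteq> 0 \<longrightarrow>
        Max (cell_diam n x S ` P) < M * (\<Sum>\<Omega>\<in>P. cell_mass n x \<Omega> * cell_diam n x S \<Omega>))"


section \<open>Prior\<close>

definition pmf_proportional :: "(nat \<Rightarrow> real) \<Rightarrow> nat pmf" where
  "pmf_proportional w = embed_pmf (\<lambda>k. w k / (\<Sum>j. w j))"

lemma pmf_pmf_proportional:
  assumes "\<And>k. w k \<ge> 0" and "summable w" and "w k0 > 0"
  shows "pmf (pmf_proportional w) k = w k / (\<Sum>j. w j)"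
proof -
  have pos: "(\<Sum>j. w j) > 0"
    using assms by (intro suminf_pos2) auto
  have "(\<integral>\<^sup>+ k. ennreal (w k / (\<Sum>j. w j)) \<partial>count_space UNIV) = (\<Sum>k. ennreal (w k / (\<Sum>j. w j)))"
    by (rule nn_integral_count_space_nat)
  also have "\<dots> = ennreal (\<Sum>k. w k / (\<Sum>j. w j))"
    using assms pos by (intro suminf_ennreal2) (auto intro!: summable_divide)
  also have "(\<Sum>k. w k / (\<Sum>j. w j)) = 1"
    using suminf_divide[OF assms(2), of "\<Sum>j. w j"] pos by simp
  finally show ?thesis
    unfolding pmf_proportional_def using assms pos by (intro pmf_embed_pmf) auto
qed

definition sparsity_prior :: "nat \<Rightarrow> real \<Rightarrow> real \<Rightarrow> nat pmf" where
  "sparsity_prior p a c =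
     pmf_proportional (\<lambda>q. if q \<le> p then c powr - real q * real p powr - (a * real q) else 0)"

definition num_trees_prior :: "real \<Rightarrow> nat pmf" where
  "num_trees_prior C\<^sub>T = pmf_proportional (\<lambda>T. if T \<ge> 1 then exp (- (C\<^sub>T * real T)) else 0)"

(* Poisson distribution with mean r conditioned to be positive; used with r = lambda / T. *)

definition tree_size_prior :: "real \<Rightarrow> nat pmf" where
  "tree_size_prior r = embed_pmf (\<lambda>k. if k \<ge> 1 then r ^ k / ((exp r - 1) * fact k) else 0)"

lemma pmf_sparsity_prior:
  assumes "c > 0" and "p \<ge> 1"
  shows "pmf (sparsity_prior p a c) q =
    (if q \<le> p then c powr - real q * real p powr - (a * real q) else 0) /
    (\<Sum>r\<le>p. c powr - real r * real p powr - (a * real r))"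
proof -
  let ?w = "\<lambda>q. if q \<le> p then c powr - real q * real p powr - (a * real q) else 0"
  have "summable ?w"
    by (rule summable_finite[of "{..p}"]) auto
  moreover have "(\<Sum>j. ?w j) = (\<Sum>r\<le>p. c powr - real r * real p powr - (a * real r))"
    by (subst suminf_finite[of "{..p}"]) auto
  ultimately show ?thesis
    unfolding sparsity_prior_def
    using pmf_pmf_proportional[of ?w 0 q] assms by auto
qed

lemma pmf_num_trees_prior:
  assumes "C\<^sub>T > 0"
  shows "pmf (num_trees_prior C\<^sub>T) T =
    (if T \<ge> 1 then exp (- (C\<^sub>T * real T)) else 0) / (\<Sum>j. if j \<ge> 1 then exp (- (C\<^sub>T * real j)) else 0)"
proof -
  let ?w = "\<lambda>T::nat. if T \<ge> 1 then exp (- (C\<^sub>T * real T)) else 0"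
  have "summable (\<lambda>k. exp (- C\<^sub>T) ^ k)"
    using assms by (intro summable_geometric) auto
  then have "summable ?w"
    by (rule summable_comparison_test'[where N = 0])
       (auto simp: exp_of_nat_mult[symmetric] mult.commute)
  then show ?thesis
    unfolding num_trees_prior_def by (rule pmf_pmf_proportional[where ?k0.0 = 1, rotated]) auto
qed

lemma pmf_tree_size_prior:
  assumes "r > 0"
  shows "pmf (tree_size_prior r) k = (if k \<ge> 1 then r ^ k / ((exp r - 1) * fact k) else 0)"
proof -
  let ?w = "\<lambda>k. if k \<ge> 1 then r ^ k / ((exp r - 1) * fact k) else 0"
  have e: "exp r > 1" using assms by simp
  have "(\<lambda>k. r ^ k / fact k) sums exp r"
    using exp_converges[of r] by (simp add: divide_inverse mult.commute)
  then have "(\<lambda>k. r ^ Suc k / fact (Suc k)) sums (exp r - 1)"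
    by (subst sums_Suc_iff) simp
  then have "(\<lambda>k. r ^ Suc k / fact (Suc k) / (exp r - 1)) sums 1"
    using sums_divide[of _ "exp r - 1" "exp r - 1"] e by fastforce
  then have "(\<lambda>k. ?w (Suc k)) sums 1"
    by (rule sums_cong[THEN iffD1, rotated]) (simp add: field_simps)
  then have s: "?w sums 1"
    using sums_Suc_iff[of ?w 1] by simp
  have "(\<integral>\<^sup>+ k. ennreal (?w k) \<partial>count_space UNIV) = (\<Sum>k. ennreal (?w k))"
    by (rule nn_integral_count_space_nat)
  also have "\<dots> = ennreal (\<Sum>k. ?w k)"
    using assms e s by (intro suminf_ennreal2) (auto intro: sums_summable)
  also have "(\<Sum>k. ?w k) = 1" using s by (rule sums_unique[symmetric])
  finally show ?thesis
    unfolding tree_size_prior_def using assms e by (intro pmf_embed_pmf) auto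
qed

(* Joint law of the subset S and the tuple of tree sizes; the number T of trees is the length of
   the tuple. *)

definition structure_prior :: "nat \<Rightarrow> real \<Rightarrow> real \<Rightarrow> real \<Rightarrow> real \<Rightarrow> (nat set \<times> nat list) pmf" where
  "structure_prior p a c C\<^sub>T l =
     do {
       q \<leftarrow> sparsity_prior p a c;
       S \<leftarrow> pmf_of_set {S. S \<subseteq> {1..p} \<and> card S = q};
       T \<leftarrow> num_trees_prior C\<^sub>T;
       Ks \<leftarrow> replicate_pmf T (tree_size_prior (l / real T));
       return_pmf (S, Ks)
     }"

(* Configurations without valid ensembles are removed and the remaining mass is renormalized. A
   configuration with valid ensembles exists as soon as n >= Cbar^2. *)

definition ensemble_prior ::
  "nat \<Rightarrow> nat \<Rightarrow> (nat \<Rightarrow> point) \<Rightarrow> real \<Rightarrow> real \<Rightarrow> real \<Rightarrow> real \<Rightarrow> real \<Rightarrow> cell set set list pmf" where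
  "ensemble_prior p n x Cbar a c C\<^sub>T l =
     do {
       (S, Ks) \<leftarrow> cond_pmf (structure_prior p a c C\<^sub>T l)
                    {(S, Ks). valid_ensembles p n x Cbar Ks S \<noteq> {}};
       pmf_of_set (valid_ensembles p n x Cbar Ks S)
     }"

definition step_height_prior :: "cell set list \<Rightarrow> (nat \<times> cell \<Rightarrow> real) measure" where
  "step_height_prior Ps =
     PiM (SIGMA t:{..<length Ps}. Ps ! t)
       (\<lambda>_. density lborel (\<lambda>u. ennreal (normal_density 0 (sqrt (1 / real (length Ps))) u)))"

(* The space F_E with the sigma-algebra generated by the point evaluations (the measure carried
   by this measure space is irrelevant). *)

definition forest_space ::
  "nat \<Rightarrow> nat \<Rightarrow> (nat \<Rightarrow> point) \<Rightarrow> real \<Rightarrow> (point \<Rightarrow> real) measure" where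
  "forest_space p n x Cbar =
     restrict_space (PiM (cube p) (\<lambda>_. borel)) (forest_functions p n x Cbar)"

definition forest_prior ::
  "nat \<Rightarrow> nat \<Rightarrow> (nat \<Rightarrow> point) \<Rightarrow> real \<Rightarrow> real \<Rightarrow> real \<Rightarrow> real \<Rightarrow> real \<Rightarrow> (point \<Rightarrow> real) measure" where
  "forest_prior p n x Cbar a c C\<^sub>T l =
     measure_pmf (ensemble_prior p n x Cbar a c C\<^sub>T l) \<bind>
       (\<lambda>E. distr (step_height_prior (map tree_rep E)) (forest_space p n x Cbar)
              (\<lambda>B. restrict (ensemble_fun (map tree_rep E) B) (cube p)))"


section \<open>Posterior\<close>

definition likelihood :: "nat \<Rightarrow> (nat \<Rightarrow> point) \<Rightarrow> (nat \<Rightarrow> real) \<Rightarrow> (point \<Rightarrow> real) \<Rightarrow> real" where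
  "likelihood n x Y f = (\<Prod>i=1..n. normal_density (f (x i)) 1 (Y i))"

definition data_law :: "nat \<Rightarrow> (nat \<Rightarrow> point) \<Rightarrow> (point \<Rightarrow> real) \<Rightarrow> (nat \<Rightarrow> real) measure" where
  "data_law n x f = PiM {1..n} (\<lambda>i. density lborel (\<lambda>u. ennreal (normal_density (f (x i)) 1 u)))"

definition posterior ::
  "(point \<Rightarrow> real) measure \<Rightarrow> nat \<Rightarrow> (nat \<Rightarrow> point) \<Rightarrow> (nat \<Rightarrow> real) \<Rightarrow> (point \<Rightarrow> real) measure" where
  "posterior prior n x Y =
     density prior (\<lambda>f. ennreal (likelihood n x Y f / (\<integral>g. likelihood n x Y g \<partial>prior)))"

end

theory Submission
  imports Defs
begin

text \<open>
  Write \<open>r = n \<epsilon>\<^sup>2 = n\<^bsup>q/(2\<alpha>+q)\<^esup> (log n)\<^sup>2\<close> and let \<open>L\<close> be the likelihood ratio with respect to the truth.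
  Given an ensemble, the regression functions form a linear space of dimension at most the total number
  of cells, and on that space \<open>log L\<close> is at most the squared norm of the projected noise minus a quarter of the
  squared distance to the truth. The projected noise has a chi-square exponential moment, so a union bound
  over the \<open>exp (O r)\<close> many ensembles with \<open>O (r / log n)\<close> cells and \<open>O (r / log p)\<close> coordinates makes \<open>L\<close>
  uniformly at most \<open>exp (O r - M\<^sup>2 r / 4)\<close> outside the ball of radius \<open>M \<epsilon>\<close>. The remaining
  ensembles have prior mass \<open>exp (- C r)\<close>: if \<open>S\<close> is empty all trees are trivial, and otherwise all tree sizes
  are at least \<open>2\<close>, which is superexponentially unlikely under Poisson means \<open>\<lambda> / T\<close>.

  The normalising constant is bounded below by a single tree. Splitting a regular grid of \<open>N\<^sup>q\<close> cubes,
  \<open>N = \<lfloor>n\<^bsup>1/(2\<alpha>+q)\<^esup>\<rfloor>\<close>, and skipping each split that would leave too few points on one side, loses only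
  \<open>O (N\<^sup>q)\<close> data points in total; the case \<open>N = 1\<close> takes care of \<open>q\<close> larger than \<open>log n\<close>.
\<close>


section \<open>Gaussian likelihood ratios\<close>

text \<open>The bound on \<open>lratio\<close> holds on whole linear spaces at once, for arbitrarily
  large step heights, so the sieve restricts only cells and coordinates. Two obstacles shape the
  rest. Sizes: when the Poisson mean \<open>l / T\<close> is small, a one-cell tree has probability
  close to 1, so tree sizes give no hold on the number T of trees. But a valid tree has one cell
  exactly when S is empty, one-cell trees yield only constants on the cube, and for sizes of at
  least 2 the factor 1 / T gained per tree makes all bounds uniform in T. Dimension: q may grow with
  n, and selecting q coordinates costs about q log p in the exponent. If N is at least 2, then 2^q
  \<le> N^q \<le> n, so q = O(log n) and the cost is O(r); if N = 1, the approximating tree has one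
  cell and selects no coordinate. That tree may use any subset J of the true coordinates, hence its
  prior mass is bounded uniformly over J and K. The constants depend on each other in one direction:
  the exponent \<open>Ct\<close> of the evidence determines the sieve size \<open>D\<close>, this
  the noise level 4 (8 D + 8), and both the radius.\<close>

definition gauss_law :: "nat \<Rightarrow> (nat \<Rightarrow> real) \<Rightarrow> (nat \<Rightarrow> real) measure" where
  "gauss_law n \<mu> = PiM {1..n} (\<lambda>i. density lborel (\<lambda>u. ennreal (normal_density (\<mu> i) 1 u)))"

lemma data_law_gauss: "data_law n x f = gauss_law n (\<lambda>i. f (x i))"
  by (simp add: data_law_def gauss_law_def)

lemma prob_space_gauss_law: "prob_space (gauss_law n \<mu>)"
  unfolding gauss_law_def by (intro prob_space_PiM prob_space_normal_density) simp

lemma sets_gauss_law [measurable_cong]: "sets (gauss_law n \<mu>) = sets (PiM {1..n} (\<lambda>_. borel))"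
  unfolding gauss_law_def by (intro sets_PiM_cong) auto

lemma measurable_gauss_component [measurable]:
  "i \<in> {1..n} \<Longrightarrow> (\<lambda>Y. Y i) \<in> borel_measurable (gauss_law n \<mu>)"
  by (subst measurable_cong_sets[OF sets_gauss_law refl]) (rule measurable_component_singleton)

text \<open>Completing the square: the exponential factor tilts N(m,1) into exp(h^2/2) times
  N(m+h,1), whose density integrates to one.\<close>

lemma gauss_mgf_1:
  "(\<integral>\<^sup>+u. ennreal (exp (h * (u - m))) \<partial>density lborel (\<lambda>u. ennreal (normal_density m 1 u))) =
     ennreal (exp (h\<^sup>2 / 2))"
proof -
  have eq: "normal_density m 1 u * exp (h * (u - m)) = exp (h\<^sup>2 / 2) * normal_density (m + h) 1 u" for u
  proof -
    have "- ((u - m)\<^sup>2 / 2) + h * (u - m) = h\<^sup>2 / 2 + - ((u - (m + h))\<^sup>2 / 2)"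
      by (simp add: power2_eq_square field_simps)
    then have "exp (- ((u - m)\<^sup>2 / 2)) * exp (h * (u - m)) = exp (h\<^sup>2 / 2) * exp (- ((u - (m + h))\<^sup>2 / 2))"
      unfolding exp_add[symmetric] by (rule arg_cong)
    then show ?thesis by (simp add: normal_density_def)
  qed
  have "(\<integral>\<^sup>+u. ennreal (exp (h * (u - m))) \<partial>density lborel (\<lambda>u. ennreal (normal_density m 1 u))) =
     (\<integral>\<^sup>+u. ennreal (normal_density m 1 u) * ennreal (exp (h * (u - m))) \<partial>lborel)"
    by (subst nn_integral_density) auto
  also have "\<dots> = (\<integral>\<^sup>+u. ennreal (exp (h\<^sup>2 / 2)) * ennreal (normal_density (m + h) 1 u) \<partial>lborel)"
    by (intro nn_integral_cong) (simp add: eq flip: ennreal_mult)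
  also have "\<dots> = ennreal (exp (h\<^sup>2 / 2)) * (\<integral>\<^sup>+u. ennreal (normal_density (m + h) 1 u) \<partial>lborel)"
    by (rule nn_integral_cmult) auto
  also have "(\<integral>\<^sup>+u. ennreal (normal_density (m + h) 1 u) \<partial>lborel) = 1"
    using prob_space.emeasure_space_1[OF prob_space_normal_density[of 1 "m + h"]]
    by (simp add: emeasure_density)
  finally show ?thesis by simp
qed

text \<open>The factor turns the N(0,1) density into sqrt 2 times the N(0,2) density. The
  coefficient 1/4 stays below the critical 1/2, beyond which the moment is infinite.\<close>

lemma gauss_chi_1:
  "(\<integral>\<^sup>+u. ennreal (exp (u\<^sup>2 / 4)) \<partial>density lborel (\<lambda>u. ennreal (normal_density 0 1 u))) = ennreal (sqrt 2)"
proof -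
  have eq: "normal_density 0 1 u * exp (u\<^sup>2 / 4) = sqrt 2 * normal_density 0 (sqrt 2) u" for u
  proof -
    have "exp (- (u\<^sup>2 / 2)) * exp (u\<^sup>2 / 4) = exp (- (u\<^sup>2 / 4))"
      by (simp flip: exp_add)
    moreover have "1 / sqrt 2 = sqrt 2 / 2" by (simp add: real_div_sqrt field_simps)
    ultimately show ?thesis by (simp add: normal_density_def real_sqrt_mult field_simps)
  qed
  have "(\<integral>\<^sup>+u. ennreal (exp (u\<^sup>2 / 4)) \<partial>density lborel (\<lambda>u. ennreal (normal_density 0 1 u))) =
     (\<integral>\<^sup>+u. ennreal (normal_density 0 1 u) * ennreal (exp (u\<^sup>2 / 4)) \<partial>lborel)"
    by (subst nn_integral_density) auto
  also have "\<dots> = (\<integral>\<^sup>+u. ennreal (sqrt 2) * ennreal (normal_density 0 (sqrt 2) u) \<partial>lborel)"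
    by (intro nn_integral_cong) (simp add: eq flip: ennreal_mult)
  also have "\<dots> = ennreal (sqrt 2) * (\<integral>\<^sup>+u. ennreal (normal_density 0 (sqrt 2) u) \<partial>lborel)"
    by (rule nn_integral_cmult) auto
  also have "(\<integral>\<^sup>+u. ennreal (normal_density 0 (sqrt 2) u) \<partial>lborel) = 1"
    using prob_space.emeasure_space_1[OF prob_space_normal_density[of "sqrt 2" 0]]
    by (simp add: emeasure_density)
  finally show ?thesis by simp
qed

lemma product_prob_nn_integral_prod:
  fixes f :: "'i \<Rightarrow> 'a \<Rightarrow> ennreal"
  assumes "finite I" "\<And>i. i \<in> I \<Longrightarrow> prob_space (M i)" "\<And>i. i \<in> I \<Longrightarrow> f i \<in> borel_measurable (M i)"
  shows "(\<integral>\<^sup>+y. (\<Prod>i\<in>I. f i (y i)) \<partial>PiM I M) = (\<Prod>i\<in>I. \<integral>\<^sup>+u. f i u \<partial>M i)"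
proof -
  \<comment> \<open>A point mass fills in outside \<open>I\<close>, because
    \<open>product_prob_space\<close> asks for a probability measure at every index.\<close>
  define N where "N = (\<lambda>i. if i \<in> I then M i else return (count_space UNIV) undefined)"
  interpret product_prob_space N
    by (intro product_prob_spaceI) (auto simp: N_def assms(2) prob_space_return)
  have "PiM I M = PiM I N" by (intro PiM_cong) (auto simp: N_def)
  moreover have "(\<integral>\<^sup>+y. (\<Prod>i\<in>I. f i (y i)) \<partial>PiM I N) = (\<Prod>i\<in>I. \<integral>\<^sup>+u. f i u \<partial>N i)"
    using assms(1,3) by (intro product_nn_integral_prod) (auto simp: N_def)
  moreover have "(\<Prod>i\<in>I. \<integral>\<^sup>+u. f i u \<partial>N i) = (\<Prod>i\<in>I. \<integral>\<^sup>+u. f i u \<partial>M i)"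
    by (intro prod.cong) (auto simp: N_def)
  ultimately show ?thesis by simp
qed

lemma gauss_mgf:
  "(\<integral>\<^sup>+Y. ennreal (exp (\<Sum>i=1..n. h i * (Y i - \<mu> i))) \<partial>gauss_law n \<mu>) =
     ennreal (exp ((\<Sum>i=1..n. (h i)\<^sup>2) / 2))"
proof -
  have "(\<integral>\<^sup>+Y. ennreal (exp (\<Sum>i=1..n. h i * (Y i - \<mu> i))) \<partial>gauss_law n \<mu>) =
    (\<integral>\<^sup>+Y. (\<Prod>i=1..n. ennreal (exp (h i * (Y i - \<mu> i)))) \<partial>gauss_law n \<mu>)"
    by (simp add: exp_sum prod_ennreal)
  also have "\<dots> = (\<Prod>i=1..n. \<integral>\<^sup>+u. ennreal (exp (h i * (u - \<mu> i)))
      \<partial>density lborel (\<lambda>u. ennreal (normal_density (\<mu> i) 1 u)))"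
    unfolding gauss_law_def
    by (intro product_prob_nn_integral_prod prob_space_normal_density) auto
  also have "\<dots> = (\<Prod>i=1..n. ennreal (exp ((h i)\<^sup>2 / 2)))"
    by (intro prod.cong refl gauss_mgf_1)
  also have "\<dots> = ennreal (exp ((\<Sum>i=1..n. (h i)\<^sup>2) / 2))"
    by (simp add: prod_ennreal exp_sum sum_divide_distrib)
  finally show ?thesis .
qed

text \<open>The density of N(v, I) with respect to N(\<mu>, I): the terms quadratic in Y have
  cancelled, leaving a linear function of the noise Y - \<mu>.\<close>

definition lratio :: "nat \<Rightarrow> (nat \<Rightarrow> real) \<Rightarrow> (nat \<Rightarrow> real) \<Rightarrow> (nat \<Rightarrow> real) \<Rightarrow> real" where
  "lratio n \<mu> v Y =
     exp ((\<Sum>i=1..n. (v i - \<mu> i) * (Y i - \<mu> i)) - (\<Sum>i=1..n. (v i - \<mu> i)\<^sup>2) / 2)"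

lemma lratio_pos: "lratio n \<mu> v Y > 0"
  by (simp add: lratio_def)

lemma measurable_lratio [measurable]:
  "(\<lambda>Y. lratio n \<mu> v Y) \<in> borel_measurable (gauss_law n \<mu>)"
  unfolding lratio_def by measurable

text \<open>Used for ensembles outside the sieve: it turns their expected contribution to the
  numerator into their prior mass.\<close>

lemma nn_integral_lratio: "(\<integral>\<^sup>+Y. ennreal (lratio n \<mu> v Y) \<partial>gauss_law n \<mu>) = 1"
proof -
  let ?s = "\<Sum>i=1..n. (v i - \<mu> i)\<^sup>2"
  have "(\<integral>\<^sup>+Y. ennreal (lratio n \<mu> v Y) \<partial>gauss_law n \<mu>) =
    (\<integral>\<^sup>+Y. ennreal (exp (- ?s / 2)) * ennreal (exp (\<Sum>i=1..n. (v i - \<mu> i) * (Y i - \<mu> i))) \<partial>gauss_law n \<mu>)"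
    by (intro nn_integral_cong) (simp add: lratio_def add.commute flip: ennreal_mult exp_add)
  also have "\<dots> = ennreal (exp (- ?s / 2)) * ennreal (exp (?s / 2))"
    by (subst nn_integral_cmult) (measurable, simp only: gauss_mgf)
  also have "\<dots> = 1"
    by (simp flip: ennreal_mult exp_add)
  finally show ?thesis .
qed

text \<open>The reciprocal reverses the sign of the linear term, so its exponential moment exp(s/2)
  meets a further factor exp(s/2) instead of being cancelled by it. This is the moment behind the
  lower bound on the evidence.\<close>

lemma nn_integral_inverse_lratio:
  "(\<integral>\<^sup>+Y. ennreal (1 / lratio n \<mu> v Y) \<partial>gauss_law n \<mu>) = ennreal (exp (\<Sum>i=1..n. (v i - \<mu> i)\<^sup>2))"
proof -
  let ?s = "\<Sum>i=1..n. (v i - \<mu> i)\<^sup>2"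
  have eq: "1 / lratio n \<mu> v Y = exp (?s / 2) * exp (\<Sum>i=1..n. (\<mu> i - v i) * (Y i - \<mu> i))" for Y
  proof -
    have "(\<Sum>i=1..n. (\<mu> i - v i) * (Y i - \<mu> i)) = - (\<Sum>i=1..n. (v i - \<mu> i) * (Y i - \<mu> i))"
      by (simp add: sum_negf[symmetric] algebra_simps)
    then show ?thesis
      unfolding lratio_def by (simp only: exp_diff exp_minus) (simp add: divide_simps)
  qed
  have sq: "(\<Sum>i=1..n. (\<mu> i - v i)\<^sup>2) = ?s"
    by (intro sum.cong) (auto simp: power2_commute)
  have "(\<integral>\<^sup>+Y. ennreal (1 / lratio n \<mu> v Y) \<partial>gauss_law n \<mu>) =
    (\<integral>\<^sup>+Y. ennreal (exp (?s / 2)) * ennreal (exp (\<Sum>i=1..n. (\<mu> i - v i) * (Y i - \<mu> i))) \<partial>gauss_law n \<mu>)"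
    by (intro nn_integral_cong) (simp add: eq flip: ennreal_mult)
  also have "\<dots> = ennreal (exp (?s / 2)) * ennreal (exp (?s / 2))"
    by (subst nn_integral_cmult) (measurable, simp only: gauss_mgf sq)
  also have "\<dots> = ennreal (exp ?s)"
    by (simp flip: ennreal_mult exp_add)
  finally show ?thesis .
qed

section \<open>Linear spaces of mean vectors and the projected noise\<close>

definition in_span :: "nat \<Rightarrow> (nat \<Rightarrow> real) set \<Rightarrow> (nat \<Rightarrow> real) \<Rightarrow> bool" where
  "in_span n \<Phi> v \<longleftrightarrow> (\<exists>c. \<forall>i\<in>{1..n}. v i = (\<Sum>\<phi>\<in>\<Phi>. c \<phi> * \<phi> i))"

definition orthonormal_family :: "nat \<Rightarrow> nat \<Rightarrow> (nat \<Rightarrow> nat \<Rightarrow> real) \<Rightarrow> bool" where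
  "orthonormal_family n d e \<longleftrightarrow>
     (\<forall>j<d. \<forall>k<d. (\<Sum>i=1..n. e j i * e k i) = (if j = k then 1 else 0))"

text \<open>Inner products and equalities refer to the indices {1..n} only. A vector whose residual
  \<open>u\<close> vanishes there adds no direction, which is why \<open>d\<close> may be smaller
  than the cardinality.\<close>

lemma gram_schmidt:
  assumes "finite \<Phi>"
  shows "\<exists>d e. d \<le> card \<Phi> \<and> orthonormal_family n d e \<and>
           (\<forall>\<phi>\<in>\<Phi>. \<exists>c. \<forall>i\<in>{1..n}. \<phi> i = (\<Sum>j<d. c j * e j i))"
  using assms
proof (induction \<Phi>)
  case empty
  show ?case by (intro exI[of _ 0]) (auto simp: orthonormal_family_def)
next
  case (insert v \<Phi>)
  then obtain d e where d: "d \<le> card \<Phi>" and on: "orthonormal_family n d e"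
    and sp: "\<forall>\<phi>\<in>\<Phi>. \<exists>c. \<forall>i\<in>{1..n}. \<phi> i = (\<Sum>j<d. c j * e j i)" by blast
  define b where "b j = (\<Sum>i=1..n. v i * e j i)" for j
  define u where "u i = v i - (\<Sum>j<d. b j * e j i)" for i
  define nu where "nu = sqrt (\<Sum>i=1..n. (u i)\<^sup>2)"
  have uo: "(\<Sum>i=1..n. u i * e k i) = 0" if "k < d" for k
  proof -
    have "(\<Sum>i=1..n. u i * e k i) = b k - (\<Sum>i=1..n. \<Sum>j<d. b j * e j i * e k i)"
      by (simp add: u_def b_def left_diff_distrib sum_subtractf sum_distrib_right)
    also have "(\<Sum>i=1..n. \<Sum>j<d. b j * e j i * e k i) = (\<Sum>j<d. b j * (\<Sum>i=1..n. e j i * e k i))"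
      by (subst sum.swap) (simp add: sum_distrib_left mult.assoc)
    also have "\<dots> = (\<Sum>j<d. if j = k then b j else 0)"
      using on that by (intro sum.cong) (auto simp: orthonormal_family_def)
    also have "\<dots> = b k" using that by simp
    finally show ?thesis by simp
  qed
  show ?case
  proof (cases "nu = 0")
    case True
    then have "\<forall>i\<in>{1..n}. u i = 0"
      unfolding nu_def by (simp add: sum_nonneg_eq_0_iff)
    then have "\<forall>i\<in>{1..n}. v i = (\<Sum>j<d. b j * e j i)" by (simp add: u_def)
    then show ?thesis
      using d on sp insert.hyps by (intro exI[of _ d] exI[of _ e]) auto
  next
    case False
    have nu2: "nu\<^sup>2 = (\<Sum>i=1..n. (u i)\<^sup>2)"
      unfolding nu_def by (intro real_sqrt_pow2 sum_nonneg) auto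
    define e' where "e' = e(d := \<lambda>i. u i / nu)"
    have ek: "e' k = e k" if "k < d" for k using that by (simp add: e'_def)
    have ed: "e' d = (\<lambda>i. u i / nu)" by (simp add: e'_def)
    have dd: "(\<Sum>i=1..n. e' d i * e' d i) = 1"
    proof -
      have "(\<Sum>i=1..n. e' d i * e' d i) = (\<Sum>i=1..n. (u i)\<^sup>2) / nu\<^sup>2"
        unfolding ed by (simp add: sum_divide_distrib power2_eq_square)
      then show ?thesis using False unfolding nu2[symmetric] by simp
    qed
    have dk: "(\<Sum>i=1..n. e' d i * e' k i) = 0" if "k < d" for k
      using uo[OF that] unfolding ed ek[OF that] by (simp add: sum_divide_distrib[symmetric])
    have on': "orthonormal_family n (Suc d) e'"
      unfolding orthonormal_family_def
    proof (intro allI impI)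
      fix j k assume jk: "j < Suc d" "k < Suc d"
      consider "j < d" "k < d" | "j = d" "k = d" | "j = d" "k < d" | "j < d" "k = d"
        using jk by linarith
      then show "(\<Sum>i=1..n. e' j i * e' k i) = (if j = k then 1 else 0)"
      proof cases
        case 1 then show ?thesis using on by (simp add: ek orthonormal_family_def)
      next
        case 2 then show ?thesis using dd by simp
      next
        case 3 then show ?thesis using dk by simp
      next
        case 4 then show ?thesis using dk[of j] by (simp add: mult.commute)
      qed
    qed
    have "\<forall>i\<in>{1..n}. v i = (\<Sum>j<Suc d. (b(d := nu)) j * e' j i)"
      using False by (auto simp: ek ed u_def)
    moreover have "\<exists>c. \<forall>i\<in>{1..n}. \<phi> i = (\<Sum>j<Suc d. c j * e' j i)" if \<phi>: "\<phi> \<in> \<Phi>" for \<phi>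
    proof -
      obtain c where "\<forall>i\<in>{1..n}. \<phi> i = (\<Sum>j<d. c j * e j i)" using sp \<phi> by blast
      then show ?thesis by (intro exI[of _ "c(d := 0)"]) (simp add: ek)
    qed
    ultimately have "\<forall>\<phi>\<in>insert v \<Phi>. \<exists>c. \<forall>i\<in>{1..n}. \<phi> i = (\<Sum>j<Suc d. c j * e' j i)"
      by blast
    moreover have "Suc d \<le> card (insert v \<Phi>)" using d insert.hyps by simp
    ultimately show ?thesis
      using on' by blast
  qed
qed

lemma orthonormal_sum_squares:
  assumes "orthonormal_family n d e"
  shows "(\<Sum>i=1..n. (\<Sum>j<d. c j * e j i)\<^sup>2) = (\<Sum>j<d. (c j)\<^sup>2)"
proof -
  have "(\<Sum>i=1..n. (\<Sum>j<d. c j * e j i)\<^sup>2) = (\<Sum>i=1..n. \<Sum>j<d. \<Sum>k<d. c j * c k * (e j i * e k i))"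
    by (simp add: power2_eq_square sum_product mult_ac)
  also have "\<dots> = (\<Sum>j<d. \<Sum>i=1..n. \<Sum>k<d. c j * c k * (e j i * e k i))"
    by (rule sum.swap)
  also have "\<dots> = (\<Sum>j<d. \<Sum>k<d. \<Sum>i=1..n. c j * c k * (e j i * e k i))"
    by (intro sum.cong refl sum.swap)
  also have "\<dots> = (\<Sum>j<d. \<Sum>k<d. c j * c k * (if j = k then 1 else 0))"
    using assms by (intro sum.cong refl) (auto simp: orthonormal_family_def sum_distrib_left[symmetric])
  also have "\<dots> = (\<Sum>j<d. (c j)\<^sup>2)"
    by (simp add: power2_eq_square if_distrib cong: if_cong)
  finally show ?thesis .
qed

text \<open>Writing \<open>exp (g\<^sup>2/4)\<close> as a Gaussian mixture of exponentials \<open>exp (\<xi> g / sqrt 2)\<close> and exchanging the two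
  Gaussian integrals avoids rotation invariance.\<close>

lemma chi_square_mgf:
  assumes "orthonormal_family n d e"
  shows "(\<integral>\<^sup>+Y. ennreal (exp ((\<Sum>j<d. (\<Sum>i=1..n. e j i * (Y i - \<mu> i))\<^sup>2) / 4)) \<partial>gauss_law n \<mu>) =
    ennreal (sqrt 2 ^ d)"
proof -
  define N where "N = density lborel (\<lambda>u. ennreal (normal_density 0 1 u))"
  define Q where "Q = PiM {..<d} (\<lambda>_. N)"
  have pN: "prob_space N" unfolding N_def by (rule prob_space_normal_density) simp
  have sN [measurable_cong]: "sets N = sets borel" by (simp add: N_def)
  interpret Q: prob_space Q unfolding Q_def by (intro prob_space_PiM pN)
  interpret G: prob_space "gauss_law n \<mu>" by (rule prob_space_gauss_law)
  interpret QG: pair_sigma_finite Q "gauss_law n \<mu>" by unfold_locales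
  have [measurable]: "(\<lambda>\<xi>. \<xi> j) \<in> borel_measurable Q" if "j < d" for j
    using measurable_component_singleton[of j "{..<d}" "\<lambda>_. N"] that
    unfolding Q_def by (simp cong: measurable_cong_sets add: sN)
  define g where "g Y j = (\<Sum>i=1..n. e j i * (Y i - \<mu> i))" for Y :: "nat \<Rightarrow> real" and j
  have [measurable]: "(\<lambda>Y. g Y j) \<in> borel_measurable (gauss_law n \<mu>)" for j
    unfolding g_def by measurable
  \<comment> \<open>Read as a function of Y, the mixture exponent is again linear in the noise, with
    coefficient vector the combination of the \<open>e j\<close> with weights
    \<open>\<xi> j / sqrt 2\<close>.\<close>
  have inner: "(\<Sum>j<d. g Y j / sqrt 2 * \<xi> j) = (\<Sum>i=1..n. (\<Sum>j<d. (\<xi> j / sqrt 2) * e j i) * (Y i - \<mu> i))" for Y \<xi>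
  proof -
    have "(\<Sum>j<d. g Y j / sqrt 2 * \<xi> j) = (\<Sum>j<d. \<Sum>i=1..n. (\<xi> j / sqrt 2) * e j i * (Y i - \<mu> i))"
      unfolding g_def by (simp add: sum_distrib_left sum_distrib_right sum_divide_distrib mult_ac)
    also have "\<dots> = (\<Sum>i=1..n. \<Sum>j<d. (\<xi> j / sqrt 2) * e j i * (Y i - \<mu> i))" by (rule sum.swap)
    finally show ?thesis by (simp add: sum_distrib_right)
  qed
  have 1: "ennreal (exp ((\<Sum>j<d. (g Y j)\<^sup>2) / 4)) = (\<integral>\<^sup>+\<xi>. ennreal (exp (\<Sum>j<d. g Y j / sqrt 2 * \<xi> j)) \<partial>Q)" for Y
  proof -
    have "(\<integral>\<^sup>+\<xi>. ennreal (exp (\<Sum>j<d. g Y j / sqrt 2 * \<xi> j)) \<partial>Q) =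
       (\<integral>\<^sup>+\<xi>. (\<Prod>j<d. ennreal (exp (g Y j / sqrt 2 * \<xi> j))) \<partial>Q)"
      by (simp add: exp_sum prod_ennreal)
    also have "\<dots> = (\<Prod>j<d. \<integral>\<^sup>+u. ennreal (exp (g Y j / sqrt 2 * u)) \<partial>N)"
      unfolding Q_def by (intro product_prob_nn_integral_prod pN) (auto simp: N_def)
    also have "\<dots> = (\<Prod>j<d. ennreal (exp ((g Y j)\<^sup>2 / 4)))"
    proof (intro prod.cong refl)
      fix j
      show "(\<integral>\<^sup>+u. ennreal (exp (g Y j / sqrt 2 * u)) \<partial>N) = ennreal (exp ((g Y j)\<^sup>2 / 4))"
      proof -
        have "(\<integral>\<^sup>+u. ennreal (exp (g Y j / sqrt 2 * (u - 0))) \<partial>N) = ennreal (exp ((g Y j / sqrt 2)\<^sup>2 / 2))"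
          unfolding N_def by (rule gauss_mgf_1)
        then show ?thesis unfolding diff_zero by (simp only: power_divide real_sqrt_pow2) simp
      qed
    qed
    also have "\<dots> = ennreal (exp ((\<Sum>j<d. (g Y j)\<^sup>2) / 4))"
      by (simp add: prod_ennreal exp_sum sum_divide_distrib)
    finally show ?thesis by simp
  qed
  \<comment> \<open>By orthonormality that coefficient vector has squared norm |\<xi>|^2 / 2, and
    half of it is the exponent |\<xi>|^2 / 4, which factorizes over the coordinates of
    \<xi>.\<close>
  have 2: "(\<integral>\<^sup>+Y. ennreal (exp (\<Sum>j<d. g Y j / sqrt 2 * \<xi> j)) \<partial>gauss_law n \<mu>) =
      (\<Prod>j<d. ennreal (exp ((\<xi> j)\<^sup>2 / 4)))" for \<xi>
    unfolding inner gauss_mgf orthonormal_sum_squares[OF assms]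
    by (simp add: power_divide sum_divide_distrib exp_sum prod_ennreal)
  have "(\<integral>\<^sup>+Y. ennreal (exp ((\<Sum>j<d. (g Y j)\<^sup>2) / 4)) \<partial>gauss_law n \<mu>) =
     (\<integral>\<^sup>+Y. (\<integral>\<^sup>+\<xi>. ennreal (exp (\<Sum>j<d. g Y j / sqrt 2 * \<xi> j)) \<partial>Q) \<partial>gauss_law n \<mu>)"
    by (simp only: 1)
  also have "\<dots> = (\<integral>\<^sup>+\<xi>. (\<integral>\<^sup>+Y. ennreal (exp (\<Sum>j<d. g Y j / sqrt 2 * \<xi> j)) \<partial>gauss_law n \<mu>) \<partial>Q)"
    by (rule QG.Fubini'[where f = "\<lambda>\<xi> Y. ennreal (exp (\<Sum>j<d. g Y j / sqrt 2 * \<xi> j))"]) measurable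
  also have "\<dots> = (\<integral>\<^sup>+\<xi>. (\<Prod>j<d. ennreal (exp ((\<xi> j)\<^sup>2 / 4))) \<partial>Q)"
    by (simp only: 2)
  also have "\<dots> = (\<Prod>j<d. \<integral>\<^sup>+u. ennreal (exp (u\<^sup>2 / 4)) \<partial>N)"
    unfolding Q_def by (intro product_prob_nn_integral_prod pN) (auto simp: N_def)
  also have "\<dots> = ennreal (sqrt 2 ^ d)"
    unfolding N_def gauss_chi_1 by (simp add: ennreal_power)
  finally show ?thesis unfolding g_def .
qed

text \<open>Uniform control of the likelihood ratio over a linear space: the score is at most the norm of the
  projected noise times the distance, and \<open>s t \<le> s\<^sup>2 + t\<^sup>2 / 4\<close>.\<close>

lemma lratio_span_bound:
  assumes "finite \<Phi>"
  obtains g where "g \<in> borel_measurable (gauss_law n \<mu>)"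
    and "(\<integral>\<^sup>+Y. ennreal (exp (g Y / 4)) \<partial>gauss_law n \<mu>) \<le> ennreal (sqrt 2 ^ (card \<Phi> + 1))"
    and "\<And>v Y. in_span n \<Phi> v \<Longrightarrow> lratio n \<mu> v Y \<le> exp (g Y - (\<Sum>i=1..n. (v i - \<mu> i)\<^sup>2) / 4)"
proof -
  \<comment> \<open>The truth \<mu> joins the spanning family, so that the differences v - \<mu>
    have coordinates in the orthonormal basis; this costs the one extra dimension in the
    bound.\<close>
  obtain d e where d: "d \<le> card (insert \<mu> \<Phi>)" and on: "orthonormal_family n d e"
    and sp: "\<forall>\<phi>\<in>insert \<mu> \<Phi>. \<exists>c. \<forall>i\<in>{1..n}. \<phi> i = (\<Sum>j<d. c j * e j i)"
    using gram_schmidt[of "insert \<mu> \<Phi>" n] assms by auto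
  from sp obtain C where C: "\<And>\<phi> i. \<phi> \<in> insert \<mu> \<Phi> \<Longrightarrow> i \<in> {1..n} \<Longrightarrow> \<phi> i = (\<Sum>j<d. C \<phi> j * e j i)"
    by metis
  define z where "z Y j = (\<Sum>i=1..n. e j i * (Y i - \<mu> i))" for Y :: "nat \<Rightarrow> real" and j
  define g where "g Y = (\<Sum>j<d. (z Y j)\<^sup>2)" for Y
  show ?thesis
  proof
    show "g \<in> borel_measurable (gauss_law n \<mu>)" unfolding g_def z_def by measurable
    have "(\<integral>\<^sup>+Y. ennreal (exp (g Y / 4)) \<partial>gauss_law n \<mu>) = ennreal (sqrt 2 ^ d)"
      unfolding g_def z_def by (rule chi_square_mgf[OF on])
    also have "d \<le> card \<Phi> + 1" using d card_insert_le_m1[of "card \<Phi> + 1" \<Phi> \<mu>] by simp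
    then have "ennreal (sqrt 2 ^ d) \<le> ennreal (sqrt 2 ^ (card \<Phi> + 1))"
      by (intro ennreal_leI power_increasing) auto
    finally show "(\<integral>\<^sup>+Y. ennreal (exp (g Y / 4)) \<partial>gauss_law n \<mu>) \<le> ennreal (sqrt 2 ^ (card \<Phi> + 1))" .
  next
    fix v Y assume "in_span n \<Phi> v"
    then obtain c where c: "\<And>i. i \<in> {1..n} \<Longrightarrow> v i = (\<Sum>\<phi>\<in>\<Phi>. c \<phi> * \<phi> i)"
      unfolding in_span_def by blast
    define w where "w j = (\<Sum>\<phi>\<in>\<Phi>. c \<phi> * C \<phi> j) - C \<mu> j" for j
    have vw: "v i - \<mu> i = (\<Sum>j<d. w j * e j i)" if i: "i \<in> {1..n}" for i
    proof -
      have "v i = (\<Sum>\<phi>\<in>\<Phi>. c \<phi> * (\<Sum>j<d. C \<phi> j * e j i))"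
        unfolding c[OF i] using C i by (intro sum.cong refl) auto
      also have "\<dots> = (\<Sum>j<d. (\<Sum>\<phi>\<in>\<Phi>. c \<phi> * C \<phi> j) * e j i)"
        by (simp add: sum_distrib_left sum_distrib_right mult.assoc) (rule sum.swap)
      finally have v: "v i = (\<Sum>j<d. (\<Sum>\<phi>\<in>\<Phi>. c \<phi> * C \<phi> j) * e j i)" .
      have m: "\<mu> i = (\<Sum>j<d. C \<mu> j * e j i)" using C i by auto
      have "v i - \<mu> i = (\<Sum>j<d. (\<Sum>\<phi>\<in>\<Phi>. c \<phi> * C \<phi> j) * e j i) - (\<Sum>j<d. C \<mu> j * e j i)"
        using v m by simp
      then show ?thesis by (simp add: w_def left_diff_distrib sum_subtractf)
    qed
    have n2: "(\<Sum>i=1..n. (v i - \<mu> i)\<^sup>2) = (\<Sum>j<d. (w j)\<^sup>2)"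
      unfolding orthonormal_sum_squares[OF on, of w, symmetric] by (intro sum.cong refl) (simp only: vw)
    have "(\<Sum>i=1..n. (v i - \<mu> i) * (Y i - \<mu> i)) = (\<Sum>i=1..n. \<Sum>j<d. w j * (e j i * (Y i - \<mu> i)))"
      by (intro sum.cong refl) (simp add: vw sum_distrib_right mult.assoc)
    also have "\<dots> = (\<Sum>j<d. w j * z Y j)"
      by (subst sum.swap) (simp add: z_def sum_distrib_left)
    also have "\<dots> \<le> (\<Sum>j<d. (z Y j)\<^sup>2 + (w j)\<^sup>2 / 4)"
    proof (rule sum_mono)
      fix j
      have "0 \<le> (z Y j - w j / 2)\<^sup>2" by simp
      then show "w j * z Y j \<le> (z Y j)\<^sup>2 + (w j)\<^sup>2 / 4" by (simp add: power2_eq_square field_simps)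
    qed
    also have "\<dots> = g Y + (\<Sum>j<d. (w j)\<^sup>2) / 4"
      by (simp add: g_def sum.distrib sum_divide_distrib)
    finally show "lratio n \<mu> v Y \<le> exp (g Y - (\<Sum>i=1..n. (v i - \<mu> i)\<^sup>2) / 4)"
      unfolding lratio_def n2 by simp
  qed
qed


section \<open>Counting and constructing tree partitions\<close>

lemma tree_partition_partition:
  "tree_partition p n x K J P \<Longrightarrow> \<Union>P = cube p \<and> disjoint P"
proof (induction rule: tree_partition.induct)
  case root
  show ?case by (simp add: disjoint_def)
next
  case (split K J P \<Omega> j i \<tau>)
  have lu: "lower_cell j \<tau> \<Omega> \<union> upper_cell j \<tau> \<Omega> = \<Omega>" "lower_cell j \<tau> \<Omega> \<inter> upper_cell j \<tau> \<Omega> = {}"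
    by (auto simp: lower_cell_def upper_cell_def)
  have dis: "\<Omega>' \<inter> \<Omega> = {}" if "\<Omega>' \<in> P - {\<Omega>}" for \<Omega>'
    using split that by (auto simp: disjoint_def)
  have "disjoint (P - {\<Omega>} \<union> {lower_cell j \<tau> \<Omega>, upper_cell j \<tau> \<Omega>})"
    unfolding disjoint_def
  proof (intro ballI impI)
    fix A B assume AB: "A \<in> P - {\<Omega>} \<union> {lower_cell j \<tau> \<Omega>, upper_cell j \<tau> \<Omega>}"
      "B \<in> P - {\<Omega>} \<union> {lower_cell j \<tau> \<Omega>, upper_cell j \<tau> \<Omega>}" "A \<noteq> B"
    consider "A \<in> P - {\<Omega>}" "B \<in> P - {\<Omega>}" | "A \<in> P - {\<Omega>}" "B \<subseteq> \<Omega>" | "B \<in> P - {\<Omega>}" "A \<subseteq> \<Omega>"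
      | "A = lower_cell j \<tau> \<Omega>" "B = upper_cell j \<tau> \<Omega>" | "B = lower_cell j \<tau> \<Omega>" "A = upper_cell j \<tau> \<Omega>"
      using AB lu by blast
    then show "A \<inter> B = {}"
    proof cases
      case 1 then show ?thesis using split AB(3) by (auto simp: disjoint_def)
    qed (use dis lu in blast)+
  qed
  moreover have "\<Union>(P - {\<Omega>} \<union> {lower_cell j \<tau> \<Omega>, upper_cell j \<tau> \<Omega>}) = \<Union>P"
    using lu split by blast
  ultimately show ?case using split by simp
qed

text \<open>Only an inequality: a split may create an empty cell, and repeated empty cells merge in
  the set \<open>P\<close>.\<close>

lemma tree_partition_finite: "tree_partition p n x K J P \<Longrightarrow> finite P \<and> card P \<le> K"
proof (induction rule: tree_partition.induct)
  case root
  show ?case by simp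
next
  case (split K J P \<Omega> j i \<tau>)
  have "card (P - {\<Omega>} \<union> {lower_cell j \<tau> \<Omega>, upper_cell j \<tau> \<Omega>}) \<le>
      card (P - {\<Omega>}) + card {lower_cell j \<tau> \<Omega>, upper_cell j \<tau> \<Omega>}"
    by (rule card_Un_le)
  also have "card (P - {\<Omega>}) = card P - 1" using split by simp
  also have "card {lower_cell j \<tau> \<Omega>, upper_cell j \<tau> \<Omega>} \<le> 2" by (simp add: card_insert_if)
  finally have "card (P - {\<Omega>} \<union> {lower_cell j \<tau> \<Omega>, upper_cell j \<tau> \<Omega>}) \<le> card P - 1 + 2"
    by simp
  moreover have "card P > 0" using split by (auto simp: card_gt_0_iff)
  ultimately show ?case using split by auto
qed

text \<open>Each split adds at most one coordinate. This ties dimension to size: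
  \<open>card J < K\<close> lets the tree count be bounded without reference to the subset, and it
  separates one-cell trees from those with at least two cells.\<close>

lemma tree_partition_coords:
  "tree_partition p n x K J P \<Longrightarrow> finite J \<and> J \<subseteq> {1..p} \<and> card J < K \<and> (J = {} \<longrightarrow> K = 1 \<and> P = {cube p})"
  by (induction rule: tree_partition.induct) (auto simp: card_insert_if)

lemma tree_partition_card:
  "tree_partition p n x K J P \<Longrightarrow> {} \<notin> P \<Longrightarrow> card P = K"
proof (induction rule: tree_partition.induct)
  case root
  show ?case by simp
next
  case (split K J P \<Omega> j i \<tau>)
  let ?l = "lower_cell j \<tau> \<Omega>" and ?u = "upper_cell j \<tau> \<Omega>"
  have sub: "?l \<subseteq> \<Omega>" "?u \<subseteq> \<Omega>" "?l \<inter> ?u = {}"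
    by (auto simp: lower_cell_def upper_cell_def)
  have ne: "?l \<noteq> {}" "?u \<noteq> {}" "{} \<notin> P - {\<Omega>}" using split.prems by auto
  have "{} \<notin> P" using ne sub by auto
  then have K: "card P = K" using split by simp
  have fin: "finite P" using tree_partition_finite split by blast
  have dis: "\<Omega>' \<inter> \<Omega> = {}" if "\<Omega>' \<in> P - {\<Omega>}" for \<Omega>'
    using tree_partition_partition[OF split(1)] split(2) that by (auto simp: disjoint_def)
  have "?l \<notin> P - {\<Omega>}" using dis[of ?l] sub ne by blast
  moreover have "?u \<notin> P - {\<Omega>}" using dis[of ?u] sub ne by blast
  moreover have "?l \<noteq> ?u" using sub ne by blast
  ultimately have "card (insert ?l (insert ?u (P - {\<Omega>}))) = Suc (Suc (card (P - {\<Omega>})))"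
    using fin by simp
  also have "card (P - {\<Omega>}) = K - 1" using split K by simp
  also have "Suc (Suc (K - 1)) = Suc K" using K split fin card_gt_0_iff[of P] by auto
  finally show ?case by (simp add: Un_commute)
qed

text \<open>Undo the last split: a tree arises from a smaller one by choosing a cell, a coordinate
  in \<open>S\<close> and a data point that supplies the threshold.\<close>

lemma card_tree_partitions:
  assumes S: "finite S"
  shows "finite {P. \<exists>J\<subseteq>S. tree_partition p n x (Suc K) J P} \<and>
    card {P. \<exists>J\<subseteq>S. tree_partition p n x (Suc K) J P} \<le> (Suc K * card S * n) ^ K"
proof (induction K)
  case 0
  have "{P. \<exists>J\<subseteq>S. tree_partition p n x (Suc 0) J P} \<subseteq> {{cube p}}"
  proof clarify
    fix P J assume "tree_partition p n x (Suc 0) J P"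
    then show "P = {cube p}"
      by (cases) (auto dest: tree_partition_coords)
  qed
  then show ?case by (auto intro: finite_subset dest: card_mono[rotated])
next
  case (Suc K)
  let ?T = "\<lambda>K. {P. \<exists>J\<subseteq>S. tree_partition p n x K J P}"
  let ?f = "\<lambda>P (\<Omega>, j, i). P - {\<Omega>} \<union> {lower_cell j (x i j) \<Omega>, upper_cell j (x i j) \<Omega>}"
  let ?U = "\<Union>P\<in>?T (Suc K). ?f P ` (P \<times> S \<times> {1..n})"
  have sub: "?T (Suc (Suc K)) \<subseteq> ?U"
  proof clarify
    fix P J assume "tree_partition p n x (Suc (Suc K)) J P" "J \<subseteq> S"
    then show "P \<in> ?U"
    proof cases
      case (split J' P' \<Omega> j i \<tau>)
      then have "P' \<in> ?T (Suc K)" using \<open>J \<subseteq> S\<close> by auto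
      moreover have "P = ?f P' (\<Omega>, j, i)" using split by simp
      moreover have "(\<Omega>, j, i) \<in> P' \<times> S \<times> {1..n}" using split \<open>J \<subseteq> S\<close> by auto
      ultimately show ?thesis by blast
    qed auto
  qed
  have fc: "finite P \<and> card P \<le> Suc K" if "P \<in> ?T (Suc K)" for P
    using that tree_partition_finite by blast
  have fin: "finite ?U" using Suc fc S by auto
  have "card (?T (Suc (Suc K))) \<le> card ?U" by (rule card_mono[OF fin sub])
  also have "\<dots> \<le> (\<Sum>P\<in>?T (Suc K). card (?f P ` (P \<times> S \<times> {1..n})))"
    using Suc by (intro card_UN_le) auto
  also have "\<dots> \<le> (\<Sum>P\<in>?T (Suc K). Suc K * card S * n)"
  proof (intro sum_mono)
    fix P assume P: "P \<in> ?T (Suc K)"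
    have "card (?f P ` (P \<times> S \<times> {1..n})) \<le> card (P \<times> S \<times> {1..n})"
      using fc[OF P] S by (intro card_image_le) auto
    also have "\<dots> = card P * (card S * n)" by (simp add: card_cartesian_product)
    also have "\<dots> \<le> Suc K * (card S * n)" using fc[OF P] by (intro mult_right_mono) auto
    finally show "card (?f P ` (P \<times> S \<times> {1..n})) \<le> Suc K * card S * n" by (simp only: mult.assoc)
  qed
  also have "\<dots> = card (?T (Suc K)) * (Suc K * card S * n)" by simp
  also have "\<dots> \<le> (Suc K * card S * n) ^ K * (Suc K * card S * n)"
    using Suc by (intro mult_right_mono) auto
  also have "\<dots> = (Suc K * card S * n) ^ Suc K" by (simp only: power_Suc2)
  also have "\<dots> \<le> (Suc (Suc K) * card S * n) ^ Suc K" by (intro power_mono mult_right_mono) auto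
  finally show ?case using finite_subset[OF sub fin] by simp
qed

lemma card_valid_trees:
  "finite (valid_trees p n x Cbar K S) \<and> card (valid_trees p n x Cbar K S) \<le> (K * card S * n) ^ (K - 1)"
proof (cases "valid_trees p n x Cbar K S = {}")
  case False
  then obtain P where "tree_partition p n x K S P" by (auto simp: valid_trees_def)
  then have S: "finite S" "K > 0" using tree_partition_coords by fastforce+
  have sub: "valid_trees p n x Cbar K S \<subseteq> {P. \<exists>J\<subseteq>S. tree_partition p n x (Suc (K - 1)) J P}"
    using S by (auto simp: valid_trees_def)
  show ?thesis
    using card_tree_partitions[OF S(1), of p n x "K - 1"] card_mono[OF _ sub] finite_subset[OF sub] S(2) by auto
qed simp

text \<open>Remove the head of size K: there are at most w^(K-1) w^(m-K) = w^(m-1) lists with such a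
  head. K takes at most m - 1 values and the empty list adds one, so the total is at most m w^(m-1).
  The factor w saved in counting the head pays for m, since m \<le> k \<le> w.\<close>

lemma card_weighted_lists:
  fixes V :: "nat \<Rightarrow> 'a set"
  assumes V: "\<And>K. 2 \<le> K \<Longrightarrow> K \<le> k \<Longrightarrow> finite (V K) \<and> card (V K) \<le> w ^ (K - 1)"
    and w: "k \<le> w" "1 \<le> w" and m: "m \<le> k"
  shows "finite {Ps. \<exists>Ks. list_all2 (\<lambda>P K. P \<in> V K \<and> 2 \<le> K) Ps Ks \<and> sum_list Ks \<le> m} \<and>
    card {Ps. \<exists>Ks. list_all2 (\<lambda>P K. P \<in> V K \<and> 2 \<le> K) Ps Ks \<and> sum_list Ks \<le> m} \<le> w ^ m"
  using m
proof (induction m rule: less_induct)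
  case (less m)
  let ?L = "\<lambda>m. {Ps. \<exists>Ks. list_all2 (\<lambda>P K. P \<in> V K \<and> 2 \<le> K) Ps Ks \<and> sum_list Ks \<le> m}"
  let ?U = "\<Union>K\<in>{2..m}. (\<lambda>(P, Ps). P # Ps) ` (V K \<times> ?L (m - K))"
  have sub: "?L m \<subseteq> insert [] ?U"
  proof clarify
    fix Qs Ks assume a: "list_all2 (\<lambda>P K. P \<in> V K \<and> 2 \<le> K) Qs Ks" "sum_list Ks \<le> m" "Qs \<notin> ?U"
    show "Qs = []"
    proof (rule ccontr)
      assume "Qs \<noteq> []"
      then obtain P Ps K Ks' where eq: "Qs = P # Ps" "Ks = K # Ks'"
        and b: "P \<in> V K" "2 \<le> K" "list_all2 (\<lambda>P K. P \<in> V K \<and> 2 \<le> K) Ps Ks'"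
        using a(1) by (cases Qs; cases Ks) auto
      have "K \<le> m" "sum_list Ks' \<le> m - K" using a(2) eq by auto
      then have "(P, Ps) \<in> V K \<times> ?L (m - K)" "K \<in> {2..m}" using b by auto
      then have "Qs \<in> ?U" unfolding eq by blast
      then show False using a(3) by simp
    qed
  qed
  have IH: "finite (?L (m - K)) \<and> card (?L (m - K)) \<le> w ^ (m - K)" if "K \<in> {2..m}" for K
    using that less by (intro less.IH) auto
  have VK: "finite (V K) \<and> card (V K) \<le> w ^ (K - 1)" if "K \<in> {2..m}" for K
    using that less.prems by (intro V) auto
  have finU: "finite ?U" using IH VK by blast
  have "card ?U \<le> (\<Sum>K\<in>{2..m}. card ((\<lambda>(P, Ps). P # Ps) ` (V K \<times> ?L (m - K))))"
    by (intro card_UN_le) auto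
  also have "\<dots> \<le> (\<Sum>K\<in>{2..m}. w ^ (m - 1))"
  proof (intro sum_mono)
    fix K assume K: "K \<in> {2..m}"
    have "card ((\<lambda>(P, Ps). P # Ps) ` (V K \<times> ?L (m - K))) \<le> card (V K \<times> ?L (m - K))"
      using IH[OF K] VK[OF K] by (intro card_image_le) auto
    also have "\<dots> \<le> w ^ (K - 1) * w ^ (m - K)"
      unfolding card_cartesian_product using IH[OF K] VK[OF K] by (intro mult_mono) auto
    also have "\<dots> = w ^ (m - 1)" using K by (simp add: power_add[symmetric])
    finally show "card ((\<lambda>(P, Ps). P # Ps) ` (V K \<times> ?L (m - K))) \<le> w ^ (m - 1)" .
  qed
  also have "\<dots> = (m - 1) * w ^ (m - 1)" by simp
  finally have cU: "card ?U \<le> (m - 1) * w ^ (m - 1)" .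
  have "card (?L m) \<le> card (insert [] ?U)" using finU by (intro card_mono sub) auto
  also have "\<dots> \<le> 1 + (m - 1) * w ^ (m - 1)" using cU finU card_insert_if[of ?U "[]"] by (auto split: if_splits)
  also have "\<dots> \<le> w ^ m"
  proof (cases "m = 0")
    case False
    have "1 + (m - 1) * w ^ (m - 1) \<le> w ^ (m - 1) + (m - 1) * w ^ (m - 1)"
      using w by simp
    also have "\<dots> = m * w ^ (m - 1)" using False by (cases m) auto
    also have "\<dots> \<le> w * w ^ (m - 1)" using w less.prems by (intro mult_right_mono) auto
    also have "\<dots> = w ^ m" using False by (cases m) auto
    finally show ?thesis .
  qed simp
  finally show ?case using finite_subset[OF sub] finU by simp
qed

text \<open>A subset with at most q elements is read off a list of length q over {0..p}, with 0 as
  padding.\<close>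

lemma card_small_subsets:
  "finite {S. S \<subseteq> {1..p::nat} \<and> card S \<le> q} \<and> card {S. S \<subseteq> {1..p::nat} \<and> card S \<le> q} \<le> (p + 1) ^ q"
proof -
  let ?A = "{S. S \<subseteq> {1..p} \<and> card S \<le> q}"
  let ?X = "{xs. set xs \<subseteq> {0..p} \<and> length xs = q}"
  have sub: "?A \<subseteq> (\<lambda>xs. set xs - {0}) ` ?X"
  proof clarify
    fix S assume S: "S \<subseteq> {1..p}" "card S \<le> q"
    have fS: "finite S" using S finite_subset by blast
    let ?xs = "sorted_list_of_set S @ replicate (q - card S) 0"
    have "?xs \<in> ?X" using S fS by auto
    moreover have "S = set ?xs - {0}" using S fS by auto
    ultimately show "S \<in> (\<lambda>xs. set xs - {0}) ` ?X" by blast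
  qed
  have fX: "finite ?X" by (intro finite_lists_length_eq) auto
  have "card ?A \<le> card ((\<lambda>xs. set xs - {0}) ` ?X)" using fX by (intro card_mono sub) auto
  also have "\<dots> \<le> card ?X" by (intro card_image_le fX)
  also have "\<dots> = (p + 1) ^ q" by (subst card_lists_length_eq) auto
  finally show ?thesis using finite_subset[OF sub] fX by auto
qed

text \<open>State of the construction of a tree along the label classes: \<open>B\<close> collects the few points that are given
  up because separating them would leave a cell with fewer than \<open>m\<close> points.\<close>

definition labelled_tree :: "nat \<Rightarrow> nat \<Rightarrow> (nat \<Rightarrow> point) \<Rightarrow> nat \<Rightarrow> nat set \<Rightarrow> (nat \<Rightarrow> 'l) \<Rightarrow>
    nat \<times> nat set \<times> cell set \<times> nat set \<Rightarrow> bool" where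
  "labelled_tree p n x m S lab = (\<lambda>(K, J, P, B).
     tree_partition p n x K J P \<and> J \<subseteq> S \<and> B \<subseteq> {1..n} \<and>
     (\<forall>\<Omega>\<in>P. num_points n x \<Omega> \<ge> m) \<and>
     (\<forall>\<Omega>\<in>P. \<exists>i\<in>{1..n} - B. x i \<in> \<Omega>) \<and>
     (\<forall>\<Omega>\<in>P. \<forall>i\<in>{1..n} - B. \<forall>i'\<in>{1..n} - B. lab i = lab i' \<longrightarrow> x i \<in> \<Omega> \<longrightarrow> x i' \<in> \<Omega>) \<and>
     card B + m * card (lab ` ({1..n} - B)) \<le> m * card (lab ` {1..n}))"

text \<open>Call a point live if it is outside \<open>B\<close>. Every cell holds a live point, and
  live points of equal label share a cell, so choosing the label of one live point per cell is
  injective.\<close>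

lemma labelled_tree_size:
  assumes "labelled_tree p n x m S lab (K, J, P, B)"
  shows "K \<le> card (lab ` ({1..n} - B))"
proof -
  have tp: "tree_partition p n x K J P" and pt: "\<forall>\<Omega>\<in>P. \<exists>i\<in>{1..n} - B. x i \<in> \<Omega>"
    and same: "\<And>\<Omega> i i'. \<Omega> \<in> P \<Longrightarrow> i \<in> {1..n} - B \<Longrightarrow> i' \<in> {1..n} - B \<Longrightarrow> lab i = lab i' \<Longrightarrow> x i \<in> \<Omega> \<Longrightarrow> x i' \<in> \<Omega>"
    using assms unfolding labelled_tree_def case_prod_conv by blast+
  from pt obtain h where h: "\<And>\<Omega>. \<Omega> \<in> P \<Longrightarrow> h \<Omega> \<in> {1..n} - B \<and> x (h \<Omega>) \<in> \<Omega>" by metis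
  have "inj_on (\<lambda>\<Omega>. lab (h \<Omega>)) P"
  proof (rule inj_onI)
    fix A C assume AC: "A \<in> P" "C \<in> P" "lab (h A) = lab (h C)"
    have "x (h A) \<in> C" using same[OF AC(2), of "h C" "h A"] h AC by auto
    moreover have "x (h A) \<in> A" using h AC by blast
    ultimately show "A = C"
      using tree_partition_partition[OF tp] AC(1,2) unfolding disjoint_def by blast
  qed
  then have "card P \<le> card (lab ` ({1..n} - B))"
    using h by (intro card_inj_on_le[of "\<lambda>\<Omega>. lab (h \<Omega>)"]) auto
  moreover have "card P = K" using h by (intro tree_partition_card[OF tp]) auto
  ultimately show ?thesis by simp
qed

text \<open>The partition stays as it is. \<open>D\<close> is a union of live label classes inside
  one cell, so giving it up retires at least one label, and that label pays for the at most
  \<open>m\<close> points added to \<open>B\<close>. The survivor \<open>i2\<close> keeps the cell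
  populated.\<close>

lemma labelled_tree_discard:
  assumes inv: "labelled_tree p n x m S lab (K, J, P, B)" and \<Omega>: "\<Omega> \<in> P"
    and D: "D \<subseteq> {i \<in> {1..n} - B. x i \<in> \<Omega>}" "card D \<le> m" "i1 \<in> D"
    and closed: "\<And>i i'. i \<in> D \<Longrightarrow> i' \<in> {1..n} - B \<Longrightarrow> x i' \<in> \<Omega> \<Longrightarrow> lab i = lab i' \<Longrightarrow> i' \<in> D"
    and i2: "i2 \<in> {1..n} - B" "x i2 \<in> \<Omega>" "i2 \<notin> D"
  shows "labelled_tree p n x m S lab (K, J, P, B \<union> D) \<and>
    card (lab ` ({1..n} - (B \<union> D))) < card (lab ` ({1..n} - B))"
proof -
  have tp: "tree_partition p n x K J P" and J: "J \<subseteq> S" and B: "B \<subseteq> {1..n}"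
    and num: "\<forall>\<Omega>\<in>P. num_points n x \<Omega> \<ge> m"
    and pt: "\<forall>\<Omega>\<in>P. \<exists>i\<in>{1..n} - B. x i \<in> \<Omega>"
    and same: "\<And>\<Omega> i i'. \<Omega> \<in> P \<Longrightarrow> i \<in> {1..n} - B \<Longrightarrow> i' \<in> {1..n} - B \<Longrightarrow> lab i = lab i' \<Longrightarrow> x i \<in> \<Omega> \<Longrightarrow> x i' \<in> \<Omega>"
    and cnt: "card B + m * card (lab ` ({1..n} - B)) \<le> m * card (lab ` {1..n})"
    using inv unfolding labelled_tree_def case_prod_conv by blast+
  have dis: "\<Omega>' \<inter> \<Omega> = {}" if "\<Omega>' \<in> P" "\<Omega>' \<noteq> \<Omega>" for \<Omega>'
    using tree_partition_partition[OF tp] \<Omega> that by (auto simp: disjoint_def)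
  have pt': "\<exists>i\<in>{1..n} - (B \<union> D). x i \<in> \<Omega>'" if "\<Omega>' \<in> P" for \<Omega>'
  proof (cases "\<Omega>' = \<Omega>")
    case True then show ?thesis using i2 by (intro bexI[of _ i2]) auto
  next
    case False
    from bspec[OF pt that] obtain i where i: "i \<in> {1..n} - B" "x i \<in> \<Omega>'" by (rule bexE)
    then have "x i \<notin> \<Omega>" using dis[OF that False] by auto
    then have "i \<notin> D" using D(1) by auto
    then show ?thesis using i by (intro bexI[of _ i]) auto
  qed
  have "lab i1 \<notin> lab ` ({1..n} - (B \<union> D))"
  proof
    assume "lab i1 \<in> lab ` ({1..n} - (B \<union> D))"
    then obtain i where i: "i \<in> {1..n} - (B \<union> D)" "lab i1 = lab i" by (rule imageE)
    have ii: "i \<in> {1..n} - B" "i1 \<in> {1..n} - B" "x i1 \<in> \<Omega>" using i(1) D by auto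
    have "x i \<in> \<Omega>" by (rule same[OF \<Omega> ii(2,1) i(2) ii(3)])
    then have "i \<in> D" by (rule closed[OF D(3) ii(1) _ i(2)])
    then show False using i by simp
  qed
  moreover have "lab i1 \<in> lab ` ({1..n} - B)" using D by auto
  ultimately have "lab ` ({1..n} - (B \<union> D)) \<subset> lab ` ({1..n} - B)" by blast
  then have lt: "card (lab ` ({1..n} - (B \<union> D))) < card (lab ` ({1..n} - B))"
    by (intro psubset_card_mono) auto
  have "card (B \<union> D) + m * card (lab ` ({1..n} - (B \<union> D))) \<le> card B + card D + m * card (lab ` ({1..n} - (B \<union> D)))"
    using card_Un_le[of B D] by simp
  also have "\<dots> \<le> card B + m * Suc (card (lab ` ({1..n} - (B \<union> D))))" using D(2) by simp
  also have "\<dots> \<le> card B + m * card (lab ` ({1..n} - B))"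
    using lt by (intro add_left_mono mult_left_mono) auto
  also note cnt
  finally have cnt': "card (B \<union> D) + m * card (lab ` ({1..n} - (B \<union> D))) \<le> m * card (lab ` {1..n})" .
  show ?thesis
    unfolding labelled_tree_def case_prod_conv
    using tp J num pt' cnt' lt B D(1) same by (intro conjI ballI impI) blast+
qed

lemma labelled_tree_split:
  assumes inv: "labelled_tree p n x m S lab (K, J, P, B)" and \<Omega>: "\<Omega> \<in> P"
    and j: "j \<in> S" "j \<in> {1..p}" and i: "i \<in> {1..n}" and \<tau>: "\<tau> = x i j"
    and num': "num_points n x (lower_cell j \<tau> \<Omega>) \<ge> m" "num_points n x (upper_cell j \<tau> \<Omega>) \<ge> m"
    and i1: "i1 \<in> {1..n} - B" "x i1 \<in> lower_cell j \<tau> \<Omega>" and i2: "i2 \<in> {1..n} - B" "x i2 \<in> upper_cell j \<tau> \<Omega>"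
    and sep: "\<And>i i'. i \<in> {1..n} - B \<Longrightarrow> i' \<in> {1..n} - B \<Longrightarrow> x i \<in> \<Omega> \<Longrightarrow> x i' \<in> \<Omega> \<Longrightarrow> lab i = lab i' \<Longrightarrow>
        x i j \<le> \<tau> \<longleftrightarrow> x i' j \<le> \<tau>"
  shows "labelled_tree p n x m S lab
    (Suc K, insert j J, P - {\<Omega>} \<union> {lower_cell j \<tau> \<Omega>, upper_cell j \<tau> \<Omega>}, B)"
proof -
  let ?P = "P - {\<Omega>} \<union> {lower_cell j \<tau> \<Omega>, upper_cell j \<tau> \<Omega>}"
  have tp: "tree_partition p n x K J P" and J: "J \<subseteq> S" and B: "B \<subseteq> {1..n}"
    and num: "\<forall>\<Omega>\<in>P. num_points n x \<Omega> \<ge> m"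
    and pt: "\<forall>\<Omega>\<in>P. \<exists>i\<in>{1..n} - B. x i \<in> \<Omega>"
    and same: "\<And>\<Omega> i i'. \<Omega> \<in> P \<Longrightarrow> i \<in> {1..n} - B \<Longrightarrow> i' \<in> {1..n} - B \<Longrightarrow> lab i = lab i' \<Longrightarrow> x i \<in> \<Omega> \<Longrightarrow> x i' \<in> \<Omega>"
    and cnt: "card B + m * card (lab ` ({1..n} - B)) \<le> m * card (lab ` {1..n})"
    using inv unfolding labelled_tree_def case_prod_conv by blast+
  have t1: "tree_partition p n x (Suc K) (insert j J) ?P"
    using tp \<Omega> j(2) i \<tau> by (rule tree_partition.split)
  have t2: "\<forall>\<Omega>\<in>?P. num_points n x \<Omega> \<ge> m" using num num' by auto
  have t3: "\<forall>\<Omega>\<in>?P. \<exists>i\<in>{1..n} - B. x i \<in> \<Omega>" using pt i1 i2 by blast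
  have t4: "x i' \<in> A" if "A \<in> ?P" "i \<in> {1..n} - B" "i' \<in> {1..n} - B" "lab i = lab i'" "x i \<in> A" for A i i'
  proof -
    have "A \<in> P \<or> A = lower_cell j \<tau> \<Omega> \<or> A = upper_cell j \<tau> \<Omega>" using that(1) by auto
    then consider "A \<in> P" | "A = lower_cell j \<tau> \<Omega>" | "A = upper_cell j \<tau> \<Omega>" by (elim disjE)
    then show ?thesis
    proof cases
      case 1 then show ?thesis using same that by blast
    next
      case 2
      then have "x i \<in> \<Omega>" "x i j \<le> \<tau>" using that by (auto simp: lower_cell_def)
      then show ?thesis using 2 same[OF \<Omega> that(2,3,4)] sep[OF that(2,3)] that by (auto simp: lower_cell_def)
    next
      case 3
      then have "x i \<in> \<Omega>" "\<not> x i j \<le> \<tau>" using that by (auto simp: upper_cell_def)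
      then show ?thesis using 3 same[OF \<Omega> that(2,3,4)] sep[OF that(2,3)] that by (auto simp: upper_cell_def)
    qed
  qed
  show ?thesis
    unfolding labelled_tree_def case_prod_conv
  proof (intro conjI t1 t2 t3 B cnt)
    show "insert j J \<subseteq> S" using J j by simp
    show "\<forall>\<Omega>\<in>?P. \<forall>i\<in>{1..n} - B. \<forall>i'\<in>{1..n} - B. lab i = lab i' \<longrightarrow> x i \<in> \<Omega> \<longrightarrow> x i' \<in> \<Omega>"
      by (intro ballI impI) (rule t4)
  qed
qed

text \<open>An extremal argument: in a state with least measure \<open>ms\<close>, no cell contains
  live points with different labels, since otherwise the cell could be split or one side of the
  split discarded, and both lower the measure.\<close>

lemma separating_tree_exists:
  fixes label :: "real \<Rightarrow> nat"
  defines "lab \<equiv> \<lambda>S x (i::nat). restrict (\<lambda>j. label (x i j)) S"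
  assumes data: "x ` {1..n} \<subseteq> cube p" and S: "S \<subseteq> {1..p}"
    and m: "m \<ge> 1" "m \<le> n" and Cbar: "Cbar\<^sup>2 = real m" and label: "mono label"
  shows "\<exists>K J P B. P \<in> valid_trees p n x Cbar K J \<and> J \<subseteq> S \<and> K \<le> card (lab S x ` {1..n}) \<and>
    B \<subseteq> {1..n} \<and> card B \<le> m * card (lab S x ` {1..n}) \<and>
    (\<forall>\<Omega>\<in>P. \<exists>i\<in>{1..n} - B. x i \<in> \<Omega>) \<and>
    (\<forall>\<Omega>\<in>P. \<forall>i\<in>{1..n} - B. \<forall>i'\<in>{1..n} - B. x i \<in> \<Omega> \<longrightarrow> x i' \<in> \<Omega> \<longrightarrow> (\<forall>j\<in>S. label (x i j) = label (x i' j)))"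
proof -
  let ?lab = "lab S x"
  let ?I = "labelled_tree p n x m S ?lab"
  \<comment> \<open>A split raises K, a discard lowers the number of live labels. Since K is at most
    the number of live labels, the factor 2 keeps the natural-number subtraction positive as long as
    some label is live, so both moves decrease \<open>ms\<close> strictly.\<close>
  define ms where "ms = (\<lambda>(K, J :: nat set, P :: cell set, B). 2 * card (?lab ` ({1..n} - B)) - K)"
  have design: "x i \<in> cube p" if "i \<in> {1..n}" for i using data that by auto
  have all: "{i. Suc 0 \<le> i \<and> i \<le> n \<and> x i \<in> cube p} = {1..n}" using design by auto
  have "?I (1, {}, {cube p}, {})"
    using m design by (auto simp: labelled_tree_def num_points_def all intro: tree_partition.root[simplified] intro!: bexI[of _ 1])
  from ex_has_least_nat[of ?I, OF this, of ms] obtain K J P B where inv: "?I (K, J, P, B)"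
    and least: "\<And>s. ?I s \<Longrightarrow> ms (K, J, P, B) \<le> ms s" by (metis prod_cases4)
  have tp: "tree_partition p n x K J P" and J: "J \<subseteq> S" and B: "B \<subseteq> {1..n}"
    and num: "\<And>\<Omega>. \<Omega> \<in> P \<Longrightarrow> num_points n x \<Omega> \<ge> m"
    and pt: "\<forall>\<Omega>\<in>P. \<exists>i\<in>{1..n} - B. x i \<in> \<Omega>"
    and cnt: "card B + m * card (?lab ` ({1..n} - B)) \<le> m * card (?lab ` {1..n})"
    using inv unfolding labelled_tree_def case_prod_conv by blast+
  have size: "K \<le> card (?lab ` ({1..n} - B))" by (rule labelled_tree_size[OF inv])
  \<comment> \<open>Stated for ordered pairs; exchanging \<open>i1\<close> and \<open>i2\<close> at
    the end gives equality of the labels.\<close>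
  have le: "label (x i1 j) \<ge> label (x i2 j)"
    if \<Omega>: "\<Omega> \<in> P" and i1: "i1 \<in> {1..n} - B" "x i1 \<in> \<Omega>" and i2: "i2 \<in> {1..n} - B" "x i2 \<in> \<Omega>" and j: "j \<in> S"
    for \<Omega> i1 i2 j
  proof (rule ccontr)
    assume "\<not> label (x i2 j) \<le> label (x i1 j)"
    then have lt: "label (x i1 j) < label (x i2 j)" by simp
    define C where "C = {i \<in> {1..n} - B. x i \<in> \<Omega>}"
    define Cl where "Cl = {i \<in> C. label (x i j) \<le> label (x i1 j)}"
    \<comment> \<open>The largest coordinate of the lower group is a data coordinate, as a split
      requires. Because \<open>label\<close> is monotone, thresholding there divides the live points
      of the cell exactly into \<open>Cl\<close> and \<open>C - Cl\<close>, cutting no label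
      class.\<close>
    define \<tau> where "\<tau> = Max ((\<lambda>i. x i j) ` Cl)"
    have fin: "finite C" "finite Cl" by (auto simp: C_def Cl_def)
    have mem: "i1 \<in> Cl" "i2 \<in> C" "i2 \<notin> Cl" using i1 i2 lt by (auto simp: C_def Cl_def)
    have "\<tau> \<in> (\<lambda>i. x i j) ` Cl" unfolding \<tau>_def using fin mem by (intro Max_in) auto
    then obtain i0 where i0: "i0 \<in> Cl" "\<tau> = x i0 j" by auto
    have low: "x i j \<le> \<tau> \<longleftrightarrow> i \<in> Cl" if "i \<in> C" for i
    proof
      assume "x i j \<le> \<tau>"
      then have "label (x i j) \<le> label (x i0 j)" using label i0 by (auto dest: monoD)
      then show "i \<in> Cl" using that i0 by (auto simp: Cl_def)
    next
      assume "i \<in> Cl" then show "x i j \<le> \<tau>" unfolding \<tau>_def using fin by (intro Max_ge) auto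
    qed
    have labj: "label (x i j) = label (x i' j)" if "?lab i = ?lab i'" for i i'
      using fun_cong[OF that, of j] j by (simp add: lab_def)
    have sep: "i \<in> Cl \<longleftrightarrow> i' \<in> Cl" if "i \<in> C" "i' \<in> C" "?lab i = ?lab i'" for i i'
      using that labj[OF that(3)] by (simp add: Cl_def)
    let ?l = "lower_cell j \<tau> \<Omega>" and ?u = "upper_cell j \<tau> \<Omega>"
    have Clc: "card Cl \<le> num_points n x ?l"
      unfolding num_points_def using low
      by (intro card_mono) (auto simp: C_def Cl_def lower_cell_def)
    have Cuc: "card (C - Cl) \<le> num_points n x ?u"
      unfolding num_points_def using low
      by (intro card_mono) (auto simp: C_def upper_cell_def not_le[symmetric])
    \<comment> \<open>\<open>num_points\<close> also counts points given up earlier. If a side has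
      fewer than \<open>m\<close> points in all, its live points are fewer than \<open>m\<close> too
      and can be discarded.\<close>
    consider "num_points n x ?l \<ge> m" "num_points n x ?u \<ge> m" | "num_points n x ?l < m" | "num_points n x ?u < m"
      by linarith
    then show False
    proof cases
      case 1
      have "?I (Suc K, insert j J, P - {\<Omega>} \<union> {?l, ?u}, B)"
        using inv \<Omega> j
      proof (rule labelled_tree_split)
        show "j \<in> {1..p}" using S j by auto
        show "i0 \<in> {1..n}" using i0 by (auto simp: Cl_def C_def)
        show "\<tau> = x i0 j" by (rule i0)
        show "i1 \<in> {1..n} - B" "i2 \<in> {1..n} - B" by fact+
        show "x i1 \<in> ?l" using low[of i1] mem i1 by (auto simp: lower_cell_def C_def)
        show "x i2 \<in> ?u" using low[of i2] mem i2 by (auto simp: upper_cell_def C_def)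
        show "x i j \<le> \<tau> \<longleftrightarrow> x i' j \<le> \<tau>" if "i \<in> {1..n} - B" "i' \<in> {1..n} - B" "x i \<in> \<Omega>" "x i' \<in> \<Omega>" "?lab i = ?lab i'" for i i'
          using low[of i] low[of i'] sep[of i i'] that by (auto simp: C_def)
      qed (use 1 in auto)
      note new = this
      have "ms (K, J, P, B) \<le> ms (Suc K, insert j J, P - {\<Omega>} \<union> {?l, ?u}, B)" by (rule least[OF new])
      moreover have "Suc K \<le> card (?lab ` ({1..n} - B))" by (rule labelled_tree_size[OF new])
      ultimately show False by (simp add: ms_def)
    next
      case 2
      have new: "?I (K, J, P, B \<union> Cl) \<and> card (?lab ` ({1..n} - (B \<union> Cl))) < card (?lab ` ({1..n} - B))"
        using inv \<Omega>
      proof (rule labelled_tree_discard)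
        show "Cl \<subseteq> {i \<in> {1..n} - B. x i \<in> \<Omega>}" by (auto simp: Cl_def C_def)
        show "card Cl \<le> m" using Clc 2 by simp
        show "i1 \<in> Cl" "i2 \<in> {1..n} - B" "x i2 \<in> \<Omega>" "i2 \<notin> Cl" by fact+
        show "i' \<in> Cl" if "i \<in> Cl" "i' \<in> {1..n} - B" "x i' \<in> \<Omega>" "?lab i = ?lab i'" for i i'
          using sep[of i i'] that by (auto simp: C_def Cl_def)
      qed
      then have "ms (K, J, P, B) \<le> ms (K, J, P, B \<union> Cl)" by (intro least) auto
      then show False using conjunct2[OF new] size unfolding ms_def case_prod_conv by arith
    next
      case 3
      have new: "?I (K, J, P, B \<union> (C - Cl)) \<and> card (?lab ` ({1..n} - (B \<union> (C - Cl)))) < card (?lab ` ({1..n} - B))"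
        using inv \<Omega>
      proof (rule labelled_tree_discard)
        show "C - Cl \<subseteq> {i \<in> {1..n} - B. x i \<in> \<Omega>}" by (auto simp: C_def)
        show "card (C - Cl) \<le> m" using Cuc 3 by simp
        show "i2 \<in> C - Cl" using mem by simp
        show "i1 \<in> {1..n} - B" "x i1 \<in> \<Omega>" "i1 \<notin> C - Cl" using i1 mem by auto
        show "i' \<in> C - Cl" if "i \<in> C - Cl" "i' \<in> {1..n} - B" "x i' \<in> \<Omega>" "?lab i = ?lab i'" for i i'
          using sep[of i i'] that by (auto simp: C_def)
      qed
      then have "ms (K, J, P, B) \<le> ms (K, J, P, B \<union> (C - Cl))" by (intro least) auto
      then show False using conjunct2[OF new] size unfolding ms_def case_prod_conv by arith
    qed
  qed
  have "cell_mass n x \<Omega> \<ge> Cbar\<^sup>2 / real n" if "\<Omega> \<in> P" for \<Omega>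
    using num[OF that] unfolding cell_mass_def Cbar by (intro divide_right_mono) auto
  then have "P \<in> valid_trees p n x Cbar K J" using tp by (simp add: valid_trees_def)
  moreover have "K \<le> card (?lab ` {1..n})"
  proof -
    have "card (?lab ` ({1..n} - B)) \<le> card (?lab ` {1..n})" by (intro card_mono) auto
    then show ?thesis using size by simp
  qed
  moreover have "card B \<le> m * card (?lab ` {1..n})" using cnt by simp
  moreover have "\<forall>\<Omega>\<in>P. \<forall>i\<in>{1..n} - B. \<forall>i'\<in>{1..n} - B. x i \<in> \<Omega> \<longrightarrow> x i' \<in> \<Omega> \<longrightarrow> (\<forall>j\<in>S. label (x i j) = label (x i' j))"
    using le by (meson dual_order.antisym)
  ultimately show ?thesis using J B pt by blast
qed


section \<open>Approximation of sparse Hoelder functions by trees along a regular grid\<close>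

lemma emp_sum_split:
  fixes h :: "nat \<Rightarrow> real"
  assumes "B \<subseteq> {1..n}" "card B \<le> b" "\<And>i. i \<in> B \<Longrightarrow> h i \<le> u" "\<And>i. i \<in> {1..n} - B \<Longrightarrow> h i \<le> w" "0 \<le> u" "0 \<le> w"
  shows "(\<Sum>i=1..n. h i) \<le> real b * u + real n * w"
proof -
  have fB: "finite B" using assms(1) finite_subset by blast
  have "(\<Sum>i=1..n. h i) = (\<Sum>i\<in>B. h i) + (\<Sum>i\<in>{1..n} - B. h i)"
    using sum.subset_diff[OF assms(1), of h] by simp
  also have "\<dots> \<le> real (card B) * u + real (card ({1..n} - B)) * w"
    using assms(3,4) by (intro add_mono sum_bounded_above) auto
  also have "\<dots> \<le> real b * u + real n * w"
  proof (intro add_mono mult_right_mono)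
    show "real (card ({1..n} - B)) \<le> real n" using card_mono[of "{1..n}" "{1..n} - B"] by simp
  qed (use assms in auto)
  finally show ?thesis .
qed

text \<open>The number of the left-open interval of length 1/N that contains \<open>u\<close>; the
  maximum with 1 puts u = 0 into the first interval.\<close>

definition grid_label :: "nat \<Rightarrow> real \<Rightarrow> nat" where
  "grid_label N u = max 1 (nat \<lceil>real N * u\<rceil>)"

lemma mono_grid_label: "mono (grid_label N)"
  unfolding grid_label_def mono_def by (intro allI impI max.mono nat_mono ceiling_mono mult_left_mono) auto

lemma grid_label_range:
  assumes "u \<in> {0..1}" "N \<ge> 1"
  shows "grid_label N u \<in> {1..N}"
proof -
  have "\<lceil>real N * u\<rceil> \<le> int N"
    using assms mult_left_mono[of u 1 "real N"] by (intro ceiling_le) auto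
  then show ?thesis using assms by (auto simp: grid_label_def)
qed

lemma grid_label_eq_dist:
  assumes "u \<in> {0..1}" "v \<in> {0..1}" "N \<ge> 1" "grid_label N u = grid_label N v"
  shows "\<bar>u - v\<bar> \<le> 1 / real N"
proof -
  have bounds: "real (grid_label N w) - 1 \<le> real N * w \<and> real N * w \<le> real (grid_label N w) \<or>
      grid_label N w = 1 \<and> 0 \<le> real N * w \<and> real N * w \<le> 1" if "w \<in> {0..1}" for w
  proof (cases "\<lceil>real N * w\<rceil> \<ge> 1")
    case True
    then have "1 \<le> nat \<lceil>real N * w\<rceil>" by linarith
    then have "grid_label N w = nat \<lceil>real N * w\<rceil>" unfolding grid_label_def by (rule max_absorb2)
    then have "real (grid_label N w) = of_int \<lceil>real N * w\<rceil>" using True by simp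
    then show ?thesis using ceiling_correct[of "real N * w"] by linarith
  next
    case False
    then have "\<lceil>real N * w\<rceil> \<le> 0" by simp
    then have "real N * w \<le> 0" by (simp add: ceiling_le_iff)
    moreover have "0 \<le> real N * w" using that by simp
    ultimately have z: "real N * w = 0" by linarith
    have "grid_label N w = 1" unfolding grid_label_def z by simp
    then show ?thesis unfolding z by simp
  qed
  have "\<bar>real N * u - real N * v\<bar> \<le> 1"
    using bounds[OF assms(1)] bounds[OF assms(2)] assms(4) by auto
  then have "real N * \<bar>u - v\<bar> \<le> 1" by (simp add: abs_mult flip: right_diff_distrib)
  then show ?thesis using assms(3) by (simp add: field_simps)
qed

lemma holder_class_bound:
  assumes f: "f \<in> holder_class p \<alpha>" and xy: "x \<in> cube p" "y \<in> cube p"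
  shows "\<bar>f x - f y\<bar> \<le> holder_norm p \<alpha> f * L2_set (\<lambda>j. x j - y j) {1..p} powr \<alpha>"
proof (cases "x = y")
  case False
  obtain j where j: "j \<in> {1..p}" "x j \<noteq> y j"
    using False xy unfolding cube_def by (metis PiE_ext)
  have pos: "L2_set (\<lambda>j. x j - y j) {1..p} > 0"
  proof -
    have "L2_set (\<lambda>j. x j - y j) {1..p} \<noteq> 0" using j by (auto simp: L2_set_eq_0_iff)
    then show ?thesis using L2_set_nonneg[of "\<lambda>j. x j - y j" "{1..p}"] by linarith
  qed
  have "\<bar>f x - f y\<bar> / L2_set (\<lambda>j. x j - y j) {1..p} powr \<alpha> \<in> holder_quotients p \<alpha> f"
    unfolding holder_quotients_def using xy False by blast
  then have "\<bar>f x - f y\<bar> / L2_set (\<lambda>j. x j - y j) {1..p} powr \<alpha> \<le> holder_norm p \<alpha> f"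
    unfolding holder_norm_def using f by (intro cSup_upper) (auto simp: holder_class_def)
  then show ?thesis using pos by (simp add: divide_le_eq)
qed (simp add: L2_set_def)

text \<open>The real supremum has no sign of its own. Two opposite corners of the cube form a pair
  at positive distance, and the Hoelder bound at that pair forces it.\<close>

lemma holder_norm_nonneg:
  assumes f: "f \<in> holder_class p \<alpha>" and p: "p \<ge> 1"
  shows "holder_norm p \<alpha> f \<ge> 0"
proof -
  define x where "x = (\<lambda>j\<in>{1..p}. 0 :: real)"
  define y where "y = (\<lambda>j\<in>{1..p}. 1 :: real)"
  have xy: "x \<in> cube p" "y \<in> cube p" by (auto simp: x_def y_def cube_def)
  have "x 1 \<noteq> y 1" using p by (auto simp: x_def y_def)
  then have "L2_set (\<lambda>j. x j - y j) {1..p} \<noteq> 0" using p by (auto simp: L2_set_eq_0_iff)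
  then have "L2_set (\<lambda>j. x j - y j) {1..p} powr \<alpha> > 0" by simp
  moreover have "0 \<le> holder_norm p \<alpha> f * L2_set (\<lambda>j. x j - y j) {1..p} powr \<alpha>"
    using holder_class_bound[OF f xy] by linarith
  ultimately show ?thesis by (meson mult_neg_pos not_less)
qed

text \<open>The real supremum is an upper bound only of a bounded set; here the Hoelder property on
  a cube of diameter sqrt p supplies boundedness.\<close>

lemma sup_norm_bound:
  assumes f: "f \<in> holder_class p \<alpha>" and p: "p \<ge> 1" and \<alpha>: "\<alpha> \<ge> 0" and z: "z \<in> cube p"
  shows "\<bar>f z\<bar> \<le> sup_norm p f"
  unfolding sup_norm_def
proof (rule cSUP_upper[OF z])
  define H where "H = holder_norm p \<alpha> f"
  have H: "H \<ge> 0" unfolding H_def by (rule holder_norm_nonneg[OF f p])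
  show "bdd_above ((\<lambda>x. \<bar>f x\<bar>) ` cube p)"
  proof (rule bdd_aboveI2)
    fix y assume y: "y \<in> cube p"
    have "L2_set (\<lambda>j. y j - z j) {1..p} \<le> sqrt (\<Sum>j\<in>{1..p}. 1)"
      unfolding L2_set_def
    proof (intro real_sqrt_le_mono sum_mono)
      fix j assume "j \<in> {1..p}"
      then have "\<bar>y j - z j\<bar> \<le> 1" using y z by (auto simp: cube_def PiE_iff abs_le_iff) (smt (verit) atLeastAtMost_iff)+
      then show "(y j - z j)\<^sup>2 \<le> 1" by (simp add: abs_square_le_1)
    qed
    then have "L2_set (\<lambda>j. y j - z j) {1..p} powr \<alpha> \<le> sqrt (\<Sum>j\<in>{1..p}. 1) powr \<alpha>"
      using \<alpha> by (intro powr_mono2) auto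
    then have "\<bar>f y - f z\<bar> \<le> H * sqrt (\<Sum>j\<in>{1..p}. 1) powr \<alpha>"
      using holder_class_bound[OF f y z] mult_left_mono[OF _ H] unfolding H_def by fastforce
    then show "\<bar>f y\<bar> \<le> \<bar>f z\<bar> + H * sqrt (\<Sum>j\<in>{1..p}. 1) powr \<alpha>" by linarith
  qed
qed

text \<open>The point \<open>z\<close> takes its coordinates in \<open>S\<close> from y and all
  others from x, and sparsity gives f y = f z, so only displacements along \<open>S\<close> count.
  The Euclidean distance is at most |S| h, and |S|^\<alpha> \<le> |S| produces the product of
  dimension and Hoelder norm that the theorem controls.\<close>

lemma holder_sparse_bound:
  assumes f: "f \<in> holder_class p \<alpha> \<inter> sparse_class p S" and xy: "x \<in> cube p" "y \<in> cube p"
    and S: "S \<subseteq> {1..p}" "S \<noteq> {}" and \<alpha>: "0 < \<alpha>" "\<alpha> \<le> 1" and h: "h \<ge> 0" "\<And>j. j \<in> S \<Longrightarrow> \<bar>x j - y j\<bar> \<le> h"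
  shows "\<bar>f x - f y\<bar> \<le> real (card S) * holder_norm p \<alpha> f * h powr \<alpha>"
proof -
  define z where "z j = (if j \<in> S then y j else x j)" for j
  have z: "z \<in> cube p" using xy S by (auto simp: z_def cube_def PiE_iff extensional_def)
  have fS: "finite S" using S finite_subset by blast
  have p: "p \<ge> 1" using S by fastforce
  have q: "real (card S) \<ge> 1" using fS S by (simp add: Suc_le_eq card_gt_0_iff)
  have fz: "f y = f z"
  proof -
    have "\<forall>j\<in>S. y j = z j" by (simp add: z_def)
    then show ?thesis using f xy(2) z unfolding sparse_class_def by blast
  qed
  have "L2_set (\<lambda>j. x j - z j) {1..p} \<le> real (card S) * h"
  proof -
    have "L2_set (\<lambda>j. x j - z j) {1..p} \<le> (\<Sum>j\<in>{1..p}. \<bar>x j - z j\<bar>)" by (rule L2_set_le_sum_abs)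
    also have "\<dots> = (\<Sum>j\<in>S. \<bar>x j - y j\<bar>)"
      using S by (intro sum.mono_neutral_cong_right) (auto simp: z_def)
    also have "\<dots> \<le> real (card S) * h" using h by (intro sum_bounded_above) auto
    finally show ?thesis .
  qed
  then have "L2_set (\<lambda>j. x j - z j) {1..p} powr \<alpha> \<le> (real (card S) * h) powr \<alpha>"
    using \<alpha> by (intro powr_mono2) auto
  also have "\<dots> = real (card S) powr \<alpha> * h powr \<alpha>" by (rule powr_mult)
  also have "\<dots> \<le> real (card S) * h powr \<alpha>"
    using powr_mono[of \<alpha> 1 "real (card S)"] q \<alpha> by (intro mult_right_mono) auto
  finally have L: "L2_set (\<lambda>j. x j - z j) {1..p} powr \<alpha> \<le> real (card S) * h powr \<alpha>" .
  have "\<bar>f x - f y\<bar> \<le> holder_norm p \<alpha> f * L2_set (\<lambda>j. x j - z j) {1..p} powr \<alpha>"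
    unfolding fz using f xy z by (intro holder_class_bound) auto
  also have "\<dots> \<le> holder_norm p \<alpha> f * (real (card S) * h powr \<alpha>)"
    using f p by (intro mult_left_mono[OF L] holder_norm_nonneg) auto
  finally show ?thesis by (simp add: mult_ac)
qed

lemma sum_indicator_cell:
  assumes P: "finite P" "disjoint P" and \<Omega>: "\<Omega> \<in> P" "z \<in> \<Omega>"
  shows "(\<Sum>\<Omega>\<in>P. \<beta> \<Omega> * indicator \<Omega> z) = (\<beta> \<Omega> :: real)"
proof -
  have "(\<Sum>\<Omega>\<in>P. \<beta> \<Omega> * indicator \<Omega> z) = (\<Sum>\<Omega>'\<in>{\<Omega>}. \<beta> \<Omega>' * indicator \<Omega>' z)"
    using P \<Omega> by (intro sum.mono_neutral_right) (auto simp: indicator_def disjoint_def)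
  then show ?thesis using \<Omega> by simp
qed

text \<open>The target height \<open>b\<close> of a cell is the value of f at a point of the cell
  that was not given up. Such points err by at most r plus the oscillation of f over a grid cube,
  the at most m N^|S| points given up by r + 2 F. The claim covers every tree with the same trace as
  \<open>P\<close>, because the prior evaluates an arbitrary representative of the class.\<close>

lemma tree_approximation:
  assumes n: "n \<ge> 1" and data: "x ` {1..n} \<subseteq> cube p"
    and S: "S \<subseteq> {1..p}" "S \<noteq> {}" and m: "m \<ge> 1" "m \<le> n" and Cbar: "Cbar\<^sup>2 = real m" and N: "N \<ge> 1"
    and f: "f \<in> holder_class p \<alpha> \<inter> sparse_class p S" and \<alpha>: "0 < \<alpha>" "\<alpha> \<le> 1"
    and Fb: "\<forall>z\<in>cube p. \<bar>f z\<bar> \<le> F" and r: "r \<ge> 0"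
  shows "\<exists>K J P. P \<in> valid_trees p n x Cbar K J \<and> J \<subseteq> S \<and> K \<le> N ^ card S \<and>
    (\<forall>Q\<in>valid_trees p n x Cbar K J. data_trace n x Q = data_trace n x P \<longrightarrow>
      (\<exists>b. (\<forall>\<Omega>\<in>Q. \<bar>b \<Omega>\<bar> \<le> F) \<and>
        (\<forall>\<beta>. (\<forall>\<Omega>\<in>Q. \<bar>\<beta> \<Omega> - b \<Omega>\<bar> \<le> r) \<longrightarrow>
          (\<Sum>i=1..n. ((\<Sum>\<Omega>\<in>Q. \<beta> \<Omega> * indicator \<Omega> (x i)) - f (x i))\<^sup>2) \<le>
            real (m * N ^ card S) * (r + 2 * F)\<^sup>2 +
            real n * (r + real (card S) * holder_norm p \<alpha> f * (1 / real N) powr \<alpha>)\<^sup>2)))"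
proof -
  have design: "x i \<in> cube p" if "i \<in> {1..n}" for i using data that by auto
  have F: "\<bar>f z\<bar> \<le> F" if "z \<in> cube p" for z using Fb that by blast
  define lab where "lab i = restrict (\<lambda>j. grid_label N (x i j)) S" for i
  define L where "L = card (lab ` {1..n})"
  have x01: "x i j \<in> {0..1}" if "i \<in> {1..n}" "j \<in> S" for i j
    using design[OF that(1)] that(2) S by (auto simp: cube_def PiE_iff)
  have fS: "finite S" using S finite_subset by blast
  have LN: "L \<le> N ^ card S"
  proof -
    have "lab ` {1..n} \<subseteq> PiE S (\<lambda>_. {1..N})"
      unfolding lab_def using grid_label_range[OF x01 N] by (auto simp: PiE_iff)
    then have "L \<le> card (PiE S (\<lambda>_. {1..N}))"
      unfolding L_def using fS by (intro card_mono finite_PiE) auto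
    then show ?thesis using fS by (simp add: card_PiE)
  qed
  obtain K J P B where P: "P \<in> valid_trees p n x Cbar K J" "J \<subseteq> S" "K \<le> L" "B \<subseteq> {1..n}" "card B \<le> m * L"
    and pt: "\<forall>\<Omega>\<in>P. \<exists>i\<in>{1..n} - B. x i \<in> \<Omega>"
    and same: "\<forall>\<Omega>\<in>P. \<forall>i\<in>{1..n} - B. \<forall>i'\<in>{1..n} - B. x i \<in> \<Omega> \<longrightarrow> x i' \<in> \<Omega> \<longrightarrow>
        (\<forall>j\<in>S. grid_label N (x i j) = grid_label N (x i' j))"
    using separating_tree_exists[of x n p S m Cbar "grid_label N", OF data S(1) m Cbar mono_grid_label]
    unfolding L_def lab_def by (elim exE conjE) (rule that; (unfold L_def lab_def)?; assumption)
  define e where "e = real (card S) * holder_norm p \<alpha> f * (1 / real N) powr \<alpha>"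
  have p1: "p \<ge> 1" using S by fastforce
  have e: "e \<ge> 0" unfolding e_def using f p1 by (intro mult_nonneg_nonneg holder_norm_nonneg) auto
  have Fpos: "F \<ge> 0" using F[OF design[of 1]] n by auto
  have approx: "\<exists>b. (\<forall>\<Omega>\<in>Q. \<bar>b \<Omega>\<bar> \<le> F) \<and>
        (\<forall>\<beta>. (\<forall>\<Omega>\<in>Q. \<bar>\<beta> \<Omega> - b \<Omega>\<bar> \<le> r) \<longrightarrow>
          (\<Sum>i=1..n. ((\<Sum>\<Omega>\<in>Q. \<beta> \<Omega> * indicator \<Omega> (x i)) - f (x i))\<^sup>2) \<le>
            real (m * N ^ card S) * (r + 2 * F)\<^sup>2 + real n * (r + e)\<^sup>2)"
    if Q: "Q \<in> valid_trees p n x Cbar K J" and tr: "data_trace n x Q = data_trace n x P" for Q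
  proof -
    have tp: "tree_partition p n x K J Q" using Q by (simp add: valid_trees_def)
    have disj: "disjoint Q" "\<Union>Q = cube p" and fin: "finite Q"
      using tree_partition_partition[OF tp] tree_partition_finite[OF tp] by auto
    \<comment> \<open>Equal traces mean that cells of \<open>Q\<close> and \<open>P\<close> hold the
      same design points, so both properties of the live points carry over from \<open>P\<close> to
      \<open>Q\<close>.\<close>
    have cell: "\<exists>\<Omega>'\<in>P. \<forall>i\<in>{1..n}. x i \<in> \<Omega> \<longleftrightarrow> x i \<in> \<Omega>'" if "\<Omega> \<in> Q" for \<Omega>
    proof -
      have "\<Omega> \<inter> x ` {1..n} \<in> data_trace n x P" using that unfolding tr[symmetric] by (simp add: data_trace_def)
      then obtain \<Omega>' where "\<Omega>' \<in> P" "\<Omega> \<inter> x ` {1..n} = \<Omega>' \<inter> x ` {1..n}" by (auto simp: data_trace_def)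
      then show ?thesis by (intro bexI[of _ \<Omega>']) auto
    qed
    have "\<exists>i\<in>{1..n} - B. x i \<in> \<Omega>" if "\<Omega> \<in> Q" for \<Omega>
    proof -
      from cell[OF that] obtain \<Omega>' where \<Omega>': "\<Omega>' \<in> P" "\<forall>i\<in>{1..n}. x i \<in> \<Omega> \<longleftrightarrow> x i \<in> \<Omega>'" by (rule bexE)
      from bspec[OF pt \<Omega>'(1)] obtain i where i: "i \<in> {1..n} - B" "x i \<in> \<Omega>'" by (rule bexE)
      then show ?thesis using \<Omega>'(2) by (intro bexI[of _ i]) auto
    qed
    then obtain h where h: "\<And>\<Omega>. \<Omega> \<in> Q \<Longrightarrow> h \<Omega> \<in> {1..n} - B \<and> x (h \<Omega>) \<in> \<Omega>" by metis
    define b where "b \<Omega> = f (x (h \<Omega>))" for \<Omega>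
    show ?thesis
    proof (intro exI[of _ b] conjI ballI allI impI)
      fix \<Omega> assume "\<Omega> \<in> Q"
      then show "\<bar>b \<Omega>\<bar> \<le> F" unfolding b_def using h by (intro F design) auto
    next
      fix \<beta> :: "cell \<Rightarrow> real" assume \<beta>: "\<forall>\<Omega>\<in>Q. \<bar>\<beta> \<Omega> - b \<Omega>\<bar> \<le> r"
      show "(\<Sum>i=1..n. ((\<Sum>\<Omega>\<in>Q. \<beta> \<Omega> * indicator \<Omega> (x i)) - f (x i))\<^sup>2) \<le>
            real (m * N ^ card S) * (r + 2 * F)\<^sup>2 + real n * (r + e)\<^sup>2"
      proof (rule emp_sum_split[OF P(4)])
        show "card B \<le> m * N ^ card S" using P(5) LN mult_le_mono2[OF LN, of m] by linarith
      next
        fix i assume "i \<in> B"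
        then have i: "i \<in> {1..n}" using P(4) by auto
        obtain \<Omega> where \<Omega>: "\<Omega> \<in> Q" "x i \<in> \<Omega>" using design[OF i] disj(2) by blast
        have "\<bar>\<beta> \<Omega> - b \<Omega>\<bar> \<le> r" "\<bar>b \<Omega>\<bar> \<le> F" "\<bar>f (x i)\<bar> \<le> F"
          using \<beta> \<Omega> h F[OF design[OF i]] unfolding b_def by (auto intro!: F design)
        then have "\<bar>\<beta> \<Omega> - f (x i)\<bar> \<le> r + 2 * F" by linarith
        then show "((\<Sum>\<Omega>\<in>Q. \<beta> \<Omega> * indicator \<Omega> (x i)) - f (x i))\<^sup>2 \<le> (r + 2 * F)\<^sup>2"
          unfolding sum_indicator_cell[OF fin disj(1) \<Omega>] using abs_le_square_iff r Fpos by fastforce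
      next
        fix i assume iB: "i \<in> {1..n} - B"
        then have i: "i \<in> {1..n}" by auto
        obtain \<Omega> where \<Omega>: "\<Omega> \<in> Q" "x i \<in> \<Omega>" using design[OF i] disj(2) by blast
        obtain \<Omega>' where \<Omega>': "\<Omega>' \<in> P" "\<forall>i\<in>{1..n}. x i \<in> \<Omega> \<longleftrightarrow> x i \<in> \<Omega>'" using cell[OF \<Omega>(1)] by (rule bexE)
        have hI: "h \<Omega> \<in> {1..n} - B" "x (h \<Omega>) \<in> \<Omega>" using h[OF \<Omega>(1)] by auto
        have "x i \<in> \<Omega>'" "x (h \<Omega>) \<in> \<Omega>'" using \<Omega>'(2) i hI \<Omega> by auto
        then have eq: "\<forall>j\<in>S. grid_label N (x (h \<Omega>) j) = grid_label N (x i j)"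
          using same \<Omega>'(1) iB hI(1) by blast
        have hi: "h \<Omega> \<in> {1..n}" using hI by auto
        have "\<bar>f (x (h \<Omega>)) - f (x i)\<bar> \<le> e"
          unfolding e_def using f design[OF hi] design[OF i] S \<alpha> eq
          by (intro holder_sparse_bound grid_label_eq_dist x01 hi i N) auto
        moreover have "\<bar>\<beta> \<Omega> - b \<Omega>\<bar> \<le> r" using \<beta> \<Omega> by blast
        ultimately have "\<bar>\<beta> \<Omega> - f (x i)\<bar> \<le> r + e" unfolding b_def by linarith
        then show "((\<Sum>\<Omega>\<in>Q. \<beta> \<Omega> * indicator \<Omega> (x i)) - f (x i))\<^sup>2 \<le> (r + e)\<^sup>2"
          unfolding sum_indicator_cell[OF fin disj(1) \<Omega>] using abs_le_square_iff r e by fastforce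
      qed auto
    qed
  qed
  show ?thesis
    using P(1,2) order_trans[OF P(3) LN] approx unfolding e_def by blast
qed


section \<open>A finite-sample bound for the posterior\<close>

text \<open>The bound also covers maps that fail to be measurable, since \<open>emeasure\<close>
  then falls back to zero. The kernel of the prior thereby takes sub-probability values at every
  tuple, including those outside the support.\<close>

lemma subprob_space_distr_prob:
  assumes "prob_space M" "space N \<noteq> {}"
  shows "subprob_space (distr M N f)"
proof
  interpret prob_space M by fact
  show "emeasure (distr M N f) (space (distr M N f)) \<le> 1"
    unfolding distr_def by (simp add: emeasure_measure_of_conv emeasure_le_1)
  show "space (distr M N f) \<noteq> {}" using assms by simp
qed

context
  fixes q :: "'a pmf" and M :: "'b measure" and f :: "'a \<Rightarrow> 'b \<Rightarrow> ennreal"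
  assumes M: "prob_space M"
    and f: "\<And>e. e \<in> set_pmf q \<Longrightarrow> f e \<in> borel_measurable M"
begin

text \<open>The support is countable, so its counting measure is sigma-finite and Fubini applies;
  moreover \<open>f e\<close> then has to be measurable only for \<open>e\<close> in the support,
  where the ensembles are valid.\<close>

lemma nn_integral_pmf_support:
  "(\<integral>\<^sup>+e. g e \<partial>measure_pmf q) = (\<integral>\<^sup>+e. ennreal (pmf q e) * g e \<partial>count_space (set_pmf q))"
  unfolding nn_integral_measure_pmf
  by (subst (2) nn_integral_count_space_indicator)
     (auto intro!: nn_integral_cong simp: indicator_def set_pmf_iff)

lemma pmf_pair_measurable:
  "(\<lambda>(e, y). ennreal (pmf q e) * f e y) \<in> borel_measurable (count_space (set_pmf q) \<Otimes>\<^sub>M M)"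
  using f by (intro measurable_pair_measure_countable1) auto

lemma borel_measurable_nn_integral_pmf: "(\<lambda>y. \<integral>\<^sup>+e. f e y \<partial>measure_pmf q) \<in> borel_measurable M"
proof -
  interpret sigma_finite_measure "count_space (set_pmf q)"
    by (rule sigma_finite_measure_count_space_countable) simp
  have "(\<lambda>(y, e). ennreal (pmf q e) * f e y) \<in> borel_measurable (M \<Otimes>\<^sub>M count_space (set_pmf q))"
    using measurable_pair_swap[OF pmf_pair_measurable] by (simp add: case_prod_beta)
  then show ?thesis
    unfolding nn_integral_pmf_support by (rule borel_measurable_nn_integral)
qed

lemma nn_integral_pmf_swap:
  "(\<integral>\<^sup>+y. \<integral>\<^sup>+e. f e y \<partial>measure_pmf q \<partial>M) = (\<integral>\<^sup>+e. \<integral>\<^sup>+y. f e y \<partial>M \<partial>measure_pmf q)"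
proof -
  interpret C: sigma_finite_measure "count_space (set_pmf q)"
    by (rule sigma_finite_measure_count_space_countable) simp
  interpret M: prob_space M by (rule M)
  interpret pair_sigma_finite "count_space (set_pmf q)" M ..
  have "(\<integral>\<^sup>+y. \<integral>\<^sup>+e. ennreal (pmf q e) * f e y \<partial>count_space (set_pmf q) \<partial>M) =
     (\<integral>\<^sup>+e. \<integral>\<^sup>+y. ennreal (pmf q e) * f e y \<partial>M \<partial>count_space (set_pmf q))"
    using pmf_pair_measurable by (intro Fubini') auto
  also have "\<dots> = (\<integral>\<^sup>+e. ennreal (pmf q e) * (\<integral>\<^sup>+y. f e y \<partial>M) \<partial>count_space (set_pmf q))"
    using f by (intro nn_integral_cong nn_integral_cmult) auto
  finally show ?thesis unfolding nn_integral_pmf_support .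
qed

end

section \<open>Ensemble functions as vectors, and integrals over the prior\<close>

lemma in_span_member: "finite \<Phi> \<Longrightarrow> \<phi> \<in> \<Phi> \<Longrightarrow> in_span n \<Phi> \<phi>"
  unfolding in_span_def
  by (rule exI[of _ "\<lambda>\<psi>. if \<psi> = \<phi> then 1 else 0"]) (simp add: if_distrib if_distribR cong: if_cong)

lemma in_span_scale: "in_span n \<Phi> v \<Longrightarrow> in_span n \<Phi> (\<lambda>i. b * v i)"
  unfolding in_span_def
proof (elim exE)
  fix c assume "\<forall>i\<in>{1..n}. v i = (\<Sum>\<phi>\<in>\<Phi>. c \<phi> * \<phi> i)"
  then show "\<exists>c. \<forall>i\<in>{1..n}. b * v i = (\<Sum>\<phi>\<in>\<Phi>. c \<phi> * \<phi> i)"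
    by (intro exI[of _ "\<lambda>\<phi>. b * c \<phi>"]) (simp add: sum_distrib_left mult.assoc)
qed

lemma in_span_sum:
  assumes "\<And>k. k \<in> A \<Longrightarrow> in_span n \<Phi> (v k)"
  shows "in_span n \<Phi> (\<lambda>i. \<Sum>k\<in>A. v k i)"
proof -
  from assms obtain c where c: "\<And>k i. k \<in> A \<Longrightarrow> i \<in> {1..n} \<Longrightarrow> v k i = (\<Sum>\<phi>\<in>\<Phi>. c k \<phi> * \<phi> i)"
    unfolding in_span_def by metis
  show ?thesis
    unfolding in_span_def
  proof (intro exI[of _ "\<lambda>\<phi>. \<Sum>k\<in>A. c k \<phi>"] ballI)
    fix i assume i: "i \<in> {1..n}"
    have "(\<Sum>k\<in>A. v k i) = (\<Sum>k\<in>A. \<Sum>\<phi>\<in>\<Phi>. c k \<phi> * \<phi> i)"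
      using c i by (intro sum.cong) auto
    also have "\<dots> = (\<Sum>\<phi>\<in>\<Phi>. \<Sum>k\<in>A. c k \<phi> * \<phi> i)" by (rule sum.swap)
    finally show "(\<Sum>k\<in>A. v k i) = (\<Sum>\<phi>\<in>\<Phi>. (\<Sum>k\<in>A. c k \<phi>) * \<phi> i)"
      by (simp add: sum_distrib_right)
  qed
qed

definition cell_vector :: "(nat \<Rightarrow> point) \<Rightarrow> cell \<Rightarrow> nat \<Rightarrow> real" where
  "cell_vector x \<Omega> i = indicator \<Omega> (x i)"

text \<open>The spanning family depends on the ensemble only through the union of its cells, neither
  on the order nor on the number of trees. This is why the union bound can run over sets of
  cells.\<close>

lemma in_span_ensemble_fun:
  assumes "finite (\<Union>(set Ps))"
  shows "in_span n (cell_vector x ` \<Union>(set Ps)) (\<lambda>i. ensemble_fun Ps B (x i))"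
  unfolding ensemble_fun_def
proof (intro in_span_sum)
  fix t \<Omega> assume "t \<in> {..<length Ps}" "\<Omega> \<in> Ps ! t"
  then have "\<Omega> \<in> \<Union>(set Ps)" using nth_mem by blast
  then have "in_span n (cell_vector x ` \<Union>(set Ps)) (\<lambda>i. B (t, \<Omega>) * cell_vector x \<Omega> i)"
    using assms by (intro in_span_scale in_span_member) auto
  then show "in_span n (cell_vector x ` \<Union>(set Ps)) (\<lambda>i. B (t, \<Omega>) * indicator \<Omega> (x i))"
    by (simp add: cell_vector_def)
qed

lemma borel_measurable_lratio_pair:
  assumes "\<And>i. i \<in> {1..n} \<Longrightarrow> (\<lambda>b. v b i) \<in> borel_measurable Q"
  shows "(\<lambda>(b, Y). lratio n \<mu> (v b) Y) \<in> borel_measurable (Q \<Otimes>\<^sub>M gauss_law n \<mu>)"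
proof -
  have [measurable]: "(\<lambda>z. v (fst z) i) \<in> borel_measurable (Q \<Otimes>\<^sub>M gauss_law n \<mu>)" if "i \<in> {1..n}" for i
    by (rule measurable_compose[OF measurable_fst assms[OF that]])
  have [measurable]: "(\<lambda>z. snd z i) \<in> borel_measurable (Q \<Otimes>\<^sub>M gauss_law n \<mu>)" if "i \<in> {1..n}" for i
    by (rule measurable_compose[OF measurable_snd measurable_gauss_component[OF that]])
  show ?thesis unfolding lratio_def case_prod_beta by measurable
qed

lemma prob_space_step_height_prior: "prob_space (step_height_prior Ps)"
\<comment> \<open>For the empty list the standard deviation degenerates to sqrt (1 / 0) = 0, but the
  product then has no factors.\<close>
proof (cases Ps)
  case Nil
  then show ?thesis unfolding step_height_prior_def by (intro prob_space_PiM) auto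
next
  case (Cons P Ps')
  then show ?thesis unfolding step_height_prior_def
    by (intro prob_space_PiM prob_space_normal_density) auto
qed

lemma measurable_ensemble_fun:
  assumes "\<And>t. t < length Ps \<Longrightarrow> finite (Ps ! t)"
  shows "(\<lambda>B. ensemble_fun Ps B z) \<in> borel_measurable (step_height_prior Ps)"
proof -
  have [measurable]: "(\<lambda>B. B (t, \<Omega>)) \<in> borel_measurable (step_height_prior Ps)"
    if "t < length Ps" "\<Omega> \<in> Ps ! t" for t \<Omega>
  proof -
    have "sets (step_height_prior Ps) = sets (PiM (SIGMA t:{..<length Ps}. Ps ! t) (\<lambda>_. borel))"
      unfolding step_height_prior_def by (intro sets_PiM_cong) auto
    then show ?thesis
      using measurable_component_singleton[of "(t, \<Omega>)" "SIGMA t:{..<length Ps}. Ps ! t" "\<lambda>_. borel"] that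
      by (simp cong: measurable_cong_sets)
  qed
  show ?thesis unfolding ensemble_fun_def by measurable
qed

definition lift_fun :: "nat \<Rightarrow> cell set list \<Rightarrow> (nat \<times> cell \<Rightarrow> real) \<Rightarrow> point \<Rightarrow> real" where
  "lift_fun p Ps B = restrict (ensemble_fun Ps B) (cube p)"

definition valid_forest :: "nat \<Rightarrow> nat \<Rightarrow> (nat \<Rightarrow> point) \<Rightarrow> real \<Rightarrow> cell set list \<Rightarrow> bool" where
  "valid_forest p n x Cbar Ps \<longleftrightarrow>
     length Ps \<ge> 1 \<and> (\<forall>t<length Ps. \<exists>K S. Ps ! t \<in> valid_trees p n x Cbar K S)"

lemma valid_forest_finite:
  "valid_forest p n x Cbar Ps \<Longrightarrow> t < length Ps \<Longrightarrow> finite (Ps ! t)"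
  unfolding valid_forest_def valid_trees_def using tree_partition_finite by blast

lemma measurable_lift_fun:
  assumes "valid_forest p n x Cbar Ps"
  shows "lift_fun p Ps \<in> measurable (step_height_prior Ps) (forest_space p n x Cbar)"
proof -
  have "lift_fun p Ps \<in> measurable (step_height_prior Ps) (PiM (cube p) (\<lambda>_. borel))"
    unfolding lift_fun_def
    using measurable_ensemble_fun[OF valid_forest_finite[OF assms]] by (intro measurable_restrict)
  moreover have "lift_fun p Ps B \<in> forest_functions p n x Cbar" for B
    using assms unfolding forest_functions_def lift_fun_def valid_forest_def by blast
  ultimately show ?thesis
    unfolding forest_space_def by (intro measurable_restrict_space2) auto
qed

lemma nn_integral_forest_prior:
  assumes ne: "forest_functions p n x Cbar \<noteq> {}"
    and valid: "\<And>E. E \<in> set_pmf (ensemble_prior p n x Cbar a c C\<^sub>T l) \<Longrightarrow> valid_forest p n x Cbar (map tree_rep E)"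
    and g: "g \<in> borel_measurable (forest_space p n x Cbar)"
  shows "(\<integral>\<^sup>+f. g f \<partial>forest_prior p n x Cbar a c C\<^sub>T l) =
    (\<integral>\<^sup>+E. \<integral>\<^sup>+B. g (lift_fun p (map tree_rep E) B) \<partial>step_height_prior (map tree_rep E)
       \<partial>measure_pmf (ensemble_prior p n x Cbar a c C\<^sub>T l))"
proof -
  have sp: "space (forest_space p n x Cbar) \<noteq> {}"
  proof -
    have "forest_functions p n x Cbar \<subseteq> space (PiM (cube p) (\<lambda>_. borel))"
      by (auto simp: forest_functions_def space_PiM)
    then show ?thesis using ne by (auto simp: forest_space_def space_restrict_space)
  qed
  \<comment> \<open>All sets of tuples are measurable for the discrete law, so measurability of the
    kernel reduces to its values being sub-probabilities.\<close>
  have k: "(\<lambda>E. distr (step_height_prior (map tree_rep E)) (forest_space p n x Cbar) (lift_fun p (map tree_rep E)))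
      \<in> measurable (measure_pmf (ensemble_prior p n x Cbar a c C\<^sub>T l)) (subprob_algebra (forest_space p n x Cbar))"
    using subprob_space_distr_prob[OF prob_space_step_height_prior sp]
    by (auto simp: space_subprob_algebra)
  have eq: "forest_prior p n x Cbar a c C\<^sub>T l = measure_pmf (ensemble_prior p n x Cbar a c C\<^sub>T l) \<bind>
     (\<lambda>E. distr (step_height_prior (map tree_rep E)) (forest_space p n x Cbar) (lift_fun p (map tree_rep E)))"
    unfolding forest_prior_def lift_fun_def ..
  show ?thesis
    unfolding eq nn_integral_bind[OF g k]
    using g by (intro nn_integral_cong_AE AE_pmfI nn_integral_distr measurable_lift_fun valid) auto
qed

lemma sets_forest_prior:
  assumes "forest_functions p n x Cbar \<noteq> {}"
  shows "sets (forest_prior p n x Cbar a c C\<^sub>T l) = sets (forest_space p n x Cbar)"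
  unfolding forest_prior_def by (rule sets_bind) auto

lemma prob_space_forest_prior:
  assumes ne: "forest_functions p n x Cbar \<noteq> {}"
    and valid: "\<And>E. E \<in> set_pmf (ensemble_prior p n x Cbar a c C\<^sub>T l) \<Longrightarrow> valid_forest p n x Cbar (map tree_rep E)"
  shows "prob_space (forest_prior p n x Cbar a c C\<^sub>T l)"
proof
  have "(\<integral>\<^sup>+f. 1 \<partial>forest_prior p n x Cbar a c C\<^sub>T l) = 1"
    using prob_space.emeasure_space_1[OF prob_space_step_height_prior]
    by (subst nn_integral_forest_prior[OF ne valid]) (auto)
  then show "emeasure (forest_prior p n x Cbar a c C\<^sub>T l) (space (forest_prior p n x Cbar a c C\<^sub>T l)) = 1"
    by simp
qed

lemma measurable_forest_eval:
  "z \<in> cube p \<Longrightarrow> (\<lambda>f. f z) \<in> borel_measurable (forest_space p n x Cbar)"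
  unfolding forest_space_def
  by (intro measurable_restrict_space1 measurable_component_singleton)

section \<open>Posterior mass through likelihood ratios\<close>

lemma likelihood_lratio:
  "likelihood n x Y f = likelihood n x Y f\<^sub>0 * lratio n (\<lambda>i. f\<^sub>0 (x i)) (\<lambda>i. f (x i)) Y"
proof -
  have 1: "normal_density (f (x i)) 1 (Y i) = normal_density (f\<^sub>0 (x i)) 1 (Y i) *
     exp ((f (x i) - f\<^sub>0 (x i)) * (Y i - f\<^sub>0 (x i)) - (f (x i) - f\<^sub>0 (x i))\<^sup>2 / 2)" for i
  proof -
    have "- ((Y i - f (x i))\<^sup>2 / 2) = - ((Y i - f\<^sub>0 (x i))\<^sup>2 / 2) +
       ((f (x i) - f\<^sub>0 (x i)) * (Y i - f\<^sub>0 (x i)) - (f (x i) - f\<^sub>0 (x i))\<^sup>2 / 2)"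
      by (simp add: power2_eq_square field_simps)
    then have "exp (- ((Y i - f (x i))\<^sup>2 / 2)) = exp (- ((Y i - f\<^sub>0 (x i))\<^sup>2 / 2)) *
       exp ((f (x i) - f\<^sub>0 (x i)) * (Y i - f\<^sub>0 (x i)) - (f (x i) - f\<^sub>0 (x i))\<^sup>2 / 2)"
      unfolding exp_add[symmetric] by (rule arg_cong)
    then show ?thesis by (simp add: normal_density_def)
  qed
  have "likelihood n x Y f = likelihood n x Y f\<^sub>0 *
    (\<Prod>i=1..n. exp ((f (x i) - f\<^sub>0 (x i)) * (Y i - f\<^sub>0 (x i)) - (f (x i) - f\<^sub>0 (x i))\<^sup>2 / 2))"
    unfolding likelihood_def prod.distrib[symmetric] by (intro prod.cong refl 1)
  then show ?thesis
    unfolding lratio_def by (simp only: exp_sum[symmetric] finite_atLeastAtMost sum_subtractf sum_divide_distrib)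
qed

text \<open>The likelihood at the truth is a common positive factor \<open>k\<close> of numerator
  and normalizing constant and cancels, so bounds on integrals of likelihood ratios suffice.\<close>

lemma posterior_le:
  assumes M: "prob_space M" and A: "A \<in> sets M"
    and ev: "\<And>i. i \<in> {1..n} \<Longrightarrow> (\<lambda>f. f (x i)) \<in> borel_measurable M"
    and num: "(\<integral>\<^sup>+f. ennreal (lratio n (\<lambda>i. f\<^sub>0 (x i)) (\<lambda>i. f (x i)) Y) * indicator A f \<partial>M) \<le> ennreal u"
    and den: "ennreal w \<le> (\<integral>\<^sup>+f. ennreal (lratio n (\<lambda>i. f\<^sub>0 (x i)) (\<lambda>i. f (x i)) Y) \<partial>M)"
    and u: "u \<ge> 0" and w: "w > 0"
  shows "measure (posterior M n x Y) A \<le> u / w"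
proof -
  interpret prob_space M by fact
  let ?L = "\<lambda>f. lratio n (\<lambda>i. f\<^sub>0 (x i)) (\<lambda>i. f (x i)) Y"
  define k where "k = likelihood n x Y f\<^sub>0"
  have k: "k > 0" unfolding k_def likelihood_def by (intro prod_pos) (auto intro: normal_density_pos)
  have lik: "likelihood n x Y f = k * ?L f" for f unfolding k_def by (rule likelihood_lratio)
  have Lm [measurable]: "?L \<in> borel_measurable M"
    using ev unfolding lratio_def by measurable
  have likm: "likelihood n x Y \<in> borel_measurable M"
    unfolding lik[abs_def] by measurable
  \<comment> \<open>Unit-variance normal densities stay below 1 / sqrt (2 pi) < 1. The bounded
    likelihood is integrable, which identifies the Bochner integral in the definition of the
    posterior with the nonnegative integral.\<close>
  have le1: "likelihood n x Y f \<le> 1" for f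
    unfolding likelihood_def
  proof (intro prod_le_1 conjI)
    fix i
    have "1 / sqrt (2 * pi) * exp (- ((Y i - f (x i))\<^sup>2 / 2)) \<le> 1 * 1"
      using pi_gt3 by (intro mult_mono) auto
    then show "normal_density (f (x i)) 1 (Y i) \<le> 1"
      by (simp add: normal_density_def)
  qed auto
  define D where "D = (\<integral>g. likelihood n x Y g \<partial>M)"
  have lik_pos: "0 \<le> likelihood n x Y f" for f
    using k lratio_pos[of n _ _ Y] by (simp add: lik less_imp_le)
  have int: "integrable M (likelihood n x Y)"
    using le1 lik_pos by (intro integrable_const_bound[where B = 1] likm) auto
  have "ennreal D = (\<integral>\<^sup>+g. ennreal (likelihood n x Y g) \<partial>M)"
    unfolding D_def using int lik_pos by (subst nn_integral_eq_integral) auto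
  also have "\<dots> = ennreal k * (\<integral>\<^sup>+g. ennreal (?L g) \<partial>M)"
    unfolding lik using k lratio_pos[of n _ _ Y]
    by (subst nn_integral_cmult[symmetric]) (auto simp: ennreal_mult less_imp_le)
  finally have D: "ennreal D = ennreal k * (\<integral>\<^sup>+g. ennreal (?L g) \<partial>M)" .
  have "ennreal (k * w) \<le> ennreal D"
    unfolding D using den k w by (simp add: ennreal_mult mult_left_mono)
  then have Dw: "k * w \<le> D" 
    using k w by (simp add: D_def lik_pos ennreal_le_iff integral_nonneg)
  then have Dpos: "D > 0" using k w by (meson less_le_trans mult_pos_pos)
  have "emeasure (posterior M n x Y) A = (\<integral>\<^sup>+f. ennreal (likelihood n x Y f / D) * indicator A f \<partial>M)"
    unfolding posterior_def D_def[symmetric] using A by (subst emeasure_density) (auto simp: lik)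
  also have "\<dots> = (\<integral>\<^sup>+f. ennreal (k / D) * (ennreal (?L f) * indicator A f) \<partial>M)"
    unfolding lik using k Dpos lratio_pos[of n _ _ Y]
    by (intro nn_integral_cong) (auto simp: mult.assoc[symmetric] less_imp_le simp flip: ennreal_mult)
  also have "\<dots> = ennreal (k / D) * (\<integral>\<^sup>+f. ennreal (?L f) * indicator A f \<partial>M)"
    using A by (intro nn_integral_cmult) auto
  also have "\<dots> \<le> ennreal (k / D) * ennreal u" by (intro mult_left_mono num) simp
  also have "\<dots> = ennreal (k / D * u)" using k Dpos u by (intro ennreal_mult[symmetric]) auto
  finally have "emeasure (posterior M n x Y) A \<le> ennreal (k / D * u)" .
  then have "measure (posterior M n x Y) A \<le> k / D * u"
    unfolding measure_def using k Dpos u by (intro enn2real_leI) auto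
  also have "\<dots> \<le> u / w"
  proof -
    have "k / D \<le> 1 / w" using Dw Dpos w by (simp add: field_simps)
    then show ?thesis using mult_right_mono[OF _ u, of "k / D" "1 / w"] by simp
  qed
  finally show ?thesis .
qed


text \<open>By Cauchy--Schwarz the integral of \<open>L\<close> over a set is bounded below through the integral of \<open>1 / L\<close>,
  whose expectation is explicit.\<close>

lemma inverse_integral_bound:
  assumes Q: "prob_space Q" and X: "X \<in> sets Q" and L: "L \<in> borel_measurable Q" and pos: "\<And>b. L b > 0"
    and b: "(\<integral>\<^sup>+b. ennreal (1 / L b) * indicator X b \<partial>Q) \<le> ennreal (measure Q X * s)"
    and s: "s > 0" and mX: "measure Q X > 0"
  shows "ennreal (measure Q X / s) \<le> (\<integral>\<^sup>+b. ennreal (L b) * indicator X b \<partial>Q)"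
proof -
  interpret prob_space Q by fact
  let ?J = "\<integral>\<^sup>+b. ennreal (L b) * indicator X b \<partial>Q"
  have [measurable]: "L \<in> borel_measurable Q" "X \<in> sets Q" by fact+
  have "ennreal (measure Q X) = (\<integral>\<^sup>+b. (ennreal (sqrt (L b)) * indicator X b) * (ennreal (sqrt (1 / L b)) * indicator X b) \<partial>Q)"
  proof -
    have "(ennreal (sqrt (L b)) * indicator X b) * (ennreal (sqrt (1 / L b)) * indicator X b) = indicator X b" for b
      using pos[of b] by (auto simp: indicator_def real_sqrt_mult[symmetric] simp flip: ennreal_mult)
    then show ?thesis using X by (simp add: emeasure_eq_measure)
  qed
  then have "ennreal (measure Q X) ^ 2 \<le>
      (\<integral>\<^sup>+b. (ennreal (sqrt (L b)) * indicator X b) ^ 2 \<partial>Q) * (\<integral>\<^sup>+b. (ennreal (sqrt (1 / L b)) * indicator X b) ^ 2 \<partial>Q)"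
    by (simp only:) (rule Cauchy_Schwarz_nn_integral; measurable)
  also have "(\<integral>\<^sup>+b. (ennreal (sqrt (L b)) * indicator X b) ^ 2 \<partial>Q) = ?J"
    using pos by (intro nn_integral_cong) (auto simp: indicator_def less_imp_le ennreal_power)
  also have "(\<integral>\<^sup>+b. (ennreal (sqrt (1 / L b)) * indicator X b) ^ 2 \<partial>Q) = (\<integral>\<^sup>+b. ennreal (1 / L b) * indicator X b \<partial>Q)"
    using pos by (intro nn_integral_cong) (auto simp: indicator_def less_imp_le ennreal_power)
  also have "?J * \<dots> \<le> ?J * ennreal (measure Q X * s)" by (intro mult_left_mono b) simp
  finally have main: "ennreal ((measure Q X)\<^sup>2) \<le> ?J * ennreal (measure Q X * s)"
    by (simp add: ennreal_power)
  show ?thesis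
  proof (cases "?J = \<infinity>")
    case False
    then obtain J where J: "?J = ennreal J" "J \<ge> 0" by (cases ?J) auto
    have "(measure Q X)\<^sup>2 \<le> J * (measure Q X * s)"
      using main J s mX by (simp add: ennreal_mult[symmetric] ennreal_le_iff)
    then have "measure Q X / s \<le> J" using s mX by (simp add: power2_eq_square field_simps)
    then show ?thesis using J by (simp add: ennreal_leI)
  qed simp
qed

text \<open>Markov's inequality, the source of all three probability bounds below.\<close>

lemma (in prob_space) prob_gt_le_nn_integral:
  fixes h :: "'a \<Rightarrow> ennreal"
  assumes h: "h \<in> borel_measurable M" and I: "(\<integral>\<^sup>+y. h y \<partial>M) \<le> ennreal b" and t: "t > 0" and b: "b \<ge> 0"
  shows "measure M {y \<in> space M. h y > ennreal t} \<le> b / t"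
proof -
  have "ennreal t * emeasure M {y \<in> space M. h y > ennreal t} = (\<integral>\<^sup>+y. ennreal t * indicator {y \<in> space M. h y > ennreal t} y \<partial>M)"
    using h by (subst nn_integral_cmult_indicator) auto
  also have "\<dots> \<le> (\<integral>\<^sup>+y. h y \<partial>M)"
    by (intro nn_integral_mono) (auto simp: indicator_def)
  also note I
  finally have "ennreal (t * measure M {y \<in> space M. h y > ennreal t}) \<le> ennreal b"
    using t by (simp add: emeasure_eq_measure ennreal_mult)
  then show ?thesis using t b by (simp add: ennreal_le_iff field_simps)
qed

text \<open>Levels and what they control: \<open>G\<close> the projected noise over each cell set in
  \<open>Idx\<close>, \<open>c1\<close> the numerator from ensembles outside \<open>Sv\<close>,
  \<open>t\<close> the inverse moment in the denominator. Off the three exceptional events the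
  numerator is at most exp(G - n R^2/4) + exp(-c1) and the evidence at least exp(-(\<gamma> + \<rho>
  + t)), where exp(-\<gamma>) is prior mass and \<rho> a squared distance near the truth.\<close>

theorem posterior_finite_sample_bound:
  fixes p n k :: nat and x :: "nat \<Rightarrow> point" and Cbar a c C\<^sub>T l G R c1 \<gamma> \<rho> t \<eta> \<delta> :: real
    and Sv :: "cell set set list set" and Idx :: "cell set set"
    and f\<^sub>0 :: "point \<Rightarrow> real"
  defines "ens \<equiv> ensemble_prior p n x Cbar a c C\<^sub>T l"
    and "\<mu> \<equiv> \<lambda>i. f\<^sub>0 (x i)"
  assumes n: "n \<ge> 1" and design: "\<And>i. i \<in> {1..n} \<Longrightarrow> x i \<in> cube p"
    and ne: "forest_functions p n x Cbar \<noteq> {}"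
    and valid: "\<And>E. E \<in> set_pmf ens \<Longrightarrow> valid_forest p n x Cbar (map tree_rep E)"
    and Idx: "finite Idx" "\<And>\<C>. \<C> \<in> Idx \<Longrightarrow> finite \<C> \<and> card \<C> \<le> k"
    and sieve: "\<And>E. E \<in> set_pmf ens \<Longrightarrow> E \<in> Sv \<Longrightarrow> \<Union>(set (map tree_rep E)) \<in> Idx"
    and compl: "measure (measure_pmf ens) (- Sv) \<le> \<eta>"
    and E0: "E\<^sub>0 \<in> set_pmf ens"
    and X: "X \<in> sets (step_height_prior (map tree_rep E\<^sub>0))"
    and near: "\<And>B. B \<in> X \<Longrightarrow> (\<Sum>i=1..n. (ensemble_fun (map tree_rep E\<^sub>0) B (x i) - \<mu> i)\<^sup>2) \<le> \<rho>"
    and mass: "exp (- \<gamma>) \<le> pmf ens E\<^sub>0 * measure (step_height_prior (map tree_rep E\<^sub>0)) X"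
    and R: "R \<ge> 0"
    and small: "(exp (G - real n * R\<^sup>2 / 4) + exp (- c1)) * exp (\<gamma> + \<rho> + t) \<le> \<delta>"
  shows "measure (data_law n x f\<^sub>0) {Y \<in> space (data_law n x f\<^sub>0).
      measure (posterior (forest_prior p n x Cbar a c C\<^sub>T l) n x Y)
        {f \<in> forest_functions p n x Cbar. emp_norm n x (\<lambda>z. f\<^sub>0 z - f z) > R} > \<delta>}
    \<le> real (card Idx) * (sqrt 2 ^ (k + 1) * exp (- G / 4)) + \<eta> * exp c1 + exp (- t)"
proof -
  define W where "W = gauss_law n \<mu>"
  define \<Theta> where "\<Theta> = forest_prior p n x Cbar a c C\<^sub>T l"
  define A where "A = {f \<in> forest_functions p n x Cbar. emp_norm n x (\<lambda>z. f\<^sub>0 z - f z) > R}"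
  define Q where "Q E = step_height_prior (map tree_rep E)" for E
  define v where "v E B i = ensemble_fun (map tree_rep E) B (x i)" for E B i
  define \<Phi> where "\<Phi> \<C> = cell_vector x ` \<C>" for \<C>
  interpret W: prob_space W unfolding W_def by (rule prob_space_gauss_law)
  have pQ: "prob_space (Q E)" for E unfolding Q_def by (rule prob_space_step_height_prior)
  interpret P: prob_space \<Theta> unfolding \<Theta>_def
    using ne valid unfolding ens_def by (rule prob_space_forest_prior)
  have vm: "(\<lambda>B. v E B i) \<in> borel_measurable (Q E)" if "E \<in> set_pmf ens" for E i
    unfolding v_def Q_def using valid_forest_finite[OF valid[OF that]] by (intro measurable_ensemble_fun) auto
  have Lm: "(\<lambda>(B, Y). lratio n \<mu> (v E B) Y) \<in> borel_measurable (Q E \<Otimes>\<^sub>M W)" if "E \<in> set_pmf ens" for E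
    unfolding W_def by (rule borel_measurable_lratio_pair) (rule vm[OF that])
  have evm: "(\<lambda>f. f (x i)) \<in> borel_measurable \<Theta>" if "i \<in> {1..n}" for i
    using measurable_forest_eval[OF design[OF that]] sets_forest_prior[OF ne]
    unfolding \<Theta>_def by (simp cong: measurable_cong_sets)
  have sets\<Theta>: "sets \<Theta> = sets (forest_space p n x Cbar)"
    unfolding \<Theta>_def by (rule sets_forest_prior[OF ne])
  have space\<Theta>: "space \<Theta> = forest_functions p n x Cbar"
  proof -
    have "forest_functions p n x Cbar \<subseteq> space (PiM (cube p) (\<lambda>_. borel))"
      by (auto simp: forest_functions_def space_PiM)
    then show ?thesis
      using sets_eq_imp_space_eq[OF sets\<Theta>] by (auto simp: forest_space_def space_restrict_space)
  qed
  have A: "A \<in> sets \<Theta>"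
  proof -
    have [measurable]: "(\<lambda>f. f (x i)) \<in> borel_measurable \<Theta>" if "i \<in> {1..n}" for i by (rule evm[OF that])
    have "A = {f \<in> space \<Theta>. sqrt (1 / real n * (\<Sum>i=1..n. (f\<^sub>0 (x i) - f (x i))\<^sup>2)) > R}"
      by (simp add: A_def space\<Theta> emp_norm_def)
    also have "\<dots> \<in> sets \<Theta>" by measurable
    finally show ?thesis .
  qed
  have far: "(\<Sum>i=1..n. (f (x i) - \<mu> i)\<^sup>2) \<ge> real n * R\<^sup>2" if "f \<in> A" for f
  proof -
    have "R < sqrt (1 / real n * (\<Sum>i=1..n. (f\<^sub>0 (x i) - f (x i))\<^sup>2))"
      using that by (simp add: A_def emp_norm_def)
    then have "R\<^sup>2 < 1 / real n * (\<Sum>i=1..n. (f\<^sub>0 (x i) - f (x i))\<^sup>2)"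
      using R real_less_rsqrt sqrt_le_D by (metis linorder_not_less real_sqrt_unique abs_of_nonneg real_le_lsqrt)
    then have "real n * R\<^sup>2 \<le> (\<Sum>i=1..n. (f\<^sub>0 (x i) - f (x i))\<^sup>2)"
      using n by (simp add: field_simps)
    also have "\<dots> = (\<Sum>i=1..n. (f (x i) - \<mu> i)\<^sup>2)"
      by (intro sum.cong) (auto simp: \<mu>_def power2_commute)
    finally show ?thesis .
  qed
  have lift_eval: "lift_fun p (map tree_rep E) B (x i) = v E B i" if "i \<in> {1..n}" for E B i
    using design[OF that] by (simp add: lift_fun_def v_def)
  have lift_lratio: "lratio n \<mu> (\<lambda>i. lift_fun p (map tree_rep E) B (x i)) Y = lratio n \<mu> (v E B) Y" for E B Y
    unfolding lratio_def using lift_eval by (intro arg_cong[of _ _ exp] arg_cong2[of _ _ _ _ "(-)"] sum.cong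
      arg_cong[of _ _ "\<lambda>u. u / 2"]) auto

  \<comment> \<open>One random variable per cell set bounds the likelihood ratio for all step
    heights at once; no discretization of the heights enters.\<close>
  have "\<exists>g. \<forall>\<C>\<in>Idx. g \<C> \<in> borel_measurable W \<and>
      (\<integral>\<^sup>+Y. ennreal (exp (g \<C> Y / 4)) \<partial>W) \<le> ennreal (sqrt 2 ^ (k + 1)) \<and>
      (\<forall>w Y. in_span n (\<Phi> \<C>) w \<longrightarrow> lratio n \<mu> w Y \<le> exp (g \<C> Y - (\<Sum>i=1..n. (w i - \<mu> i)\<^sup>2) / 4))"
  proof (intro bchoice ballI)
    fix \<C> assume \<C>: "\<C> \<in> Idx"
    have fin: "finite (\<Phi> \<C>)" using Idx(2)[OF \<C>] by (simp add: \<Phi>_def)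
    obtain g where g: "g \<in> borel_measurable (gauss_law n \<mu>)"
      "(\<integral>\<^sup>+Y. ennreal (exp (g Y / 4)) \<partial>gauss_law n \<mu>) \<le> ennreal (sqrt 2 ^ (card (\<Phi> \<C>) + 1))"
      "\<And>w Y. in_span n (\<Phi> \<C>) w \<Longrightarrow> lratio n \<mu> w Y \<le> exp (g Y - (\<Sum>i=1..n. (w i - \<mu> i)\<^sup>2) / 4)"
      using lratio_span_bound[OF fin, of n \<mu>] by blast
    have "card (\<Phi> \<C>) \<le> k" using Idx(2)[OF \<C>] card_image_le[of \<C> "cell_vector x"] by (simp add: \<Phi>_def)
    then have "ennreal (sqrt 2 ^ (card (\<Phi> \<C>) + 1)) \<le> ennreal (sqrt 2 ^ (k + 1))"
      by (intro ennreal_leI power_increasing) auto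
    then show "\<exists>g. g \<in> borel_measurable W \<and>
      (\<integral>\<^sup>+Y. ennreal (exp (g Y / 4)) \<partial>W) \<le> ennreal (sqrt 2 ^ (k + 1)) \<and>
      (\<forall>w Y. in_span n (\<Phi> \<C>) w \<longrightarrow> lratio n \<mu> w Y \<le> exp (g Y - (\<Sum>i=1..n. (w i - \<mu> i)\<^sup>2) / 4))"
      using g unfolding W_def by (intro exI[of _ g]) (auto intro: order_trans)
  qed
  then obtain g where gm: "\<And>\<C>. \<C> \<in> Idx \<Longrightarrow> g \<C> \<in> borel_measurable W"
    and gi: "\<And>\<C>. \<C> \<in> Idx \<Longrightarrow> (\<integral>\<^sup>+Y. ennreal (exp (g \<C> Y / 4)) \<partial>W) \<le> ennreal (sqrt 2 ^ (k + 1))"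
    and gb: "\<And>\<C> w Y. \<C> \<in> Idx \<Longrightarrow> in_span n (\<Phi> \<C>) w \<Longrightarrow>
        lratio n \<mu> w Y \<le> exp (g \<C> Y - (\<Sum>i=1..n. (w i - \<mu> i)\<^sup>2) / 4)"
    by blast

  define LE where "LE E Y = (\<integral>\<^sup>+B. ennreal (lratio n \<mu> (v E B) Y) \<partial>Q E)" for E Y
  define h1 where "h1 Y = (\<integral>\<^sup>+E. indicator (- Sv) E * LE E Y \<partial>measure_pmf ens)" for Y
  define h3 where "h3 Y = (\<integral>\<^sup>+B. ennreal (1 / lratio n \<mu> (v E\<^sub>0 B) Y) * indicator X B \<partial>Q E\<^sub>0)" for Y
  define \<beta> where "\<beta> = measure (Q E\<^sub>0) X"
  \<comment> \<open>The variables compared with the thresholds have means at most \<eta> for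
    \<open>h1\<close>, sqrt 2 ^ (k+1) for exp(g/4), and \<beta> exp(\<rho>) for \<open>h3\<close>.
    The last threshold exceeds its mean by exactly the factor exp(t).\<close>
  define G1 where "G1 = {Y \<in> space W. h1 Y > ennreal (exp (- c1))}"
  define G2 where "G2 \<C> = {Y \<in> space W. ennreal (exp (g \<C> Y / 4)) > ennreal (exp (G / 4))}" for \<C>
  define G3 where "G3 = {Y \<in> space W. h3 Y > ennreal (\<beta> * exp (\<rho> + t))}"

  have LEm: "LE E \<in> borel_measurable W" if "E \<in> set_pmf ens" for E
  proof -
    interpret sigma_finite_measure "Q E" using pQ by (simp add: prob_space_imp_sigma_finite)
    have "(\<lambda>(Y, B). ennreal (lratio n \<mu> (v E B) Y)) \<in> borel_measurable (W \<Otimes>\<^sub>M Q E)"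
      using measurable_pair_swap[OF Lm[OF that]] by (simp add: case_prod_beta)
    then show ?thesis unfolding LE_def by (rule borel_measurable_nn_integral)
  qed
  have LEi: "(\<integral>\<^sup>+Y. LE E Y \<partial>W) = 1" if "E \<in> set_pmf ens" for E
  proof -
    interpret Q: prob_space "Q E" by (rule pQ)
    interpret pair_sigma_finite "Q E" W ..
    have "(\<integral>\<^sup>+Y. LE E Y \<partial>W) = (\<integral>\<^sup>+B. \<integral>\<^sup>+Y. ennreal (lratio n \<mu> (v E B) Y) \<partial>W \<partial>Q E)"
      unfolding LE_def using Lm[OF that] by (intro Fubini') (simp add: case_prod_beta)
    then show ?thesis unfolding W_def by (simp add: nn_integral_lratio Q.emeasure_space_1)
  qed
  have f1: "(\<lambda>Y. indicator (- Sv) E * LE E Y) \<in> borel_measurable W" if "E \<in> set_pmf ens" for E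
    using LEm[OF that] by auto
  have h1m: "h1 \<in> borel_measurable W"
    unfolding h1_def using W.prob_space_axioms f1 by (rule borel_measurable_nn_integral_pmf)
  have h1i: "(\<integral>\<^sup>+Y. h1 Y \<partial>W) \<le> ennreal \<eta>"
  proof -
    have "(\<integral>\<^sup>+Y. h1 Y \<partial>W) = (\<integral>\<^sup>+E. \<integral>\<^sup>+Y. indicator (- Sv) E * LE E Y \<partial>W \<partial>measure_pmf ens)"
      unfolding h1_def using W.prob_space_axioms f1 by (rule nn_integral_pmf_swap)
    also have "\<dots> = (\<integral>\<^sup>+E. indicator (- Sv) E \<partial>measure_pmf ens)"
      using LEi LEm by (intro nn_integral_cong_AE AE_pmfI) (simp add: nn_integral_cmult)
    also have "\<dots> = ennreal (measure (measure_pmf ens) (- Sv))"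
      by (simp add: measure_pmf.emeasure_eq_measure)
    also have "\<dots> \<le> ennreal \<eta>" using compl by (rule ennreal_leI)
    finally show ?thesis .
  qed
  have \<eta>: "\<eta> \<ge> 0" using compl measure_nonneg order_trans by blast
  have P1: "measure W G1 \<le> \<eta> * exp c1"
    unfolding G1_def using W.prob_gt_le_nn_integral[OF h1m h1i _ \<eta>, of "exp (- c1)"]
    by (simp add: exp_minus inverse_eq_divide)
  have P2: "measure W (G2 \<C>) \<le> sqrt 2 ^ (k + 1) * exp (- G / 4)" if "\<C> \<in> Idx" for \<C>
  proof -
    have m: "(\<lambda>Y. ennreal (exp (g \<C> Y / 4))) \<in> borel_measurable W" using gm[OF that] by measurable
    have "measure W (G2 \<C>) \<le> sqrt 2 ^ (k + 1) / exp (G / 4)"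
      unfolding G2_def by (rule W.prob_gt_le_nn_integral[OF m gi[OF that]]) simp_all
    moreover have "b / exp (G / 4) = b * exp (- G / 4)" for b :: real
      by (simp add: exp_minus inverse_eq_divide)
    ultimately show ?thesis by (simp only:)
  qed
  have \<beta>: "\<beta> > 0"
  proof -
    have "0 < pmf ens E\<^sub>0 * \<beta>" using mass exp_gt_zero[of "- \<gamma>"] unfolding \<beta>_def Q_def by linarith
    then show ?thesis by (simp add: zero_less_mult_iff pmf_nonneg not_less[symmetric])
  qed
  have XQ [measurable]: "X \<in> sets (Q E\<^sub>0)" using X unfolding Q_def .
  have Km: "(\<lambda>(B, Y). ennreal (1 / lratio n \<mu> (v E\<^sub>0 B) Y) * indicator X B) \<in> borel_measurable (Q E\<^sub>0 \<Otimes>\<^sub>M W)"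
  proof -
    have [measurable]: "(\<lambda>z. lratio n \<mu> (v E\<^sub>0 (fst z)) (snd z)) \<in> borel_measurable (Q E\<^sub>0 \<Otimes>\<^sub>M W)"
      using Lm[OF E0] by (simp add: case_prod_beta)
    show ?thesis unfolding case_prod_beta by measurable
  qed
  have h3m: "h3 \<in> borel_measurable W"
  proof -
    interpret sigma_finite_measure "Q E\<^sub>0" using pQ by (simp add: prob_space_imp_sigma_finite)
    show ?thesis unfolding h3_def
      using measurable_pair_swap[OF Km] by (intro borel_measurable_nn_integral) (simp add: case_prod_beta)
  qed
  have h3i: "(\<integral>\<^sup>+Y. h3 Y \<partial>W) \<le> ennreal (\<beta> * exp \<rho>)"
  proof -
    interpret Q: prob_space "Q E\<^sub>0" by (rule pQ)
    interpret pair_sigma_finite "Q E\<^sub>0" W ..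
    have "(\<integral>\<^sup>+Y. h3 Y \<partial>W) =
      (\<integral>\<^sup>+B. \<integral>\<^sup>+Y. ennreal (1 / lratio n \<mu> (v E\<^sub>0 B) Y) * indicator X B \<partial>W \<partial>Q E\<^sub>0)"
      unfolding h3_def using Km by (intro Fubini') (simp add: case_prod_beta)
    also have "\<dots> = (\<integral>\<^sup>+B. ennreal (exp (\<Sum>i=1..n. (v E\<^sub>0 B i - \<mu> i)\<^sup>2)) * indicator X B \<partial>Q E\<^sub>0)"
    proof (intro nn_integral_cong)
      fix B
      have "(\<integral>\<^sup>+Y. ennreal (1 / lratio n \<mu> (v E\<^sub>0 B) Y) * indicator X B \<partial>W) =
        (\<integral>\<^sup>+Y. ennreal (1 / lratio n \<mu> (v E\<^sub>0 B) Y) \<partial>W) * indicator X B"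
        unfolding W_def by (intro nn_integral_multc) measurable
      then show "(\<integral>\<^sup>+Y. ennreal (1 / lratio n \<mu> (v E\<^sub>0 B) Y) * indicator X B \<partial>W) =
        ennreal (exp (\<Sum>i=1..n. (v E\<^sub>0 B i - \<mu> i)\<^sup>2)) * indicator X B"
        unfolding W_def by (simp only: nn_integral_inverse_lratio)
    qed
    also have "\<dots> \<le> (\<integral>\<^sup>+B. ennreal (exp \<rho>) * indicator X B \<partial>Q E\<^sub>0)"
      using near by (intro nn_integral_mono) (auto simp: indicator_def v_def intro!: ennreal_leI)
    also have "\<dots> = ennreal (exp \<rho>) * ennreal \<beta>"
      unfolding \<beta>_def by (simp add: nn_integral_cmult_indicator Q.emeasure_eq_measure)
    finally show ?thesis using \<beta> by (simp add: ennreal_mult mult.commute)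
  qed
  have P3: "measure W G3 \<le> exp (- t)"
    unfolding G3_def using W.prob_gt_le_nn_integral[OF h3m h3i, of "\<beta> * exp (\<rho> + t)"] \<beta>
    by (simp add: exp_minus inverse_eq_divide exp_add)

  let ?u = "exp (G - real n * R\<^sup>2 / 4) + exp (- c1)"
  let ?w = "exp (- (\<gamma> + \<rho> + t))"
  have good: "measure (posterior \<Theta> n x Y) A \<le> \<delta>"
    if Y: "Y \<in> space W" "Y \<notin> G1" "Y \<notin> G3" "\<And>\<C>. \<C> \<in> Idx \<Longrightarrow> Y \<notin> G2 \<C>" for Y
  proof -
    have Lmeas: "(\<lambda>f. lratio n \<mu> (\<lambda>i. f (x i)) Y) \<in> borel_measurable \<Theta>"
    proof -
      have [measurable]: "(\<lambda>f. f (x i)) \<in> borel_measurable \<Theta>" if "i \<in> {1..n}" for i by (rule evm[OF that])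
      show ?thesis unfolding lratio_def by measurable
    qed
    have numm: "(\<lambda>f. ennreal (lratio n \<mu> (\<lambda>i. f (x i)) Y) * indicator A f) \<in> borel_measurable \<Theta>"
      using Lmeas A by auto
    have sieve_bd: "lratio n \<mu> (v E B) Y \<le> exp (G - real n * R\<^sup>2 / 4)"
      if E: "E \<in> set_pmf ens" "E \<in> Sv" and BA: "lift_fun p (map tree_rep E) B \<in> A" for E B
    proof -
      let ?C = "\<Union>(set (map tree_rep E))"
      have C: "?C \<in> Idx" by (rule sieve[OF E])
      have "in_span n (\<Phi> ?C) (v E B)"
        unfolding \<Phi>_def v_def using Idx(2)[OF C] by (intro in_span_ensemble_fun) auto
      from gb[OF C this] have "lratio n \<mu> (v E B) Y \<le> exp (g ?C Y - (\<Sum>i=1..n. (v E B i - \<mu> i)\<^sup>2) / 4)" .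
      also have "\<dots> \<le> exp (G - real n * R\<^sup>2 / 4)"
      proof -
        have "g ?C Y \<le> G"
          using Y(4)[OF C] Y(1) unfolding G2_def by (simp add: ennreal_less_iff not_less)
        moreover have "real n * R\<^sup>2 \<le> (\<Sum>i=1..n. (v E B i - \<mu> i)\<^sup>2)"
          using far[OF BA] lift_eval by simp
        ultimately show ?thesis by simp
      qed
      finally show ?thesis .
    qed
    have "(\<integral>\<^sup>+f. ennreal (lratio n \<mu> (\<lambda>i. f (x i)) Y) * indicator A f \<partial>\<Theta>) =
      (\<integral>\<^sup>+E. \<integral>\<^sup>+B. ennreal (lratio n \<mu> (v E B) Y) * indicator A (lift_fun p (map tree_rep E) B) \<partial>Q E \<partial>measure_pmf ens)"
      unfolding \<Theta>_def Q_def ens_def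
      using numm valid
      by (subst nn_integral_forest_prior[OF ne]) (auto simp: lift_lratio ens_def \<Theta>_def sets_forest_prior[OF ne] cong: measurable_cong_sets)
    also have "\<dots> \<le> (\<integral>\<^sup>+E. ennreal (exp (G - real n * R\<^sup>2 / 4)) + indicator (- Sv) E * LE E Y \<partial>measure_pmf ens)"
    proof (intro nn_integral_mono_AE AE_pmfI)
      fix E assume E: "E \<in> set_pmf ens"
      interpret Q: prob_space "Q E" by (rule pQ)
      show "(\<integral>\<^sup>+B. ennreal (lratio n \<mu> (v E B) Y) * indicator A (lift_fun p (map tree_rep E) B) \<partial>Q E)
        \<le> ennreal (exp (G - real n * R\<^sup>2 / 4)) + indicator (- Sv) E * LE E Y"
      proof (cases "E \<in> Sv")
        case True
        have "(\<integral>\<^sup>+B. ennreal (lratio n \<mu> (v E B) Y) * indicator A (lift_fun p (map tree_rep E) B) \<partial>Q E)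
          \<le> (\<integral>\<^sup>+B. ennreal (exp (G - real n * R\<^sup>2 / 4)) \<partial>Q E)"
          using sieve_bd[OF E True] by (intro nn_integral_mono) (auto simp: indicator_def intro!: ennreal_leI)
        also have "\<dots> = ennreal (exp (G - real n * R\<^sup>2 / 4))" by (simp add: Q.emeasure_space_1)
        finally show ?thesis using True by simp
      next
        case False
        have "(\<integral>\<^sup>+B. ennreal (lratio n \<mu> (v E B) Y) * indicator A (lift_fun p (map tree_rep E) B) \<partial>Q E) \<le> LE E Y"
          unfolding LE_def by (intro nn_integral_mono) (auto simp: indicator_def)
        then show ?thesis using False by (simp add: add_increasing)
      qed
    qed
    also have "\<dots> = ennreal (exp (G - real n * R\<^sup>2 / 4)) + h1 Y"
      unfolding h1_def by (subst nn_integral_add) (auto simp: measure_pmf.emeasure_space_1)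
    also have "\<dots> \<le> ennreal (exp (G - real n * R\<^sup>2 / 4)) + ennreal (exp (- c1))"
      using Y(1,2) by (intro add_left_mono) (simp add: G1_def not_less)
    finally have num: "(\<integral>\<^sup>+f. ennreal (lratio n \<mu> (\<lambda>i. f (x i)) Y) * indicator A f \<partial>\<Theta>) \<le> ennreal ?u"
      by (simp add: ennreal_plus)
    have vm0: "(\<lambda>B. lratio n \<mu> (v E\<^sub>0 B) Y) \<in> borel_measurable (Q E\<^sub>0)"
    proof -
      have [measurable]: "(\<lambda>B. v E\<^sub>0 B i) \<in> borel_measurable (Q E\<^sub>0)" for i by (rule vm[OF E0])
      show ?thesis unfolding lratio_def by measurable
    qed
    have "ennreal ?w \<le> ennreal (pmf ens E\<^sub>0 * (\<beta> / exp (\<rho> + t)))"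
    proof (rule ennreal_leI)
      have "?w = exp (- \<gamma>) / exp (\<rho> + t)" by (simp add: algebra_simps flip: exp_diff)
      also have "\<dots> \<le> pmf ens E\<^sub>0 * \<beta> / exp (\<rho> + t)"
        using mass unfolding \<beta>_def Q_def by (intro divide_right_mono) auto
      finally show "?w \<le> pmf ens E\<^sub>0 * (\<beta> / exp (\<rho> + t))" by simp
    qed
    also have "\<dots> = ennreal (pmf ens E\<^sub>0) * ennreal (\<beta> / exp (\<rho> + t))"
      using \<beta> by (intro ennreal_mult) auto
    also have "ennreal (\<beta> / exp (\<rho> + t)) \<le> (\<integral>\<^sup>+B. ennreal (lratio n \<mu> (v E\<^sub>0 B) Y) * indicator X B \<partial>Q E\<^sub>0)"
      unfolding \<beta>_def
      using Y(1,3) \<beta> unfolding G3_def h3_def \<beta>_def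
      by (intro inverse_integral_bound pQ XQ vm0 lratio_pos) (auto simp: not_less)
    also have "\<dots> \<le> LE E\<^sub>0 Y"
      unfolding LE_def by (intro nn_integral_mono) (auto simp: indicator_def)
    \<comment> \<open>The evidence is reduced to the single ensemble
      \<open>E\<^sub>0\<close>.\<close>
    also have "ennreal (pmf ens E\<^sub>0) * LE E\<^sub>0 Y \<le> (\<integral>\<^sup>+E. LE E Y \<partial>measure_pmf ens)"
    proof -
      have "ennreal (pmf ens E\<^sub>0) * LE E\<^sub>0 Y = (\<integral>\<^sup>+E. LE E\<^sub>0 Y * indicator {E\<^sub>0} E \<partial>measure_pmf ens)"
        by (simp add: nn_integral_cmult_indicator emeasure_pmf_single mult.commute)
      also have "\<dots> \<le> (\<integral>\<^sup>+E. LE E Y \<partial>measure_pmf ens)"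
        by (intro nn_integral_mono) (auto simp: indicator_def)
      finally show ?thesis .
    qed
    also have "\<dots> = (\<integral>\<^sup>+f. ennreal (lratio n \<mu> (\<lambda>i. f (x i)) Y) \<partial>\<Theta>)"
      unfolding \<Theta>_def LE_def Q_def ens_def
      using Lmeas valid
      by (subst nn_integral_forest_prior[OF ne]) (auto simp: lift_lratio ens_def \<Theta>_def sets_forest_prior[OF ne] cong: measurable_cong_sets)
    finally have den: "ennreal ?w \<le> (\<integral>\<^sup>+f. ennreal (lratio n \<mu> (\<lambda>i. f (x i)) Y) \<partial>\<Theta>)"
      by (simp add: mult_left_mono)
    have "measure (posterior \<Theta> n x Y) A \<le> ?u / ?w"
      using P.prob_space_axioms A evm num den unfolding \<mu>_def
      by (rule posterior_le) (auto intro: add_nonneg_nonneg)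
    also have "?u / ?w = ?u * exp (\<gamma> + \<rho> + t)"
      unfolding exp_minus[of "\<gamma> + \<rho> + t"] divide_inverse inverse_inverse_eq ..
    also note small
    finally show ?thesis .
  qed
  have G2m: "G2 \<C> \<in> sets W" if "\<C> \<in> Idx" for \<C>
    unfolding G2_def using gm[OF that] by measurable
  have sm: "G1 \<in> sets W" "G3 \<in> sets W" "(\<Union>\<C>\<in>Idx. G2 \<C>) \<in> sets W"
    using h1m h3m Idx(1) G2m unfolding G1_def G3_def by (auto intro: sets.finite_UN)
  \<comment> \<open>Inclusion in a measurable event is enough for monotonicity of
    \<open>measure\<close>, so measurability of the posterior mass as a function of Y is not at
    issue.\<close>
  have "{Y \<in> space W. measure (posterior \<Theta> n x Y) A > \<delta>} \<subseteq> (\<Union>\<C>\<in>Idx. G2 \<C>) \<union> G1 \<union> G3"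
    using good by (auto simp: not_le[symmetric])
  then have "measure W {Y \<in> space W. measure (posterior \<Theta> n x Y) A > \<delta>} \<le> measure W ((\<Union>\<C>\<in>Idx. G2 \<C>) \<union> G1 \<union> G3)"
    using sm by (intro W.finite_measure_mono) auto
  also have "\<dots> \<le> measure W (\<Union>\<C>\<in>Idx. G2 \<C>) + measure W G1 + measure W G3"
    using measure_Un_le[of "(\<Union>\<C>\<in>Idx. G2 \<C>) \<union> G1" W G3] measure_Un_le[of "\<Union>\<C>\<in>Idx. G2 \<C>" W G1] sm
    by auto
  also have "measure W (\<Union>\<C>\<in>Idx. G2 \<C>) \<le> (\<Sum>\<C>\<in>Idx. measure W (G2 \<C>))"
    using Idx(1) G2m by (intro W.finite_measure_subadditive_finite) auto
  also have "\<dots> \<le> (\<Sum>\<C>\<in>Idx. sqrt 2 ^ (k + 1) * exp (- G / 4))" by (intro sum_mono P2)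
  finally show ?thesis
    using P1 P3 unfolding \<Theta>_def A_def W_def data_law_gauss \<mu>_def by simp
qed


section \<open>Mass of the prior\<close>

lemma pmf_bind_ge: "pmf M x * pmf (f x) y \<le> pmf (bind_pmf M f) y"
proof -
  have "ennreal (pmf M x * pmf (f x) y) = (\<integral>\<^sup>+z. ennreal (pmf (f x) y) * indicator {x} z \<partial>measure_pmf M)"
    by (simp add: nn_integral_cmult_indicator emeasure_pmf_single ennreal_mult mult.commute)
  also have "\<dots> \<le> (\<integral>\<^sup>+z. ennreal (pmf (f z) y) \<partial>measure_pmf M)"
    by (intro nn_integral_mono) (auto simp: indicator_def)
  also have "\<dots> = ennreal (pmf (bind_pmf M f) y)" by (rule ennreal_pmf_bind[symmetric])
  finally show ?thesis by (simp add: ennreal_le_iff)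
qed

lemma emeasure_bind_pmf_le:
  assumes "\<And>x. x \<in> set_pmf M \<Longrightarrow> emeasure (measure_pmf (f x)) A \<le> u"
  shows "emeasure (measure_pmf (bind_pmf M f)) A \<le> u"
proof -
  have "emeasure (measure_pmf (bind_pmf M f)) A = (\<integral>\<^sup>+x. emeasure (measure_pmf (f x)) A \<partial>measure_pmf M)"
    by simp
  also have "\<dots> \<le> (\<integral>\<^sup>+x. u \<partial>measure_pmf M)"
    using assms by (intro nn_integral_mono_AE AE_pmfI) auto
  finally show ?thesis by (simp add: measure_pmf.emeasure_space_1)
qed

lemma measure_bind_pmf_le:
  assumes "\<And>x. x \<in> set_pmf M \<Longrightarrow> x \<notin> B \<Longrightarrow> set_pmf (f x) \<inter> A = {}"
  shows "measure (measure_pmf (bind_pmf M f)) A \<le> measure (measure_pmf M) B"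
proof -
  have "emeasure (measure_pmf (bind_pmf M f)) A = (\<integral>\<^sup>+x. emeasure (measure_pmf (f x)) A \<partial>measure_pmf M)"
    by simp
  also have "\<dots> \<le> (\<integral>\<^sup>+x. indicator B x \<partial>measure_pmf M)"
  proof (intro nn_integral_mono_AE AE_pmfI)
    fix x assume x: "x \<in> set_pmf M"
    show "emeasure (measure_pmf (f x)) A \<le> indicator B x"
    proof (cases "x \<in> B")
      case True then show ?thesis by (simp add: measure_pmf.emeasure_le_1)
    next
      case False
      then show ?thesis using assms[OF x]
        by (simp add: measure_pmf.emeasure_eq_measure measure_pmf_zero_iff)
    qed
  qed
  also have "\<dots> = emeasure (measure_pmf M) B" by simp
  finally show ?thesis by (simp add: measure_pmf.emeasure_eq_measure)
qed

lemma measure_cond_pmf_le: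
  assumes ne: "set_pmf M \<inter> V \<noteq> {}"
  shows "measure (measure_pmf (cond_pmf M V)) A \<le> measure (measure_pmf M) (A \<inter> V) / measure (measure_pmf M) V"
proof -
  define m where "m = measure (measure_pmf M) V"
  have m: "m > 0" unfolding m_def using ne measure_pmf_posI by fastforce
  have "emeasure (measure_pmf (cond_pmf M V)) A =
      (\<integral>\<^sup>+x. ennreal (pmf (cond_pmf M V) x) * indicator A x \<partial>count_space UNIV)"
    by (simp flip: nn_integral_measure_pmf)
  also have "\<dots> = (\<integral>\<^sup>+x. ennreal (1 / m) * (ennreal (pmf M x) * indicator (A \<inter> V) x) \<partial>count_space UNIV)"
    using m by (intro nn_integral_cong)
      (auto simp: pmf_cond[OF ne] m_def[symmetric] indicator_def simp flip: ennreal_mult)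
  also have "\<dots> = ennreal (1 / m) * emeasure (measure_pmf M) (A \<inter> V)"
    by (subst nn_integral_cmult) (simp_all flip: nn_integral_measure_pmf)
  also have "\<dots> = ennreal (measure (measure_pmf M) (A \<inter> V) / m)"
    using m by (simp add: measure_pmf.emeasure_eq_measure flip: ennreal_mult)
  finally show ?thesis unfolding m_def[symmetric] using m by (simp add: measure_pmf.emeasure_eq_measure)
qed

lemma nn_integral_replicate_pmf:
  "(\<integral>\<^sup>+xs. prod_list (map g xs) \<partial>measure_pmf (replicate_pmf T M)) = (\<integral>\<^sup>+x. g x \<partial>measure_pmf M) ^ T"
proof (induction T)
  case (Suc T)
  then show ?case by (simp add: nn_integral_cmult nn_integral_multc)
qed simp

text \<open>From u/T \<le> exp(u/T). It makes the T-fold product of tree-size moments bounded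
  uniformly in T.\<close>

lemma power_div_le_exp:
  assumes "u \<ge> 0" "T \<ge> 1"
  shows "(u / real T) ^ T \<le> exp u"
proof -
  have "(u / real T) ^ T \<le> exp (u / real T) ^ T"
    using assms exp_ge_add_one_self[of "u / real T"] by (intro power_mono) (linarith, simp)
  also have "\<dots> = exp u" using assms by (simp flip: exp_of_nat_mult)
  finally show ?thesis .
qed

text \<open>The normalizer exp y - 1 is at least y, and K! \<ge> (K-2)!, so each term is at most (s
  y)^K / (y (K-2)!), which is s^2 y times an exponential-series term. What matters is the surviving
  factor y, equal to l/T in the application.\<close>

lemma tree_size_gen_fun:
  assumes y: "y > 0" and s: "s \<ge> 0"
  shows "(\<integral>\<^sup>+K. (if 2 \<le> K then ennreal (s ^ K) else 0) \<partial>measure_pmf (tree_size_prior y)) \<le>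
    ennreal (s\<^sup>2 * y * exp (s * y))"
proof -
  define b where "b K = (if 2 \<le> K then s\<^sup>2 * y * ((s * y) ^ (K - 2) / fact (K - 2)) else 0)" for K :: nat
  have "(\<lambda>K. (s * y) ^ K / fact K) sums exp (s * y)"
    using exp_converges[of "s * y"] by (simp add: divide_inverse mult.commute)
  then have "(\<lambda>K. s\<^sup>2 * y * ((s * y) ^ K / fact K)) sums (s\<^sup>2 * y * exp (s * y))"
    by (rule sums_mult)
  then have "(\<lambda>K. b (K + 2)) sums (s\<^sup>2 * y * exp (s * y))" by (simp add: b_def)
  then have bs: "b sums (s\<^sup>2 * y * exp (s * y))"
    using sums_iff_shift[of b 2 "s\<^sup>2 * y * exp (s * y)"] by (simp add: b_def lessThan_Suc numeral_2_eq_2)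
  have bpos: "b K \<ge> 0" for K using y s by (simp add: b_def)
  have le: "ennreal (pmf (tree_size_prior y) K) * (if 2 \<le> K then ennreal (s ^ K) else 0) \<le> ennreal (b K)" for K
  proof (cases "2 \<le> K")
    case True
    define j where "j = K - 2"
    have K: "K = j + 2" using True by (simp add: j_def)
    have e: "exp y - 1 \<ge> y" using exp_ge_add_one_self[of y] by linarith
    have f: "(fact j :: real) \<le> fact K" unfolding K by (rule fact_mono) simp
    have "pmf (tree_size_prior y) K * s ^ K = (s * y) ^ K / ((exp y - 1) * fact K)"
      using True by (simp add: pmf_tree_size_prior[OF y] power_mult_distrib)
    also have "\<dots> \<le> (s * y) ^ K / (y * fact j)"
      using e f y s by (intro divide_left_mono mult_mono mult_pos_pos) auto
    also have "\<dots> = s\<^sup>2 * y * ((s * y) ^ j / fact j)"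
      using y by (simp add: K power_add power2_eq_square)
    finally show ?thesis using True s unfolding b_def j_def[symmetric]
      by (simp add: ennreal_leI flip: ennreal_mult)
  qed simp
  have "(\<integral>\<^sup>+K. (if 2 \<le> K then ennreal (s ^ K) else 0) \<partial>measure_pmf (tree_size_prior y)) \<le> (\<integral>\<^sup>+K. ennreal (b K) \<partial>count_space UNIV)"
    unfolding nn_integral_measure_pmf by (intro nn_integral_mono le)
  also have "\<dots> = (\<Sum>K. ennreal (b K))" by (rule nn_integral_count_space_nat)
  also have "\<dots> = ennreal (s\<^sup>2 * y * exp (s * y))"
    using bs bpos by (simp add: suminf_ennreal2 sums_iff)
  finally show ?thesis .
qed

text \<open>A Chernoff bound with s to the total size. Each tree contributes s^2 (l/T) exp(s l/T),
  and the T-th power is bounded independently of T. Sizes equal to 1 must be excluded: their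
  probability y / (exp y - 1) is near 1 for small y and would contribute about s per tree.\<close>

lemma tree_sizes_tail:
  assumes l: "l > 0" and s: "s \<ge> 1" and T: "T \<ge> 1"
  shows "measure (measure_pmf (replicate_pmf T (tree_size_prior (l / real T))))
      {Ks. (\<forall>K\<in>set Ks. 2 \<le> K) \<and> k < sum_list Ks} \<le> exp (s\<^sup>2 * l + s * l) / s ^ k"
proof -
  let ?M = "measure_pmf (replicate_pmf T (tree_size_prior (l / real T)))"
  let ?A = "{Ks. (\<forall>K\<in>set Ks. 2 \<le> K) \<and> k < sum_list Ks}"
  \<comment> \<open>The value zero below size 2 builds the restriction on the list into the product
    of the moments.\<close>
  let ?g = "\<lambda>K. if 2 \<le> K then ennreal (s ^ K) else 0"
  have g: "prod_list (map ?g Ks) = ennreal (s ^ sum_list Ks)" if "\<forall>K\<in>set Ks. 2 \<le> K" for Ks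
    using that s by (induction Ks) (auto simp: power_add ennreal_mult)
  have "ennreal (s ^ k) * emeasure ?M ?A = (\<integral>\<^sup>+Ks. ennreal (s ^ k) * indicator ?A Ks \<partial>?M)"
    by (simp add: nn_integral_cmult_indicator)
  also have "\<dots> \<le> (\<integral>\<^sup>+Ks. prod_list (map ?g Ks) \<partial>?M)"
    using s by (intro nn_integral_mono)
      (auto simp: indicator_def g intro!: ennreal_leI power_increasing)
  also have "\<dots> = (\<integral>\<^sup>+K. ?g K \<partial>measure_pmf (tree_size_prior (l / real T))) ^ T"
    by (rule nn_integral_replicate_pmf)
  also have "\<dots> \<le> ennreal (s\<^sup>2 * (l / real T) * exp (s * (l / real T))) ^ T"
    using l s T by (intro power_mono tree_size_gen_fun) auto
  also have "\<dots> = ennreal ((s\<^sup>2 * l / real T) ^ T * exp (s * l / real T) ^ T)"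
  proof -
    have eq: "s\<^sup>2 * (l / real T) * exp (s * (l / real T)) = (s\<^sup>2 * l / real T) * exp (s * l / real T)" by simp
    show ?thesis unfolding eq power_mult_distrib[symmetric] using l s by (intro ennreal_power) simp
  qed
  also have "\<dots> = ennreal ((s\<^sup>2 * l / real T) ^ T * exp (s * l))"
    using T by (simp flip: exp_of_nat_mult)
  also have "\<dots> \<le> ennreal (exp (s\<^sup>2 * l) * exp (s * l))"
    using l s T by (intro ennreal_leI mult_right_mono power_div_le_exp) auto
  finally have "ennreal (s ^ k * measure ?M ?A) \<le> ennreal (exp (s\<^sup>2 * l) * exp (s * l))"
    using s by (simp add: measure_pmf.emeasure_eq_measure ennreal_mult)
  then have "s ^ k * measure ?M ?A \<le> exp (s\<^sup>2 * l) * exp (s * l)" by (simp add: ennreal_le_iff)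
  then show ?thesis using s by (simp add: exp_add field_simps)
qed

text \<open>The weights of the sparsity prior form a geometric sequence truncated at p; this is its
  ratio.\<close>

definition sparsity_ratio :: "nat \<Rightarrow> real \<Rightarrow> real \<Rightarrow> real" where
  "sparsity_ratio p a c = real p powr - a / c"

lemma pmf_sparsity_prior_ratio:
  assumes "c > 0" "p \<ge> 1"
  shows "pmf (sparsity_prior p a c) q =
    (if q \<le> p then sparsity_ratio p a c ^ q else 0) / (\<Sum>r\<le>p. sparsity_ratio p a c ^ r)"
proof -
  have "c powr - real r * real p powr - (a * real r) = sparsity_ratio p a c ^ r" for r
  proof -
    have "real p powr - (a * real r) = (real p powr - a) ^ r"
      using assms by (simp add: powr_powr flip: powr_realpow)
    moreover have "c powr - real r = (1 / c) ^ r"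
      using assms by (simp add: powr_minus powr_realpow divide_inverse power_inverse)
    ultimately show ?thesis by (simp add: sparsity_ratio_def power_divide)
  qed
  then show ?thesis unfolding pmf_sparsity_prior[OF assms] by simp
qed

context
  fixes p :: nat and a c :: real
  assumes c: "c > 0" and p: "p \<ge> 1" and half: "sparsity_ratio p a c \<le> 1 / 2"
begin

lemma sparsity_ratio_pos: "sparsity_ratio p a c > 0"
  using c p by (simp add: sparsity_ratio_def)

lemma sparsity_norm: "1 \<le> (\<Sum>r\<le>p. sparsity_ratio p a c ^ r)" "(\<Sum>r\<le>p. sparsity_ratio p a c ^ r) \<le> 2"
proof -
  let ?z = "sparsity_ratio p a c"
  have z: "0 < ?z" "?z < 1" using half sparsity_ratio_pos by auto
  have "(\<Sum>r\<in>{0}. ?z ^ r) \<le> (\<Sum>r\<le>p. ?z ^ r)" using z by (intro sum_mono2) auto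
  then show "1 \<le> (\<Sum>r\<le>p. ?z ^ r)" by simp
  have "(\<Sum>r\<le>p. ?z ^ r) \<le> (\<Sum>r. ?z ^ r)" using z by (intro sum_le_suminf) auto
  also have "\<dots> = 1 / (1 - ?z)" using z by (intro suminf_geometric) auto
  also have "\<dots> \<le> 2" using half z by (simp add: field_simps)
  finally show "(\<Sum>r\<le>p. ?z ^ r) \<le> 2" .
qed

lemma pmf_sparsity_prior_ge:
  assumes "q \<le> p"
  shows "sparsity_ratio p a c ^ q / 2 \<le> pmf (sparsity_prior p a c) q"
proof -
  have "sparsity_ratio p a c ^ q / 2 \<le> sparsity_ratio p a c ^ q / (\<Sum>r\<le>p. sparsity_ratio p a c ^ r)"
    using sparsity_norm sparsity_ratio_pos by (intro divide_left_mono) auto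
  then show ?thesis unfolding pmf_sparsity_prior_ratio[OF c p] using assms by simp
qed

lemma set_pmf_sparsity_prior: "q \<in> set_pmf (sparsity_prior p a c) \<Longrightarrow> q \<le> p"
  unfolding set_pmf_iff pmf_sparsity_prior_ratio[OF c p] by (auto split: if_splits)

lemma sparsity_prior_tail:
  "measure (measure_pmf (sparsity_prior p a c)) {r. q < r} \<le> 2 * sparsity_ratio p a c ^ (q + 1)"
proof -
  let ?z = "sparsity_ratio p a c"
  have z: "0 < ?z" "?z < 1" using half sparsity_ratio_pos by auto
  have "measure (measure_pmf (sparsity_prior p a c)) {r. q < r} = measure (measure_pmf (sparsity_prior p a c)) {q + 1..p}"
    using set_pmf_sparsity_prior by (intro measure_pmf.finite_measure_eq_AE AE_pmfI) auto
  also have "\<dots> = (\<Sum>r=q+1..p. pmf (sparsity_prior p a c) r)"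
    by (rule measure_measure_pmf_finite) simp
  also have "\<dots> \<le> (\<Sum>r=q+1..p. ?z ^ r)"
  proof (intro sum_mono)
    fix r assume r: "r \<in> {q+1..p}"
    have "?z ^ r / (\<Sum>r\<le>p. ?z ^ r) \<le> ?z ^ r / 1"
      using sparsity_norm z by (intro divide_left_mono) auto
    then show "pmf (sparsity_prior p a c) r \<le> ?z ^ r"
      unfolding pmf_sparsity_prior_ratio[OF c p] using r by simp
  qed
  also have "\<dots> \<le> (\<Sum>r\<in>(\<lambda>r. r + (q + 1)) ` {..p}. ?z ^ r)"
  proof (intro sum_mono2)
    show "{q+1..p} \<subseteq> (\<lambda>r. r + (q + 1)) ` {..p}"
    proof
      fix r assume "r \<in> {q+1..p}"
      then show "r \<in> (\<lambda>r. r + (q + 1)) ` {..p}" by (intro image_eqI[of _ _ "r - (q + 1)"]) auto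
    qed
  qed (use z in auto)
  also have "\<dots> = (\<Sum>r\<le>p. ?z ^ (r + (q + 1)))" by (subst sum.reindex) (auto simp: inj_on_def)
  also have "\<dots> = ?z ^ (q + 1) * (\<Sum>r\<le>p. ?z ^ r)" 
    unfolding power_add[of _ _ "q + 1"] sum_distrib_right[symmetric] by (rule mult.commute)
  also have "\<dots> \<le> ?z ^ (q + 1) * 2" using sparsity_norm z by (intro mult_left_mono) auto
  finally show ?thesis by simp
qed

lemma finite_subsets_of_size: "finite {S. S \<subseteq> {1..p} \<and> card S = q}"
  by (rule finite_subset[of _ "Pow {1..p}"]) auto

text \<open>One path through the draws: the size of \<open>S\<close>, the set \<open>S\<close>, a
  single tree, its size. With T = 1 the Poisson parameter is \<open>l\<close> itself, and the
  uniform choice of \<open>S\<close> costs at most p^|S|.\<close>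

lemma structure_prior_ge:
  assumes S: "S \<subseteq> {1..p}" and l: "l > 0"
  shows "sparsity_ratio p a c ^ card S / 2 * (1 / real p ^ card S) * pmf (num_trees_prior C\<^sub>T) 1 *
    pmf (tree_size_prior l) K \<le> pmf (structure_prior p a c C\<^sub>T l) (S, [K])"
proof -
  let ?q = "card S"
  let ?X = "{S. S \<subseteq> {1..p} \<and> card S = ?q}"
  have q: "?q \<le> p" using S card_mono[of "{1..p}" S] by simp
  have X: "?X \<noteq> {}" "finite ?X" using S finite_subsets_of_size by auto
  have "card ?X = p choose ?q" using n_subsets[of "{1..p}" ?q] by simp
  then have cX: "real (card ?X) \<le> real p ^ ?q"
    using binomial_le_pow[OF q] by (metis of_nat_le_iff of_nat_power)
  have cX0: "card ?X > 0" using X by (simp add: card_gt_0_iff)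
  have "1 / real p ^ ?q \<le> 1 / real (card ?X)" using cX cX0 p by (intro divide_left_mono) auto
  then have u: "1 / real p ^ ?q \<le> pmf (pmf_of_set ?X) S" using X S by simp
  have r: "pmf (tree_size_prior l) K \<le> pmf (replicate_pmf 1 (tree_size_prior (l / real 1)) \<bind> (\<lambda>Ks. return_pmf (S, Ks))) (S, [K])"
  proof -
    have "pmf (replicate_pmf 1 (tree_size_prior l)) [K] = pmf (tree_size_prior l) K"
      unfolding replicate_pmf_1 using pmf_map_inj'[of "\<lambda>x. [x]" "tree_size_prior l" K] by (simp add: inj_on_def)
    then show ?thesis
      using pmf_bind_ge[of "replicate_pmf 1 (tree_size_prior (l / real 1))" "[K]" "\<lambda>Ks. return_pmf (S, Ks)" "(S, [K])"]
      by (simp del: replicate_pmf.simps)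
  qed
  have nn: "0 \<le> pmf M y" for M :: "'z pmf" and y by (rule pmf_nonneg)
  let ?f3 = "\<lambda>S T. replicate_pmf T (tree_size_prior (l / real T)) \<bind> (\<lambda>Ks. return_pmf (S, Ks))"
  let ?f2 = "\<lambda>S. num_trees_prior C\<^sub>T \<bind> ?f3 S"
  let ?f1 = "\<lambda>q. pmf_of_set {S. S \<subseteq> {1..p} \<and> card S = q} \<bind> ?f2"
  have "pmf (num_trees_prior C\<^sub>T) 1 * pmf (tree_size_prior l) K \<le> pmf (num_trees_prior C\<^sub>T) 1 * pmf (?f3 S 1) (S, [K])"
    by (intro mult_left_mono r pmf_nonneg)
  also have "\<dots> \<le> pmf (?f2 S) (S, [K])" by (rule pmf_bind_ge)
  finally have 2: "pmf (num_trees_prior C\<^sub>T) 1 * pmf (tree_size_prior l) K \<le> pmf (?f2 S) (S, [K])" .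
  have "1 / real p ^ ?q * (pmf (num_trees_prior C\<^sub>T) 1 * pmf (tree_size_prior l) K) \<le> pmf (pmf_of_set ?X) S * pmf (?f2 S) (S, [K])"
    by (intro mult_mono u 2) (auto intro: mult_nonneg_nonneg pmf_nonneg)
  also have "\<dots> \<le> pmf (?f1 ?q) (S, [K])" by (rule pmf_bind_ge)
  finally have 3: "1 / real p ^ ?q * (pmf (num_trees_prior C\<^sub>T) 1 * pmf (tree_size_prior l) K) \<le> pmf (?f1 ?q) (S, [K])" .
  have "sparsity_ratio p a c ^ ?q / 2 * (1 / real p ^ ?q * (pmf (num_trees_prior C\<^sub>T) 1 * pmf (tree_size_prior l) K))
    \<le> pmf (sparsity_prior p a c) ?q * pmf (?f1 ?q) (S, [K])"
    using sparsity_ratio_pos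
    by (intro mult_mono 3 pmf_sparsity_prior_ge q mult_nonneg_nonneg pmf_nonneg) auto
  also have "\<dots> \<le> pmf (sparsity_prior p a c \<bind> ?f1) (S, [K])" by (rule pmf_bind_ge)
  also have "sparsity_prior p a c \<bind> ?f1 = structure_prior p a c C\<^sub>T l" by (simp add: structure_prior_def)
  finally show ?thesis by (simp add: mult.assoc)
qed

lemma structure_prior_sparsity_tail:
  "measure (measure_pmf (structure_prior p a c C\<^sub>T l)) {(S, Ks). q < card S} \<le> 2 * sparsity_ratio p a c ^ (q + 1)"
proof -
  have "measure (measure_pmf (structure_prior p a c C\<^sub>T l)) {(S, Ks). q < card S} \<le>
    measure (measure_pmf (sparsity_prior p a c)) {r. q < r}"
    unfolding structure_prior_def
  proof (rule measure_bind_pmf_le)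
    fix r assume r: "r \<in> set_pmf (sparsity_prior p a c)" "r \<notin> {r. q < r}"
    have "{S. S \<subseteq> {1..p} \<and> card S = r} \<noteq> {}"
      using set_pmf_sparsity_prior[OF r(1)] by (auto intro!: exI[of _ "{1..r}"])
    then show "set_pmf (pmf_of_set {S. S \<subseteq> {1..p} \<and> card S = r} \<bind>
        (\<lambda>S. num_trees_prior C\<^sub>T \<bind> (\<lambda>T. replicate_pmf T (tree_size_prior (l / real T)) \<bind> (\<lambda>Ks. return_pmf (S, Ks)))))
      \<inter> {(S, Ks). q < card S} = {}"
      using finite_subsets_of_size r(2) by (auto simp: set_bind_pmf)
  qed
  also note sparsity_prior_tail
  finally show ?thesis .
qed

end

lemma set_pmf_num_trees_prior: "C\<^sub>T > 0 \<Longrightarrow> T \<in> set_pmf (num_trees_prior C\<^sub>T) \<Longrightarrow> T \<ge> 1"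
  by (rule ccontr) (auto simp: set_pmf_iff pmf_num_trees_prior)

lemma num_trees_prior_one_pos:
  assumes "C\<^sub>T > 0"
  shows "pmf (num_trees_prior C\<^sub>T) 1 > 0"
proof -
  have "(\<Sum>j. if j \<ge> 1 then exp (- (C\<^sub>T * real j)) else 0) > 0"
  proof (rule suminf_pos2)
    have "summable (\<lambda>k. exp (- C\<^sub>T) ^ k)" using assms by (intro summable_geometric) auto
    then show "summable (\<lambda>j::nat. if j \<ge> 1 then exp (- (C\<^sub>T * real j)) else 0)"
      by (rule summable_comparison_test'[where N = 0])
       (auto simp: exp_of_nat_mult[symmetric] mult.commute)
  qed (auto intro!: exI[of _ 1])
  then show ?thesis using assms by (simp add: pmf_num_trees_prior)
qed

lemma structure_prior_size_tail:
  assumes l: "l > 0" and s: "s \<ge> 1" and C: "C\<^sub>T > 0"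
  shows "measure (measure_pmf (structure_prior p a c C\<^sub>T l)) {(S, Ks). (\<forall>K\<in>set Ks. 2 \<le> K) \<and> k < sum_list Ks}
    \<le> exp (s\<^sup>2 * l + s * l) / s ^ k"
proof -
  let ?A = "{(S :: nat set, Ks). (\<forall>K\<in>set Ks. 2 \<le> K) \<and> k < sum_list Ks}"
  let ?u = "exp (s\<^sup>2 * l + s * l) / s ^ k"
  have "emeasure (measure_pmf (structure_prior p a c C\<^sub>T l)) ?A \<le> ennreal ?u"
    unfolding structure_prior_def
  proof (rule emeasure_bind_pmf_le, rule emeasure_bind_pmf_le, rule emeasure_bind_pmf_le)
    fix q and S :: "nat set" and T assume "T \<in> set_pmf (num_trees_prior C\<^sub>T)"
    then have T: "T \<ge> 1" by (rule set_pmf_num_trees_prior[OF C])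
    let ?M = "replicate_pmf T (tree_size_prior (l / real T))"
    have "emeasure (measure_pmf (?M \<bind> (\<lambda>Ks. return_pmf (S, Ks)))) ?A =
      emeasure (measure_pmf ?M) {Ks. (\<forall>K\<in>set Ks. 2 \<le> K) \<and> k < sum_list Ks}"
      unfolding map_pmf_def[symmetric] by (simp add: vimage_def)
    also have "\<dots> \<le> ennreal ?u"
      unfolding measure_pmf.emeasure_eq_measure by (intro ennreal_leI tree_sizes_tail l s T)
    finally show "emeasure (measure_pmf (?M \<bind> (\<lambda>Ks. return_pmf (S, Ks)))) ?A \<le> ennreal ?u" .
  qed
  then show ?thesis using s by (simp add: measure_pmf.emeasure_eq_measure ennreal_le_iff)
qed

section \<open>Prior mass of step heights near a target\<close>

lemma normal_interval_ge:
  assumes b: "\<bar>b\<bar> \<le> F" and r: "0 \<le> r" "r \<le> 1"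
  shows "2 * r * normal_density 0 1 (F + 1) \<le>
    measure (density lborel (\<lambda>u. ennreal (normal_density 0 1 u))) {b - r..b + r}"
proof -
  let ?N = "density lborel (\<lambda>u. ennreal (normal_density 0 1 u))"
  interpret N: prob_space ?N by (rule prob_space_normal_density) simp
  have le: "normal_density 0 1 (F + 1) \<le> normal_density 0 1 u" if "u \<in> {b - r..b + r}" for u
  proof -
    have "\<bar>u\<bar> \<le> F + 1" using that b r by auto
    then have "u\<^sup>2 \<le> (F + 1)\<^sup>2" using abs_le_square_iff[of u "F + 1"] b by auto
    then show ?thesis by (simp add: normal_density_def divide_right_mono)
  qed
  have "ennreal (2 * r * normal_density 0 1 (F + 1)) =
      (\<integral>\<^sup>+u. ennreal (normal_density 0 1 (F + 1)) * indicator {b - r..b + r} u \<partial>lborel)"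
    using r by (simp add: nn_integral_cmult_indicator ennreal_mult[symmetric] mult_ac)
  also have "\<dots> \<le> (\<integral>\<^sup>+u. ennreal (normal_density 0 1 u) * indicator {b - r..b + r} u \<partial>lborel)"
    using le by (intro nn_integral_mono) (auto simp: indicator_def intro!: ennreal_leI)
  also have "\<dots> = emeasure ?N {b - r..b + r}" by (subst emeasure_density) auto
  finally show ?thesis by (simp add: N.emeasure_eq_measure ennreal_le_iff)
qed

text \<open>The index set repeats that of \<open>step_height_prior\<close> for a one-tree ensemble,
  where the variance 1/T is 1 and only t = 0 occurs.\<close>

definition height_box :: "cell set \<Rightarrow> (cell \<Rightarrow> real) \<Rightarrow> real \<Rightarrow> (nat \<times> cell \<Rightarrow> real) set" where
  "height_box Q b r = (\<Pi>\<^sub>E (t, \<Omega>)\<in>(SIGMA t:{..<length [Q]}. [Q] ! t). {b \<Omega> - r..b \<Omega> + r})"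

lemma height_box_prob:
  assumes Q: "finite Q" "card Q \<le> K" and b: "\<forall>\<Omega>\<in>Q. \<bar>b \<Omega>\<bar> \<le> F" and r: "0 \<le> r" "r \<le> 1"
    and w: "0 \<le> w" "w \<le> 1" "w \<le> 2 * r * normal_density 0 1 (F + 1)"
  shows "height_box Q b r \<in> sets (step_height_prior [Q])"
    and "w ^ K \<le> measure (step_height_prior [Q]) (height_box Q b r)"
    and "\<And>B \<Omega>. B \<in> height_box Q b r \<Longrightarrow> \<Omega> \<in> Q \<Longrightarrow> \<bar>B (0, \<Omega>) - b \<Omega>\<bar> \<le> r"
proof -
  let ?I = "SIGMA t:{..<length [Q]}. [Q] ! t"
  let ?N = "density lborel (\<lambda>u. ennreal (normal_density 0 1 u))"
  have I: "?I = {0} \<times> Q" by auto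
  have pN: "prob_space ?N" by (rule prob_space_normal_density) simp
  interpret product_prob_space "\<lambda>_. ?N" ?I by (intro product_prob_spaceI pN)
  interpret finite_product_prob_space "\<lambda>_. ?N" ?I
    by unfold_locales (use Q in auto)
  have eq: "step_height_prior [Q] = PiM ?I (\<lambda>_. ?N)" unfolding step_height_prior_def by simp
  show "height_box Q b r \<in> sets (step_height_prior [Q])"
    unfolding eq height_box_def by (intro sets_PiM_I_finite) (use Q in auto)
  have "measure (step_height_prior [Q]) (height_box Q b r) = (\<Prod>z\<in>?I. measure ?N (case z of (t, \<Omega>) \<Rightarrow> {b \<Omega> - r..b \<Omega> + r}))"
    unfolding eq height_box_def by (intro finite_measure_PiM_emb) auto
  also have "\<dots> = (\<Prod>\<Omega>\<in>Q. measure ?N {b \<Omega> - r..b \<Omega> + r})"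
    unfolding I by (subst prod.cartesian_product') simp
  also have "\<dots> \<ge> (\<Prod>\<Omega>\<in>Q. w)"
    using w order_trans[OF w(3) normal_interval_ge[OF _ r]] b by (intro prod_mono) auto
  finally have "w ^ card Q \<le> measure (step_height_prior [Q]) (height_box Q b r)" by simp
  moreover have "w ^ K \<le> w ^ card Q" using w Q by (intro power_decreasing) auto
  ultimately show "w ^ K \<le> measure (step_height_prior [Q]) (height_box Q b r)" by linarith
  fix B \<Omega> assume "B \<in> height_box Q b r" "\<Omega> \<in> Q"
  then have "B (0, \<Omega>) \<in> {b \<Omega> - r..b \<Omega> + r}" unfolding height_box_def I by (force simp: PiE_iff)
  then show "\<bar>B (0, \<Omega>) - b \<Omega>\<bar> \<le> r" by (auto simp: abs_le_iff)
qed

section \<open>Classes of trees and the sieve of cell sets\<close>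

definition tree_class :: "nat \<Rightarrow> nat \<Rightarrow> (nat \<Rightarrow> point) \<Rightarrow> real \<Rightarrow> nat \<Rightarrow> nat set \<Rightarrow> cell set \<Rightarrow> cell set set" where
  "tree_class p n x Cbar K S P = {Q \<in> valid_trees p n x Cbar K S. data_trace n x P = data_trace n x Q}"

lemma tree_classes_image:
  "tree_classes p n x Cbar K S = tree_class p n x Cbar K S ` valid_trees p n x Cbar K S"
  unfolding tree_classes_def quotient_def tree_class_def by auto

lemma tree_rep_class:
  assumes "P \<in> valid_trees p n x Cbar K S"
  shows "tree_rep (tree_class p n x Cbar K S P) \<in> valid_trees p n x Cbar K S"
    and "data_trace n x (tree_rep (tree_class p n x Cbar K S P)) = data_trace n x P"
proof -
  have "P \<in> tree_class p n x Cbar K S P" using assms by (simp add: tree_class_def)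
  then have "tree_rep (tree_class p n x Cbar K S P) \<in> tree_class p n x Cbar K S P"
    unfolding tree_rep_def by (rule someI)
  then show "tree_rep (tree_class p n x Cbar K S P) \<in> valid_trees p n x Cbar K S"
    "data_trace n x (tree_rep (tree_class p n x Cbar K S P)) = data_trace n x P"
    by (auto simp: tree_class_def)
qed

lemma tree_rep_valid: "e \<in> tree_classes p n x Cbar K S \<Longrightarrow> tree_rep e \<in> valid_trees p n x Cbar K S"
  unfolding tree_classes_image using tree_rep_class by blast

lemma card_tree_classes:
  "finite (tree_classes p n x Cbar K S) \<and> card (tree_classes p n x Cbar K S) \<le> (K * card S * n) ^ (K - 1)"
  unfolding tree_classes_image
  using card_valid_trees[of p n x Cbar K S] card_image_le order_trans by blast

lemma finite_valid_ensembles: "finite (valid_ensembles p n x Cbar Ks S)"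
proof (rule finite_subset)
  show "valid_ensembles p n x Cbar Ks S \<subseteq>
    {E. set E \<subseteq> (\<Union>K\<in>set Ks. tree_classes p n x Cbar K S) \<and> length E = length Ks}"
    unfolding valid_ensembles_def by (fastforce simp: set_conv_nth)
  show "finite {E. set E \<subseteq> (\<Union>K\<in>set Ks. tree_classes p n x Cbar K S) \<and> length E = length Ks}"
    using card_tree_classes by (intro finite_lists_length_eq) blast
qed

lemma valid_ensembles_single:
  "valid_ensembles p n x Cbar [K] S = (\<lambda>e. [e]) ` tree_classes p n x Cbar K S"
  unfolding valid_ensembles_def by (auto simp: length_Suc_conv)

lemma card_valid_ensembles_single:
  "card (valid_ensembles p n x Cbar [K] S) \<le> (K * card S * n) ^ (K - 1)"
  unfolding valid_ensembles_single
  using card_tree_classes[of p n x Cbar K S] card_image_le order_trans by blast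

definition nontrivial_forests :: "nat \<Rightarrow> nat \<Rightarrow> (nat \<Rightarrow> point) \<Rightarrow> real \<Rightarrow> nat \<Rightarrow> nat set \<Rightarrow> cell set list set" where
  "nontrivial_forests p n x Cbar k S =
     {Ps. \<exists>Ks. list_all2 (\<lambda>P K. P \<in> valid_trees p n x Cbar K S \<and> 2 \<le> K) Ps Ks \<and> sum_list Ks \<le> k}"

text \<open>The index set of the union bound consists of cell sets instead of ensembles. Arbitrarily
  many one-cell trees share the single member \<open>{cube p}\<close>, so no bound on the number of
  trees is imposed.\<close>

definition forest_cells :: "nat \<Rightarrow> nat \<Rightarrow> (nat \<Rightarrow> point) \<Rightarrow> real \<Rightarrow> nat \<Rightarrow> nat \<Rightarrow> cell set set" where
  "forest_cells p n x Cbar q k = insert {cube p}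
     (\<Union>S\<in>{S. S \<subseteq> {1..p} \<and> card S \<le> q}. (\<lambda>Ps. \<Union>(set Ps)) ` nontrivial_forests p n x Cbar k S)"

text \<open>A tree of size K \<le> k uses fewer than K coordinates, so K |S| n \<le> k k n; one base
  then serves for every subset and every size.\<close>

lemma card_nontrivial_forests:
  assumes "k \<ge> 1" "n \<ge> 1"
  shows "finite (nontrivial_forests p n x Cbar k S) \<and> card (nontrivial_forests p n x Cbar k S) \<le> (k * k * n) ^ k"
  unfolding nontrivial_forests_def
proof (rule card_weighted_lists[where k = k])
  fix K assume K: "2 \<le> K" "K \<le> k"
  have "card (valid_trees p n x Cbar K S) \<le> (k * k * n) ^ (K - 1)"
  proof (cases "valid_trees p n x Cbar K S = {}")
    case False
    then obtain P where "tree_partition p n x K S P" by (auto simp: valid_trees_def)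
    then have "card S < K" using tree_partition_coords by blast
    then have "K * card S * n \<le> k * k * n" using K by (intro mult_le_mono) auto
    then have "(K * card S * n) ^ (K - 1) \<le> (k * k * n) ^ (K - 1)" by (intro power_mono) auto
    then show ?thesis using card_valid_trees order_trans by blast
  qed simp
  then show "finite (valid_trees p n x Cbar K S) \<and> card (valid_trees p n x Cbar K S) \<le> (k * k * n) ^ (K - 1)"
    using card_valid_trees by blast
qed (use assms in auto)

lemma card_Union_forest:
  "list_all2 (\<lambda>P K. P \<in> valid_trees p n x Cbar K S \<and> 2 \<le> K) Ps Ks \<Longrightarrow>
     finite (\<Union>(set Ps)) \<and> card (\<Union>(set Ps)) \<le> sum_list Ks"
proof (induction Ps Ks rule: list_all2_induct)
  case (Cons P Ps K Ks)
  have P: "finite P" "card P \<le> K" using Cons tree_partition_finite by (auto simp: valid_trees_def)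
  have "card (P \<union> \<Union>(set Ps)) \<le> card P + card (\<Union>(set Ps))" by (rule card_Un_le)
  then show ?case using P Cons by auto
qed simp

lemma forest_cells_bounds:
  assumes k: "k \<ge> 1" and n: "n \<ge> 1"
  shows "finite (forest_cells p n x Cbar q k)"
    and "card (forest_cells p n x Cbar q k) \<le> 1 + (p + 1) ^ q * (k * k * n) ^ k"
    and "\<And>\<C>. \<C> \<in> forest_cells p n x Cbar q k \<Longrightarrow> finite \<C> \<and> card \<C> \<le> k"
proof -
  let ?A = "{S. S \<subseteq> {1..p} \<and> card S \<le> q}"
  let ?N = "nontrivial_forests p n x Cbar k"
  let ?U = "\<Union>S\<in>?A. (\<lambda>Ps. \<Union>(set Ps)) ` ?N S"
  have fin: "finite ?U" using card_small_subsets card_nontrivial_forests[OF k n] by blast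
  then show "finite (forest_cells p n x Cbar q k)" by (simp add: forest_cells_def)
  have "card ?U \<le> (\<Sum>S\<in>?A. card ((\<lambda>Ps. \<Union>(set Ps)) ` ?N S))"
    using card_small_subsets by (intro card_UN_le) blast
  also have "\<dots> \<le> (\<Sum>S\<in>?A. (k * k * n) ^ k)"
    using card_nontrivial_forests[OF k n] card_image_le order_trans by (intro sum_mono) blast
  also have "\<dots> = card ?A * (k * k * n) ^ k" by simp
  also have "\<dots> \<le> (p + 1) ^ q * (k * k * n) ^ k"
    using card_small_subsets by (intro mult_right_mono) auto
  finally show "card (forest_cells p n x Cbar q k) \<le> 1 + (p + 1) ^ q * (k * k * n) ^ k"
    unfolding forest_cells_def using fin card_insert_if[of ?U "{cube p}"] by (auto split: if_splits)
  fix \<C> assume "\<C> \<in> forest_cells p n x Cbar q k"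
  then consider "\<C> = {cube p}" | S Ps where "Ps \<in> ?N S" "\<C> = \<Union>(set Ps)" by (auto simp: forest_cells_def)
  then show "finite \<C> \<and> card \<C> \<le> k"
  proof cases
    case 1 then show ?thesis using k by simp
  next
    case 2
    then show ?thesis using card_Union_forest order_trans unfolding nontrivial_forests_def by blast
  qed
qed

lemma valid_forest_of_ensemble:
  assumes "E \<in> valid_ensembles p n x Cbar Ks S" "length Ks \<ge> 1"
  shows "valid_forest p n x Cbar (map tree_rep E)"
proof -
  have len: "length E = length Ks" and cl: "\<And>t. t < length Ks \<Longrightarrow> E ! t \<in> tree_classes p n x Cbar (Ks ! t) S"
    using assms(1) by (auto simp: valid_ensembles_def)
  have "map tree_rep E ! t \<in> valid_trees p n x Cbar (Ks ! t) S" if "t < length Ks" for t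
    using tree_rep_valid[OF cl[OF that]] that len by simp
  then show ?thesis unfolding valid_forest_def using len assms(2) by auto
qed

text \<open>The total size has to be controlled only if all sizes are at least 2, which is the event
  covered by the tail bound; for empty \<open>S\<close> the cell set is \<open>{cube p}\<close>
  whatever the number of trees.\<close>

lemma forest_cells_of_ensemble:
  assumes E: "E \<in> valid_ensembles p n x Cbar Ks S" and len: "length Ks \<ge> 1"
    and q: "card S \<le> q" and k: "(\<forall>K\<in>set Ks. 2 \<le> K) \<Longrightarrow> sum_list Ks \<le> k"
  shows "\<Union>(set (map tree_rep E)) \<in> forest_cells p n x Cbar q k"
proof -
  have lE: "length E = length Ks" and cl: "\<And>t. t < length Ks \<Longrightarrow> E ! t \<in> tree_classes p n x Cbar (Ks ! t) S"
    using E by (auto simp: valid_ensembles_def)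
  have val: "tree_rep (E ! t) \<in> valid_trees p n x Cbar (Ks ! t) S" if "t < length Ks" for t
    by (rule tree_rep_valid[OF cl[OF that]])
  have tp: "tree_partition p n x (Ks ! t) S (tree_rep (E ! t))" if "t < length Ks" for t
    using val[OF that] by (simp add: valid_trees_def)
  show ?thesis
  proof (cases "S = {}")
    case True
    have "tree_rep e = {cube p}" if "e \<in> set E" for e
    proof -
      from that lE obtain t where "t < length Ks" "e = E ! t" by (auto simp: in_set_conv_nth)
      then show ?thesis using tree_partition_coords[OF tp] True by blast
    qed
    then have "set (map tree_rep E) = {{cube p}}" using len lE by (cases E) auto
    then show ?thesis by (simp add: forest_cells_def)
  next
    case False
    have K2: "2 \<le> Ks ! t" if "t < length Ks" for t
    proof -
      have "finite S" "card S < Ks ! t" using tree_partition_coords[OF tp[OF that]] by auto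
      then show ?thesis using False card_gt_0_iff[of S] by linarith
    qed
    then have "\<forall>K\<in>set Ks. 2 \<le> K" by (auto simp: in_set_conv_nth)
    then have "sum_list Ks \<le> k" by (rule k)
    moreover have "list_all2 (\<lambda>P K. P \<in> valid_trees p n x Cbar K S \<and> 2 \<le> K) (map tree_rep E) Ks"
      using val K2 lE by (auto simp: list_all2_conv_all_nth)
    ultimately have "map tree_rep E \<in> nontrivial_forests p n x Cbar k S" unfolding nontrivial_forests_def by blast
    moreover have "S \<subseteq> {1..p}"
    proof -
      have "0 < length Ks" using len by linarith
      then show ?thesis using tree_partition_coords[OF tp] by blast
    qed
    ultimately show ?thesis using q unfolding forest_cells_def by blast
  qed
qed

lemma trivial_tree_valid:
  assumes "\<And>i. i \<in> {1..n} \<Longrightarrow> x i \<in> cube p" "Cbar\<^sup>2 \<le> real n" "n \<ge> 1"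
  shows "{cube p} \<in> valid_trees p n x Cbar 1 {}"
proof -
  have "{i \<in> {1..n}. x i \<in> cube p} = {1..n}" using assms(1) by auto
  then have "cell_mass n x (cube p) = 1" using assms(3) by (simp add: cell_mass_def num_points_def)
  then show ?thesis using assms(2,3) by (auto simp: valid_trees_def intro: tree_partition.root[simplified])
qed

section \<open>The renormalized prior on ensembles\<close>

context
  fixes p n :: nat and x :: "nat \<Rightarrow> point" and Cbar a c C\<^sub>T l :: real
  assumes c: "c > 0" and p: "p \<ge> 1" and half: "sparsity_ratio p a c \<le> 1 / 2"
    and C: "C\<^sub>T > 0" and l: "l > 0" and n: "n \<ge> 1" and m: "Cbar\<^sup>2 \<le> real n"
    and design: "\<And>i. i \<in> {1..n} \<Longrightarrow> x i \<in> cube p"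
begin

definition valid_structures :: "(nat set \<times> nat list) set" where
  "valid_structures = {(S, Ks). valid_ensembles p n x Cbar Ks S \<noteq> {}}"

lemma trivial_structure: "({}, [1]) \<in> valid_structures"
proof -
  have "{cube p} \<in> valid_trees p n x Cbar 1 {}" by (rule trivial_tree_valid[OF design m n])
  then show ?thesis unfolding valid_structures_def by (auto simp: valid_ensembles_single tree_classes_image)
qed

text \<open>The configuration of one one-cell tree is always valid, and its mass is bounded below by
  a constant free of n and p, since the empty subset has prior probability at least 1/2.
  Conditioning on validity therefore inflates probabilities by a bounded factor only.\<close>

lemma valid_structures_prob:
  "pmf (num_trees_prior C\<^sub>T) 1 * pmf (tree_size_prior l) 1 / 2 \<le> measure (measure_pmf (structure_prior p a c C\<^sub>T l)) valid_structures"
proof -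
  have "pmf (num_trees_prior C\<^sub>T) 1 * pmf (tree_size_prior l) 1 / 2 \<le> pmf (structure_prior p a c C\<^sub>T l) ({}, [1])"
    using structure_prior_ge[OF c p half, of "{}" l C\<^sub>T 1] l by simp
  also have "\<dots> = measure (measure_pmf (structure_prior p a c C\<^sub>T l)) {({}, [1])}" by (simp add: pmf.rep_eq)
  also have "\<dots> \<le> measure (measure_pmf (structure_prior p a c C\<^sub>T l)) valid_structures"
    using trivial_structure by (intro measure_pmf.finite_measure_mono) auto
  finally show ?thesis .
qed

lemma trivial_structure_prob_pos: "pmf (num_trees_prior C\<^sub>T) 1 * pmf (tree_size_prior l) 1 / 2 > 0"
proof -
  have "pmf (tree_size_prior l) 1 > 0" using l by (simp add: pmf_tree_size_prior)
  moreover have "pmf (num_trees_prior C\<^sub>T) 1 > 0" by (rule num_trees_prior_one_pos[OF C])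
  ultimately show ?thesis by simp
qed

lemma structure_support_valid: "set_pmf (structure_prior p a c C\<^sub>T l) \<inter> valid_structures \<noteq> {}"
proof -
  have "measure (measure_pmf (structure_prior p a c C\<^sub>T l)) valid_structures > 0"
    using valid_structures_prob trivial_structure_prob_pos by linarith
  then show ?thesis using measure_pmf_zero_iff[of "structure_prior p a c C\<^sub>T l" valid_structures] by auto
qed

lemma ensemble_prior_eq:
  "ensemble_prior p n x Cbar a c C\<^sub>T l =
     cond_pmf (structure_prior p a c C\<^sub>T l) valid_structures \<bind> (\<lambda>(S, Ks). pmf_of_set (valid_ensembles p n x Cbar Ks S))"
  unfolding ensemble_prior_def valid_structures_def ..

lemma structure_support_length:
  "(S, Ks) \<in> set_pmf (structure_prior p a c C\<^sub>T l) \<Longrightarrow> length Ks \<ge> 1"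
  unfolding structure_prior_def
  using set_pmf_num_trees_prior[OF C] by (auto simp: set_bind_pmf set_replicate_pmf)

lemma ensemble_prior_support:
  assumes "E \<in> set_pmf (ensemble_prior p n x Cbar a c C\<^sub>T l)"
  shows "valid_forest p n x Cbar (map tree_rep E)"
proof -
  obtain S Ks where "(S, Ks) \<in> set_pmf (structure_prior p a c C\<^sub>T l)" "(S, Ks) \<in> valid_structures"
    "E \<in> set_pmf (pmf_of_set (valid_ensembles p n x Cbar Ks S))"
    using assms structure_support_valid unfolding ensemble_prior_eq by (auto simp: set_bind_pmf)
  then have "length Ks \<ge> 1" "E \<in> valid_ensembles p n x Cbar Ks S"
    using structure_support_length finite_valid_ensembles by (auto simp: valid_structures_def)
  then show ?thesis by (intro valid_forest_of_ensemble)
qed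

lemma forest_functions_nonempty: "forest_functions p n x Cbar \<noteq> {}"
proof -
  obtain E where "E \<in> set_pmf (ensemble_prior p n x Cbar a c C\<^sub>T l)" using set_pmf_not_empty[of "ensemble_prior p n x Cbar a c C\<^sub>T l"] by blast
  then show ?thesis using ensemble_prior_support unfolding forest_functions_def valid_forest_def by blast
qed

text \<open>An ensemble can leave the sieve only through too many coordinates or through sizes all
  at least 2 with total above \<open>k\<close>; the denominator is the price of the
  conditioning.\<close>

lemma ensemble_prior_sieve:
  assumes s: "s \<ge> 1"
  shows "measure (measure_pmf (ensemble_prior p n x Cbar a c C\<^sub>T l))
      (- {E. \<Union>(set (map tree_rep E)) \<in> forest_cells p n x Cbar q k}) \<le>
    (2 * sparsity_ratio p a c ^ (q + 1) + exp (s\<^sup>2 * l + s * l) / s ^ k) /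
      (pmf (num_trees_prior C\<^sub>T) 1 * pmf (tree_size_prior l) 1 / 2)"
proof -
  let ?M = "structure_prior p a c C\<^sub>T l"
  let ?A = "- {E. \<Union>(set (map tree_rep E)) \<in> forest_cells p n x Cbar q k}"
  let ?B1 = "{(S :: nat set, Ks :: nat list). q < card S}"
  let ?B2 = "{(S :: nat set, Ks :: nat list). (\<forall>K\<in>set Ks. 2 \<le> K) \<and> k < sum_list Ks}"
  let ?\<nu> = "pmf (num_trees_prior C\<^sub>T) 1 * pmf (tree_size_prior l) 1 / 2"
  have "measure (measure_pmf (ensemble_prior p n x Cbar a c C\<^sub>T l)) ?A \<le>
    measure (measure_pmf (cond_pmf ?M valid_structures)) (?B1 \<union> ?B2)"
    unfolding ensemble_prior_eq
  proof (rule measure_bind_pmf_le)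
    fix y assume y: "y \<in> set_pmf (cond_pmf ?M valid_structures)" "y \<notin> ?B1 \<union> ?B2"
    obtain S Ks where yS: "y = (S, Ks)" by (cases y)
    have supp: "(S, Ks) \<in> set_pmf ?M" "(S, Ks) \<in> valid_structures"
      using y structure_support_valid yS by auto
    have len: "length Ks \<ge> 1" by (rule structure_support_length[OF supp(1)])
    have "\<Union>(set (map tree_rep E)) \<in> forest_cells p n x Cbar q k" if "E \<in> valid_ensembles p n x Cbar Ks S" for E
      using that len by (rule forest_cells_of_ensemble) (use y yS in auto)
    then show "set_pmf (case y of (S, Ks) \<Rightarrow> pmf_of_set (valid_ensembles p n x Cbar Ks S)) \<inter> ?A = {}"
      using supp(2) finite_valid_ensembles[of p n x Cbar Ks S] unfolding yS by (auto simp: valid_structures_def)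
  qed
  also have "\<dots> \<le> measure (measure_pmf ?M) ((?B1 \<union> ?B2) \<inter> valid_structures) / measure (measure_pmf ?M) valid_structures"
    by (rule measure_cond_pmf_le[OF structure_support_valid])
  also have "\<dots> \<le> measure (measure_pmf ?M) ((?B1 \<union> ?B2) \<inter> valid_structures) / ?\<nu>"
    using valid_structures_prob trivial_structure_prob_pos by (intro divide_left_mono) (auto intro!: mult_pos_pos)
  also have "\<dots> \<le> (measure (measure_pmf ?M) ?B1 + measure (measure_pmf ?M) ?B2) / ?\<nu>"
  proof (intro divide_right_mono)
    have "measure (measure_pmf ?M) ((?B1 \<union> ?B2) \<inter> valid_structures) \<le> measure (measure_pmf ?M) (?B1 \<union> ?B2)"
      by (intro measure_pmf.finite_measure_mono) auto
    also have "\<dots> \<le> measure (measure_pmf ?M) ?B1 + measure (measure_pmf ?M) ?B2"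
      by (intro measure_Un_le) auto
    finally show "measure (measure_pmf ?M) ((?B1 \<union> ?B2) \<inter> valid_structures) \<le> measure (measure_pmf ?M) ?B1 + measure (measure_pmf ?M) ?B2" .
  qed (use trivial_structure_prob_pos in auto)
  also have "\<dots> \<le> (2 * sparsity_ratio p a c ^ (q + 1) + exp (s\<^sup>2 * l + s * l) / s ^ k) / ?\<nu>"
    using trivial_structure_prob_pos
    by (intro divide_right_mono add_mono structure_prior_sparsity_tail[OF c p half] structure_prior_size_tail l s C) auto
  finally show ?thesis .
qed

text \<open>Conditioning can only increase the mass of a valid configuration, and the uniform choice
  among ensembles costs the number of one-tree ensembles, which the tree count bounds.\<close>

lemma ensemble_prior_ge:
  assumes P: "P \<in> valid_trees p n x Cbar K S"
  shows "[tree_class p n x Cbar K S P] \<in> set_pmf (ensemble_prior p n x Cbar a c C\<^sub>T l)" (is ?A)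
    and "sparsity_ratio p a c ^ card S / 2 * (1 / real p ^ card S) * pmf (num_trees_prior C\<^sub>T) 1 *
      pmf (tree_size_prior l) K / real ((K * card S * n) ^ (K - 1)) \<le>
      pmf (ensemble_prior p n x Cbar a c C\<^sub>T l) [tree_class p n x Cbar K S P]" (is "?B \<le> _")
proof -
  let ?M = "structure_prior p a c C\<^sub>T l"
  let ?E = "[tree_class p n x Cbar K S P]"
  let ?V = "valid_ensembles p n x Cbar [K] S"
  have tp: "tree_partition p n x K S P" using P by (simp add: valid_trees_def)
  have S: "S \<subseteq> {1..p}" "K \<ge> 1" using tree_partition_coords[OF tp] by auto
  have E: "?E \<in> ?V" using P by (simp add: valid_ensembles_single tree_classes_image)
  then have V: "(S, [K]) \<in> valid_structures" by (auto simp: valid_structures_def)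
  have mV: "measure (measure_pmf ?M) valid_structures > 0"
    using valid_structures_prob trivial_structure_prob_pos by linarith
  have "pmf ?M (S, [K]) / 1 \<le> pmf ?M (S, [K]) / measure (measure_pmf ?M) valid_structures"
    using mV by (intro divide_left_mono) auto
  then have 1: "pmf ?M (S, [K]) \<le> pmf (cond_pmf ?M valid_structures) (S, [K])"
    using V by (simp add: pmf_cond[OF structure_support_valid])
  have cV: "0 < card ?V" using E finite_valid_ensembles by (auto simp: card_gt_0_iff)
  have "1 / real ((K * card S * n) ^ (K - 1)) \<le> 1 / real (card ?V)"
  proof (rule frac_le)
    show "real (card ?V) \<le> real ((K * card S * n) ^ (K - 1))"
      using card_valid_ensembles_single[of p n x Cbar K S] by (rule of_nat_mono)
  qed (use cV in auto)
  also have "\<dots> = pmf (pmf_of_set ?V) ?E" using E finite_valid_ensembles cV by (subst pmf_of_set) auto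
  finally have 2: "1 / real ((K * card S * n) ^ (K - 1)) \<le> pmf (pmf_of_set ?V) ?E" .
  have "?B \<le> pmf ?M (S, [K]) / real ((K * card S * n) ^ (K - 1))"
    using structure_prior_ge[OF c p half S(1) l, of C\<^sub>T K] by (intro divide_right_mono) auto
  also have "\<dots> = pmf ?M (S, [K]) * (1 / real ((K * card S * n) ^ (K - 1)))" by simp
  also have "\<dots> \<le> pmf (cond_pmf ?M valid_structures) (S, [K]) * pmf (pmf_of_set ?V) ?E"
    by (intro mult_mono 1 2 pmf_nonneg) auto
  also have "\<dots> \<le> pmf (ensemble_prior p n x Cbar a c C\<^sub>T l) ?E"
    unfolding ensemble_prior_eq
    using pmf_bind_ge[of "cond_pmf ?M valid_structures" "(S, [K])" "\<lambda>(S, Ks). pmf_of_set (valid_ensembles p n x Cbar Ks S)" ?E]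
    by simp
  finally show "?B \<le> pmf (ensemble_prior p n x Cbar a c C\<^sub>T l) ?E" .
  \<comment> \<open>The denominator does not vanish, as it bounds the cardinality of a nonempty set
    of ensembles.\<close>
  moreover have "?B > 0"
  proof -
    have "card ?V \<le> (K * card S * n) ^ (K - 1)" by (rule card_valid_ensembles_single)
    then have "real ((K * card S * n) ^ (K - 1)) > 0" using cV by linarith
    moreover have "pmf (tree_size_prior l) K > 0" using l S by (simp add: pmf_tree_size_prior)
    moreover have "pmf (num_trees_prior C\<^sub>T) 1 > 0"
      using trivial_structure_prob_pos pmf_nonneg[of "num_trees_prior C\<^sub>T" 1] by (cases "pmf (num_trees_prior C\<^sub>T) 1 = 0") auto
    ultimately show ?thesis using sparsity_ratio_pos[OF c p half] p by simp
  qed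
  ultimately have "pmf (ensemble_prior p n x Cbar a c C\<^sub>T l) ?E > 0" by linarith
  then show ?A by (simp add: set_pmf_iff)
qed

end


section \<open>Rates\<close>

text \<open>The mass condition \<gamma> is asked for every admissible pair of K and J, because the
  approximating tree is known only to use some subset of \<open>S\<close> and at most N^|S| cells.
  Heights may deviate by 1/n. The functions are those of the representative \<open>Q\<close>, which
  shares only its trace on the design with the constructed tree.\<close>

lemma contraction_finite_sample:
  fixes f\<^sub>0 :: "point \<Rightarrow> real" and m N :: nat
  assumes c: "c > 0" and p: "p \<ge> 1" and half: "sparsity_ratio p a c \<le> 1 / 2"
    and C: "C\<^sub>T > 0" and l: "l > 0" and n: "n \<ge> 1" and m: "m \<ge> 1" "m \<le> n" and Cbar: "Cbar\<^sup>2 = real m"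
    and design: "\<And>i. i \<in> {1..n} \<Longrightarrow> x i \<in> cube p"
    and S: "S \<subseteq> {1..p}" "S \<noteq> {}" and N: "N \<ge> 1"
    and f: "f\<^sub>0 \<in> holder_class p \<alpha> \<inter> sparse_class p S" and \<alpha>: "0 < \<alpha>" "\<alpha> \<le> 1"
    and F: "\<And>z. z \<in> cube p \<Longrightarrow> \<bar>f\<^sub>0 z\<bar> \<le> F"
    and w: "0 \<le> w" "w \<le> 1" "w \<le> 2 * (1 / real n) * normal_density 0 1 (F + 1)"
    and \<rho>: "real (m * N ^ card S) * (1 / real n + 2 * F)\<^sup>2 +
          real n * (1 / real n + real (card S) * holder_norm p \<alpha> f\<^sub>0 * (1 / real N) powr \<alpha>)\<^sup>2 \<le> \<rho>"
    and \<gamma>: "\<And>K J. J \<subseteq> S \<Longrightarrow> card J < K \<Longrightarrow> (J = {} \<Longrightarrow> K = 1) \<Longrightarrow> K \<le> N ^ card S \<Longrightarrow>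
        exp (- \<gamma>) \<le> sparsity_ratio p a c ^ card J / 2 * (1 / real p ^ card J) * pmf (num_trees_prior C\<^sub>T) 1 *
           pmf (tree_size_prior l) K / real ((K * card J * n) ^ (K - 1)) * w ^ K"
    and k: "k \<ge> 1" and s: "s \<ge> 1" and R: "R \<ge> 0"
    and small: "(exp (G - real n * R\<^sup>2 / 4) + exp (- c1)) * exp (\<gamma> + \<rho> + t) \<le> \<delta>"
  shows "measure (data_law n x f\<^sub>0) {Y \<in> space (data_law n x f\<^sub>0).
      measure (posterior (forest_prior p n x Cbar a c C\<^sub>T l) n x Y)
        {f \<in> forest_functions p n x Cbar. emp_norm n x (\<lambda>z. f\<^sub>0 z - f z) > R} > \<delta>}
    \<le> real (1 + (p + 1) ^ q * (k * k * n) ^ k) * (sqrt 2 ^ (k + 1) * exp (- G / 4)) +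
      (2 * sparsity_ratio p a c ^ (q + 1) + exp (s\<^sup>2 * l + s * l) / s ^ k) /
        (pmf (num_trees_prior C\<^sub>T) 1 * pmf (tree_size_prior l) 1 / 2) * exp c1 + exp (- t)"
proof -
  have Cn: "Cbar\<^sup>2 \<le> real n" using Cbar m by simp
  have r: "0 \<le> 1 / real n" "1 / real n \<le> 1" using n by auto
  have data: "x ` {1..n} \<subseteq> cube p" using design by auto
  have F': "\<forall>z\<in>cube p. \<bar>f\<^sub>0 z\<bar> \<le> F" using F by blast
  from tree_approximation[OF n data S m Cbar N f \<alpha> F' r(1)]
  obtain K J P where P: "P \<in> valid_trees p n x Cbar K J" and J: "J \<subseteq> S" and K: "K \<le> N ^ card S"
    and appr: "\<forall>Q\<in>valid_trees p n x Cbar K J. data_trace n x Q = data_trace n x P \<longrightarrow>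
      (\<exists>b. (\<forall>\<Omega>\<in>Q. \<bar>b \<Omega>\<bar> \<le> F) \<and>
        (\<forall>\<beta>. (\<forall>\<Omega>\<in>Q. \<bar>\<beta> \<Omega> - b \<Omega>\<bar> \<le> 1 / real n) \<longrightarrow>
          (\<Sum>i=1..n. ((\<Sum>\<Omega>\<in>Q. \<beta> \<Omega> * indicator \<Omega> (x i)) - f\<^sub>0 (x i))\<^sup>2) \<le>
            real (m * N ^ card S) * (1 / real n + 2 * F)\<^sup>2 +
            real n * (1 / real n + real (card S) * holder_norm p \<alpha> f\<^sub>0 * (1 / real N) powr \<alpha>)\<^sup>2))"
    by blast
  define Q where "Q = tree_rep (tree_class p n x Cbar K J P)"
  have Q: "Q \<in> valid_trees p n x Cbar K J" "data_trace n x Q = data_trace n x P"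
    unfolding Q_def by (rule tree_rep_class[OF P])+
  have tQ: "tree_partition p n x K J Q" using Q by (simp add: valid_trees_def)
  have fQ: "finite Q" "card Q \<le> K" using tree_partition_finite[OF tQ] by auto
  have JK: "card J < K" "J = {} \<Longrightarrow> K = 1" using tree_partition_coords[OF tQ] by auto
  from bspec[OF appr Q(1), THEN mp, OF Q(2)] obtain b where
    bb: "(\<forall>\<Omega>\<in>Q. \<bar>b \<Omega>\<bar> \<le> F) \<and>
        (\<forall>\<beta>. (\<forall>\<Omega>\<in>Q. \<bar>\<beta> \<Omega> - b \<Omega>\<bar> \<le> 1 / real n) \<longrightarrow>
          (\<Sum>i=1..n. ((\<Sum>\<Omega>\<in>Q. \<beta> \<Omega> * indicator \<Omega> (x i)) - f\<^sub>0 (x i))\<^sup>2) \<le>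
            real (m * N ^ card S) * (1 / real n + 2 * F)\<^sup>2 +
            real n * (1 / real n + real (card S) * holder_norm p \<alpha> f\<^sub>0 * (1 / real N) powr \<alpha>)\<^sup>2)"
    by (rule exE)
  note b = conjunct1[OF bb]
  have near: "(\<Sum>i=1..n. ((\<Sum>\<Omega>\<in>Q. \<beta> \<Omega> * indicator \<Omega> (x i)) - f\<^sub>0 (x i))\<^sup>2) \<le> \<rho>"
    if "\<forall>\<Omega>\<in>Q. \<bar>\<beta> \<Omega> - b \<Omega>\<bar> \<le> 1 / real n" for \<beta>
    by (rule order_trans[OF mp[OF spec[OF conjunct2[OF bb]] that] \<rho>])
  let ?E = "[tree_class p n x Cbar K J P]"
  let ?X = "height_box Q b (1 / real n)"
  let ?ens = "ensemble_prior p n x Cbar a c C\<^sub>T l"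
  have map: "map tree_rep ?E = [Q]" by (simp add: Q_def)
  note box = height_box_prob[OF fQ b r w]
  note ctx = c p half C l n Cn design
  let ?I = "forest_cells p n x Cbar q k"
  let ?Sv = "{E. \<Union>(set (map tree_rep E)) \<in> ?I}"
  let ?\<eta> = "(2 * sparsity_ratio p a c ^ (q + 1) + exp (s\<^sup>2 * l + s * l) / s ^ k) /
        (pmf (num_trees_prior C\<^sub>T) 1 * pmf (tree_size_prior l) 1 / 2)"
  have mass: "exp (- \<gamma>) \<le> pmf ?ens ?E * measure (step_height_prior [Q]) ?X"
  proof -
    have "exp (- \<gamma>) \<le> sparsity_ratio p a c ^ card J / 2 * (1 / real p ^ card J) * pmf (num_trees_prior C\<^sub>T) 1 *
           pmf (tree_size_prior l) K / real ((K * card J * n) ^ (K - 1)) * w ^ K"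
      by (rule \<gamma>[OF J JK K])
    also have "\<dots> \<le> pmf ?ens ?E * measure (step_height_prior [Q]) ?X"
      using w by (intro mult_mono ensemble_prior_ge(2)[OF ctx P] box(2) pmf_nonneg) auto
    finally show ?thesis .
  qed
  have "measure (data_law n x f\<^sub>0) {Y \<in> space (data_law n x f\<^sub>0).
      measure (posterior (forest_prior p n x Cbar a c C\<^sub>T l) n x Y)
        {f \<in> forest_functions p n x Cbar. emp_norm n x (\<lambda>z. f\<^sub>0 z - f z) > R} > \<delta>}
    \<le> real (card ?I) * (sqrt 2 ^ (k + 1) * exp (- G / 4)) + ?\<eta> * exp c1 + exp (- t)"
  proof (rule posterior_finite_sample_bound[where Sv = ?Sv and E\<^sub>0 = ?E and X = ?X and \<rho> = \<rho> and \<gamma> = \<gamma>])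
    show "1 \<le> n" by (rule n)
    show "x i \<in> cube p" if "i \<in> {1..n}" for i by (rule design[OF that])
    show "forest_functions p n x Cbar \<noteq> {}" by (rule forest_functions_nonempty[OF ctx])
    show "valid_forest p n x Cbar (map tree_rep E)" if "E \<in> set_pmf ?ens" for E
      by (rule ensemble_prior_support[OF ctx that])
    show "finite ?I" by (rule forest_cells_bounds(1)[OF k n])
    show "finite \<C> \<and> card \<C> \<le> k" if "\<C> \<in> ?I" for \<C> by (rule forest_cells_bounds(3)[OF k n that])
    show "\<Union>(set (map tree_rep E)) \<in> ?I" if "E \<in> ?Sv" for E using that by simp
    show "measure (measure_pmf ?ens) (- ?Sv) \<le> ?\<eta>" by (rule ensemble_prior_sieve[OF ctx s])
    show "?E \<in> set_pmf ?ens" by (rule ensemble_prior_ge(1)[OF ctx P])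
    show "?X \<in> sets (step_height_prior (map tree_rep ?E))" unfolding map by (rule box(1))
    show "(\<Sum>i=1..n. (ensemble_fun (map tree_rep ?E) B (x i) - f\<^sub>0 (x i))\<^sup>2) \<le> \<rho>" if "B \<in> ?X" for B
    proof -
      have "ensemble_fun (map tree_rep ?E) B (x i) = (\<Sum>\<Omega>\<in>Q. B (0, \<Omega>) * indicator \<Omega> (x i))" for i
        unfolding map by (simp add: ensemble_fun_def)
      then show ?thesis using near[of "\<lambda>\<Omega>. B (0, \<Omega>)"] box(3)[OF that] by simp
    qed
    show "exp (- \<gamma>) \<le> pmf ?ens ?E * measure (step_height_prior (map tree_rep ?E)) ?X"
      unfolding map by (rule mass)
  qed (use R small in auto)
  also have "real (card ?I) * (sqrt 2 ^ (k + 1) * exp (- G / 4)) \<le>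
      real (1 + (p + 1) ^ q * (k * k * n) ^ k) * (sqrt 2 ^ (k + 1) * exp (- G / 4))"
    using forest_cells_bounds(2)[OF k n, of p x Cbar q] by (intro mult_right_mono of_nat_mono) auto
  finally show ?thesis by simp
qed

text \<open>With r = \<kappa> L^2: p + 1 \<le> p^2 and q log p \<le> D r give 2 D; k \<le> n^2 gives
  k k n \<le> n^5, and k L \<le> (D+1) r gives 5 (D+1); the chi-square factor gives D + 2. The sum
  is 8 D + 7.\<close>

lemma entropy_bound:
  fixes D L \<kappa> :: real
  assumes n: "n \<ge> 1" and L: "L = ln (real n)" "L \<ge> 1" and \<kappa>: "\<kappa> \<ge> 1" "\<kappa> \<le> real n" and D: "D > 0"
    and big: "(D + 1) * L \<le> real n" and p: "p \<ge> 2"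
    and k: "k = nat \<lceil>D * \<kappa> * L\<rceil>" and q: "q = nat \<lfloor>D * (\<kappa> * L\<^sup>2) / ln (real p)\<rfloor>"
  shows "real (1 + (p + 1) ^ q * (k * k * n) ^ k) * sqrt 2 ^ (k + 1) \<le> 2 * exp ((8 * D + 7) * (\<kappa> * L\<^sup>2))"
proof -
  define r where "r = \<kappa> * L\<^sup>2"
  have L2: "L \<le> L\<^sup>2" using L(2) by (simp add: power2_eq_square)
  have \<kappa>L: "1 \<le> \<kappa> * L" using mult_mono[of 1 \<kappa> 1 L] \<kappa> L by simp
  have \<kappa>Lr: "\<kappa> * L \<le> r" unfolding r_def using \<kappa> L2 by (intro mult_left_mono) auto
  have r1: "1 \<le> r" using \<kappa>L \<kappa>Lr by linarith
  have kup: "real k \<le> (D + 1) * (\<kappa> * L)"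
  proof -
    have "real k \<le> D * \<kappa> * L + 1" unfolding k using D \<kappa> L by (simp add: mult_nonneg_nonneg)
    then show ?thesis using \<kappa>L by (simp add: algebra_simps)
  qed
  have kr: "real k \<le> (D + 1) * r" using kup \<kappa>Lr D by (meson mult_left_mono order_trans add_nonneg_nonneg less_imp_le zero_le_one)
  have kL: "real k * L \<le> (D + 1) * r"
    using mult_right_mono[OF kup, of L] L by (simp add: r_def power2_eq_square mult_ac)
  have kn: "real k \<le> real n ^ 2"
  proof -
    have "(D + 1) * (\<kappa> * L) = ((D + 1) * L) * \<kappa>" by simp
    also have "\<dots> \<le> real n * real n" using big \<kappa> L D by (intro mult_mono) auto
    finally show ?thesis using kup by (simp add: power2_eq_square)
  qed
  have n_exp: "real n = exp L" using L n by simp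
  have lnp: "ln (real p) > 0" using p by simp
  have qr: "real q * ln (real p) \<le> D * r"
  proof -
    have "0 \<le> D * r / ln (real p)" using D r1 lnp by simp
    then have "real q \<le> D * r / ln (real p)" unfolding q r_def[symmetric] by (simp add: floor_correct)
    then show ?thesis using lnp by (simp add: field_simps)
  qed
  have A: "real ((p + 1) ^ q) \<le> exp (2 * D * r)"
  proof -
    have "real p + 1 \<le> real p ^ 2"
    proof -
      have "2 \<le> real p" using p by simp
      moreover have "2 * real p \<le> real p * real p" using p by (intro mult_right_mono) auto
      ultimately show ?thesis unfolding power2_eq_square by linarith
    qed
    then have "real ((p + 1) ^ q) \<le> (real p ^ 2) ^ q" by (simp add: power_mono)
    also have "\<dots> = exp (ln (real p)) ^ (2 * q)" using p by (simp add: power_mult)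
    also have "\<dots> = exp (2 * (real q * ln (real p)))" by (simp flip: exp_of_nat_mult)
    also have "\<dots> \<le> exp (2 * D * r)" using qr by simp
    finally show ?thesis .
  qed
  have B: "real ((k * k * n) ^ k) \<le> exp (5 * (D + 1) * r)"
  proof -
    have "real (k * k * n) \<le> (real n ^ 2 * real n ^ 2) * real n"
      unfolding of_nat_mult using kn by (intro mult_mono) auto
    also have "\<dots> = real n ^ 5" by (simp add: power_numeral_reduce)
    finally have "real ((k * k * n) ^ k) \<le> (real n ^ 5) ^ k" unfolding of_nat_power by (intro power_mono) auto
    also have "\<dots> = exp L ^ (5 * k)" by (simp add: power_mult n_exp)
    also have "\<dots> = exp (5 * (real k * L))" by (simp flip: exp_of_nat_mult)
    also have "\<dots> \<le> exp (5 * (D + 1) * r)" 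
      using mult_left_mono[OF kL, of 5] by (simp only: mult.assoc exp_le_cancel_iff)
    finally show ?thesis .
  qed
  have Cc: "sqrt 2 ^ (k + 1) \<le> exp ((D + 2) * r)"
  proof -
    have "sqrt 2 \<le> exp 1"
    proof -
      have "sqrt 2 \<le> 2" using real_sqrt_le_mono[of 2 4] by simp
      also have "\<dots> \<le> exp (1 :: real)" using exp_ge_add_one_self[of 1] by simp
      finally show ?thesis .
    qed
    then have "sqrt 2 ^ (k + 1) \<le> exp 1 ^ (k + 1)" by (intro power_mono) auto
    also have "\<dots> = exp (real k + 1)" by (subst exp_of_nat_mult[symmetric]) simp
    also have "\<dots> \<le> exp ((D + 2) * r)" using kr r1 by (simp add: algebra_simps)
    finally show ?thesis .
  qed
  have "real ((p + 1) ^ q * (k * k * n) ^ k) \<le> exp (2 * D * r) * exp (5 * (D + 1) * r)"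
    unfolding of_nat_mult[of "(p + 1) ^ q"] using A B by (intro mult_mono) auto
  moreover have "1 \<le> exp (2 * D * r) * exp (5 * (D + 1) * r)"
    using D r1 by (simp flip: exp_add)
  ultimately have "real (1 + (p + 1) ^ q * (k * k * n) ^ k) \<le> 2 * (exp (2 * D * r) * exp (5 * (D + 1) * r))"
    unfolding of_nat_add by simp
  then have "real (1 + (p + 1) ^ q * (k * k * n) ^ k) * sqrt 2 ^ (k + 1) \<le>
      2 * (exp (2 * D * r) * exp (5 * (D + 1) * r)) * exp ((D + 2) * r)"
    using Cc by (intro mult_mono) auto
  also have "\<dots> = 2 * exp ((8 * D + 7) * r)" by (simp add: algebra_simps flip: exp_add)
  finally show ?thesis unfolding r_def .
qed

text \<open>The Chernoff base s = sqrt \<kappa> balances two demands: s^2 l is still O(\<kappa>),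
  while log s is of order log n, so that s^k \<ge> exp(D r / 6) although k is only about r / log n.
  This exponent must beat B + 1, hence D \<ge> 6 (B+1). For the sparsity, the ratio is at most
  p^(-a/2) and (q+1) log p \<ge> D r, hence D \<ge> 2 B / a.\<close>

lemma sieve_bound:
  fixes D L \<kappa> B :: real
  assumes L: "L \<ge> 1" "L\<^sup>2 \<ge> 2 * l" and \<kappa>: "\<kappa> \<ge> 1" "ln \<kappa> \<ge> L / 3" and l: "l > 0" and a: "a > 0" and c: "c > 0"
    and D: "D > 0" "D \<ge> 2 * B / a" "D \<ge> 6 * (B + 1)"
    and p: "p \<ge> 2" and pc: "real p powr (- a / 2) \<le> c"
    and k: "k = nat \<lceil>D * \<kappa> * L\<rceil>" and q: "q = nat \<lfloor>D * (\<kappa> * L\<^sup>2) / ln (real p)\<rfloor>"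
  shows "2 * sparsity_ratio p a c ^ (q + 1) + exp ((sqrt \<kappa>)\<^sup>2 * l + sqrt \<kappa> * l) / sqrt \<kappa> ^ k \<le> 3 * exp (- (B * (\<kappa> * L\<^sup>2)))"
proof -
  define r where "r = \<kappa> * L\<^sup>2"
  have r0: "r \<ge> 0" using \<kappa> by (simp add: r_def)
  have lnp: "ln (real p) > 0" using p by simp
  have z: "sparsity_ratio p a c \<le> real p powr (- a / 2)"
  proof -
    have "real p powr - a = real p powr (- a / 2) * real p powr (- a / 2)"
      by (simp flip: powr_add)
    also have "\<dots> \<le> real p powr (- a / 2) * c" using pc by (intro mult_left_mono) auto
    finally show ?thesis using c by (simp add: sparsity_ratio_def field_simps)
  qed
  have z0: "0 \<le> sparsity_ratio p a c" using c by (simp add: sparsity_ratio_def)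
  have "D * r / ln (real p) \<le> real q + 1"
    unfolding q r_def[symmetric] by linarith
  then have qD: "D * r \<le> real (q + 1) * ln (real p)" using lnp by (simp add: field_simps)
  have "sparsity_ratio p a c ^ (q + 1) \<le> (real p powr (- a / 2)) ^ (q + 1)" using z z0 by (intro power_mono)
  also have "\<dots> = exp (- (a / 2) * (real (q + 1) * ln (real p)))"
  proof -
    have "real p powr (- a / 2) = exp (- (a / 2) * ln (real p))" using p by (simp add: powr_def)
    then have "(real p powr (- a / 2)) ^ (q + 1) = exp (real (q + 1) * (- (a / 2) * ln (real p)))"
      by (simp only: exp_of_nat_mult)
    then show ?thesis by (simp only: mult.left_commute)
  qed
  also have "\<dots> \<le> exp (- (B * r))"
  proof -
    have "B * r \<le> a / 2 * (D * r)"
      using mult_right_mono[OF D(2), of "a / 2 * r"] a r0 by (simp add: field_simps)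
    also have "\<dots> \<le> a / 2 * (real (q + 1) * ln (real p))" using qD a by (intro mult_left_mono) auto
    finally show ?thesis by simp
  qed
  finally have 1: "sparsity_ratio p a c ^ (q + 1) \<le> exp (- (B * r))" .
  have e1: "(sqrt \<kappa>)\<^sup>2 * l + sqrt \<kappa> * l \<le> r"
  proof -
    have "sqrt \<kappa> \<le> \<kappa>" using \<kappa> by (intro real_le_lsqrt) (auto simp: power2_eq_square)
    then have "(sqrt \<kappa>)\<^sup>2 * l + sqrt \<kappa> * l \<le> \<kappa> * l + \<kappa> * l"
      using \<kappa> l by (intro add_mono mult_right_mono) auto
    also have "\<dots> = \<kappa> * (2 * l)" by simp
    also have "\<dots> \<le> r" unfolding r_def using L \<kappa> by (intro mult_left_mono) auto
    finally show ?thesis .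
  qed
  have e2: "exp (D * r / 6) \<le> sqrt \<kappa> ^ k"
  proof -
    have kD: "D * \<kappa> * L \<le> real k" unfolding k by linarith
    have "D * r / 6 = (D * \<kappa> * L) * (L / 6)" by (simp add: r_def power2_eq_square)
    also have "\<dots> \<le> real k * (ln \<kappa> / 2)"
      using kD \<kappa> L D by (intro mult_mono) auto
    finally have "exp (D * r / 6) \<le> exp (real k * (ln \<kappa> / 2))" by simp
    also have "\<dots> = exp (ln (sqrt \<kappa>)) ^ k" 
    proof -
      have "ln (sqrt \<kappa>) = ln \<kappa> / 2" using \<kappa> by (simp add: ln_sqrt)
      then show ?thesis by (simp only: exp_of_nat_mult)
    qed
    also have "\<dots> = sqrt \<kappa> ^ k" using \<kappa> by simp
    finally show ?thesis .
  qed
  have "exp ((sqrt \<kappa>)\<^sup>2 * l + sqrt \<kappa> * l) / sqrt \<kappa> ^ k \<le> exp r / exp (D * r / 6)"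
    using e1 e2 by (intro frac_le) auto
  also have "\<dots> \<le> exp (- (B * r))"
  proof -
    have "(B + 1) * r \<le> D / 6 * r" using D(3) r0 by (intro mult_right_mono) auto
    then show ?thesis by (simp add: algebra_simps flip: exp_diff)
  qed
  finally show ?thesis using 1 unfolding r_def by linarith
qed

text \<open>One summand per factor of the prior mass: sparsity prior, choice of the subset,
  normalizers together with the draw T = 1, power of \<open>l\<close>, factorial of K, number of
  trees, step heights.\<close>

definition mass_const :: "real \<Rightarrow> real \<Rightarrow> real \<Rightarrow> real \<Rightarrow> real \<Rightarrow> real" where
  "mass_const A a c l u = (2 * a * A + 2 * \<bar>ln c\<bar>) + 2 * A + \<bar>ln (u / (2 * (exp l - 1)))\<bar> + \<bar>ln l\<bar> + 1 + 3 + (A + 3)\<^sup>2"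

text \<open>Every factor costs at most a constant times r in the exponent. Terms of size K log n or
  K (log n)^2 are covered by K \<le> \<kappa>; the delicate one is j log p \<le> 2 L A \<kappa>, for
  which j \<le> 2 L is needed.\<close>

lemma mass_bound:
  fixes A L \<kappa> u :: real
  assumes n: "n \<ge> 1" and L: "L = ln (real n)" "L \<ge> 1" and \<kappa>: "\<kappa> \<ge> 1" "\<kappa> \<le> real n" and A: "A \<ge> 0"
    and K: "real K \<le> \<kappa>" and j: "j < K" "j = 0 \<Longrightarrow> K = 1" "real j \<le> 2 * L"
    and p: "p \<ge> 2" "ln (real p) \<le> A * \<kappa>" and hyp: "a > 0" "c > 0" "l > 0" "u > 0"
  shows "exp (- (mass_const A a c l u * (\<kappa> * L\<^sup>2))) \<le>
    sparsity_ratio p a c ^ j / 2 * (1 / real p ^ j) * u * pmf (tree_size_prior l) K / real ((K * j * n) ^ (K - 1)) *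
      exp (- ((A + 3)\<^sup>2 * L\<^sup>2)) ^ K"
proof -
  define r where "r = \<kappa> * L\<^sup>2"
  have L2: "L \<le> L\<^sup>2" "1 \<le> L\<^sup>2" using L(2) mult_mono[of 1 L 1 L] by (auto simp: power2_eq_square)
  have \<kappa>L: "\<kappa> * L \<le> r" unfolding r_def using \<kappa> L2 by (intro mult_left_mono) auto
  have \<kappa>r: "\<kappa> \<le> r" unfolding r_def using mult_left_mono[of 1 "L\<^sup>2" \<kappa>] \<kappa> L2 by simp
  have Lr: "L \<le> r" using mult_right_mono[of 1 \<kappa> L] \<kappa> L \<kappa>L by simp
  have r1: "1 \<le> r" using \<kappa> \<kappa>r by linarith
  have Kr: "real K \<le> r" using K \<kappa>r by linarith
  have KL: "real K * L \<le> r"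
  proof -
    have "real K * L \<le> \<kappa> * L" using K L(2) by (intro mult_right_mono) auto
    then show ?thesis using \<kappa>L by linarith
  qed
  have KL2: "real K * L\<^sup>2 \<le> r" unfolding r_def using K by (intro mult_right_mono) auto
  have jr: "real j \<le> 2 * r" using j Lr by linarith
  have lnp: "0 \<le> ln (real p)" using p by simp
  have jp: "real j * ln (real p) \<le> 2 * A * r"
  proof -
    have "real j * ln (real p) \<le> (2 * L) * (A * \<kappa>)" using j(3) p(2) lnp L by (intro mult_mono) auto
    also have "\<dots> = 2 * A * (\<kappa> * L)" by simp
    also have "\<dots> \<le> 2 * A * r" using A \<kappa>L by (intro mult_left_mono) auto
    finally show ?thesis .
  qed
  have K1: "K \<ge> 1" using j by linarith
  have Kn: "K \<le> n" using K \<kappa> by (metis of_nat_le_iff order_trans)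
  have nL: "real n = exp L" using L n by simp
  have f1: "exp (- ((2 * a * A + 2 * \<bar>ln c\<bar>) * r)) \<le> sparsity_ratio p a c ^ j"
  proof -
    have "sparsity_ratio p a c = exp (- (a * ln (real p) + ln c))"
      using p hyp by (simp add: sparsity_ratio_def powr_def exp_diff exp_minus field_simps exp_add)
    then have eq: "sparsity_ratio p a c ^ j = exp (- (a * (real j * ln (real p)) + real j * ln c))"
    proof -
      have "exp (- (a * ln (real p) + ln c)) ^ j = exp (real j * - (a * ln (real p) + ln c))"
        by (rule exp_of_nat_mult[symmetric])
      also have "real j * - (a * ln (real p) + ln c) = - (a * (real j * ln (real p)) + real j * ln c)"
        by (simp add: algebra_simps)
      finally show ?thesis by (simp only: \<open>sparsity_ratio p a c = exp (- (a * ln (real p) + ln c))\<close>)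
    qed
    have "a * (real j * ln (real p)) \<le> a * (2 * A * r)" using jp hyp by (intro mult_left_mono) auto
    moreover have "real j * ln c \<le> 2 * r * \<bar>ln c\<bar>"
    proof -
      have "real j * ln c \<le> real j * \<bar>ln c\<bar>" by (intro mult_left_mono) auto
      also have "\<dots> \<le> 2 * r * \<bar>ln c\<bar>" using jr by (intro mult_right_mono) auto
      finally show ?thesis .
    qed
    ultimately show ?thesis unfolding eq by (simp add: algebra_simps)
  qed
  have f2: "exp (- (2 * A * r)) \<le> 1 / real p ^ j"
  proof -
    have "real p ^ j = exp (real j * ln (real p))" using p by (simp add: exp_of_nat_mult)
    then show ?thesis using jp by (simp add: exp_minus field_simps)
  qed
  have f3: "exp (- (\<bar>ln (u / (2 * (exp l - 1)))\<bar> * r)) \<le> u / (2 * (exp l - 1))"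
  proof -
    let ?c = "u / (2 * (exp l - 1))"
    have pos: "?c > 0" using hyp by simp
    have "- (\<bar>ln ?c\<bar> * r) \<le> - (\<bar>ln ?c\<bar> * 1)" using r1 by (intro le_imp_neg_le mult_left_mono) auto
    then have "- (\<bar>ln ?c\<bar> * r) \<le> ln ?c" by linarith
    then have "exp (- (\<bar>ln ?c\<bar> * r)) \<le> exp (ln ?c)" by (simp only: exp_le_cancel_iff)
    then show ?thesis unfolding exp_ln[OF pos] .
  qed
  have f4: "exp (- (\<bar>ln l\<bar> * r)) \<le> l ^ K"
  proof -
    have "real K * - ln l \<le> real K * \<bar>ln l\<bar>" by (intro mult_left_mono) auto
    also have "\<dots> \<le> r * \<bar>ln l\<bar>" using Kr by (intro mult_right_mono) auto
    finally have "real K * - ln l \<le> r * \<bar>ln l\<bar>" .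
    then have "exp (- (\<bar>ln l\<bar> * r)) \<le> exp (real K * ln l)" by (simp add: mult.commute)
    also have "\<dots> = l ^ K" using hyp by (simp add: exp_of_nat_mult)
    finally show ?thesis .
  qed
  have f5: "exp (- (1 * r)) \<le> 1 / fact K"
  proof -
    have "(fact K :: real) \<le> real (K ^ K)" by (rule fact_le_power)
    also have "\<dots> \<le> real n ^ K" using Kn by (simp add: power_mono)
    also have "\<dots> = exp (real K * L)" by (simp add: nL exp_of_nat_mult)
    also have "\<dots> \<le> exp r" using KL by simp
    finally show ?thesis by (simp add: exp_minus field_simps)
  qed
  have f6: "exp (- (3 * r)) \<le> 1 / real ((K * j * n) ^ (K - 1))"
  proof -
    \<comment> \<open>For j = 0 the base vanishes, but then K = 1 and the power is 0 ^ 0 =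
      1.\<close>
    have pos: "0 < (K * j * n) ^ (K - 1)"
      using j n K1 by (cases "j = 0") auto
    have "K * j * n \<le> n * n * n" using Kn j by (intro mult_le_mono) auto
    then have "(K * j * n) ^ (K - 1) \<le> (n * n * n) ^ (K - 1)" by (intro power_mono) auto
    also have "\<dots> \<le> (n * n * n) ^ K" using n by (intro power_increasing) auto
    finally have "real ((K * j * n) ^ (K - 1)) \<le> real ((n * n * n) ^ K)" by (rule of_nat_mono)
    also have "\<dots> = (exp L ^ 3) ^ K" by (simp add: nL power3_eq_cube)
    also have "\<dots> = exp (3 * (real K * L))" by (simp add: power_mult[symmetric] flip: exp_of_nat_mult)
    also have "\<dots> \<le> exp (3 * r)" using KL by simp
    finally have "real ((K * j * n) ^ (K - 1)) \<le> exp (3 * r)" .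
    then have "1 / exp (3 * r) \<le> 1 / real ((K * j * n) ^ (K - 1))"
      using pos by (intro frac_le) (simp_all only: of_nat_0_less_iff order_refl zero_le_one)
    then show ?thesis by (simp add: exp_minus inverse_eq_divide)
  qed
  have f7: "exp (- ((A + 3)\<^sup>2 * r)) \<le> exp (- ((A + 3)\<^sup>2 * L\<^sup>2)) ^ K"
  proof -
    have "(A + 3)\<^sup>2 * (real K * L\<^sup>2) \<le> (A + 3)\<^sup>2 * r" using KL2 by (intro mult_left_mono) auto
    then show ?thesis by (simp add: mult.left_commute flip: exp_of_nat_mult)
  qed
  let ?c = "u / (2 * (exp l - 1))"
  have "exp (- (mass_const A a c l u * r)) =
    exp (- ((2 * a * A + 2 * \<bar>ln c\<bar>) * r)) * exp (- (2 * A * r)) * exp (- (\<bar>ln ?c\<bar> * r)) * exp (- (\<bar>ln l\<bar> * r)) *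
    exp (- (1 * r)) * exp (- (3 * r)) * exp (- ((A + 3)\<^sup>2 * r))"
    unfolding exp_add[symmetric] mass_const_def by (rule arg_cong[of _ _ exp]) (simp only: distrib_right minus_add_distrib)
  also have "\<dots> \<le> sparsity_ratio p a c ^ j * (1 / real p ^ j) * ?c * l ^ K * (1 / fact K) *
      (1 / real ((K * j * n) ^ (K - 1))) * exp (- ((A + 3)\<^sup>2 * L\<^sup>2)) ^ K"
    using hyp by (intro mult_mono f1 f2 f3 f4 f5 f6 f7 mult_nonneg_nonneg)
      (auto simp: sparsity_ratio_def)
  also have "\<dots> = sparsity_ratio p a c ^ j / 2 * (1 / real p ^ j) * u * pmf (tree_size_prior l) K / real ((K * j * n) ^ (K - 1)) *
      exp (- ((A + 3)\<^sup>2 * L\<^sup>2)) ^ K"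
    using K1 by (simp only: pmf_tree_size_prior[OF hyp(3)] if_True times_divide_eq_left times_divide_eq_right
      mult_1_right mult_1_left divide_divide_eq_left divide_divide_eq_right mult_ac)
  finally show ?thesis unfolding r_def .
qed

text \<open>An interval of radius 1/n around a height of size at most A L has log-probability at
  least -(L + 1 + (A L + 1)^2 / 2), the 1 accounting for 2 / sqrt (2 pi) \<ge> exp(-1). The constant
  (A+3)^2 absorbs all three terms.\<close>

lemma height_density_bound:
  fixes A L :: real
  assumes n: "n \<ge> 1" and L: "L = ln (real n)" "L \<ge> 1" and A: "A \<ge> 0"
  shows "exp (- ((A + 3)\<^sup>2 * L\<^sup>2)) \<le> 2 * (1 / real n) * normal_density 0 1 (A * L + 1)"
proof -
  have L2: "L \<le> L\<^sup>2" "1 \<le> L\<^sup>2" using L(2) mult_mono[of 1 L 1 L] by (auto simp: power2_eq_square)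
  have nL: "1 / real n = exp (- L)" using L n by (simp add: exp_minus inverse_eq_divide)
  have "(A * L + 1)\<^sup>2 \<le> ((A + 1) * L)\<^sup>2" using A L by (intro power_mono) (auto simp: algebra_simps)
  then have 1: "L + 1 + (A * L + 1)\<^sup>2 / 2 \<le> (A + 3)\<^sup>2 * L\<^sup>2"
  proof -
    have "L + 1 + (A * L + 1)\<^sup>2 / 2 \<le> L\<^sup>2 + L\<^sup>2 + (A + 1)\<^sup>2 * L\<^sup>2"
      using \<open>(A * L + 1)\<^sup>2 \<le> ((A + 1) * L)\<^sup>2\<close> L2 zero_le_power2[of "A * L + 1"]
      unfolding power_mult_distrib by linarith
    also have "\<dots> = (2 + (A + 1)\<^sup>2) * L\<^sup>2" by (simp add: algebra_simps)
    also have "\<dots> \<le> (A + 3)\<^sup>2 * L\<^sup>2"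
      using A by (intro mult_right_mono) (auto simp: power2_eq_square algebra_simps)
    finally show ?thesis .
  qed
  have e: "exp (- 1) \<le> 2 / sqrt (2 * pi)"
  proof -
    have "sqrt (2 * pi) \<le> 4" using pi_less_4 by (intro real_le_lsqrt) auto
    then have "2 / 4 \<le> 2 / sqrt (2 * pi)" by (intro divide_left_mono) auto
    moreover have "exp (- 1) \<le> (1 / 2 :: real)"
      using exp_ge_add_one_self[of 1] by (simp add: exp_minus inverse_eq_divide field_simps)
    ultimately show ?thesis by linarith
  qed
  have "exp (- ((A + 3)\<^sup>2 * L\<^sup>2)) \<le> exp (- 1 + (- L + - ((A * L + 1)\<^sup>2 / 2)))" using 1 by simp
  also have "\<dots> = exp (- 1) * (exp (- L) * exp (- ((A * L + 1)\<^sup>2 / 2)))" by (simp only: exp_add)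
  also have "\<dots> \<le> 2 / sqrt (2 * pi) * (exp (- L) * exp (- ((A * L + 1)\<^sup>2 / 2)))"
    by (intro mult_right_mono e) auto
  also have "\<dots> = 2 * (1 / real n) * normal_density 0 1 (A * L + 1)"
    unfolding nL by (simp add: normal_density_def)
  finally show ?thesis .
qed

text \<open>Points given up number at most m \<kappa>, each with squared error of order L^2. The
  others have squared error of order e^2 L^2, and n e^2 = \<kappa> makes both parts multiples of
  \<kappa> L^2.\<close>

lemma approximation_bound:
  fixes A L \<kappa> e v :: real
  assumes n: "n \<ge> 1" and L: "L \<ge> 1" and \<kappa>: "\<kappa> \<ge> 1" and A: "A \<ge> 0" and e: "e \<ge> 0" "1 / real n \<le> e" "real n * e\<^sup>2 = \<kappa>"
    and M: "real M \<le> \<kappa>" and v: "0 \<le> v" "v \<le> 2 * e" and H: "H \<le> A * L" "0 \<le> H"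
  shows "real (m * M) * (1 / real n + 2 * (A * L))\<^sup>2 + real n * (1 / real n + H * v)\<^sup>2 \<le>
    (real m + 1) * (1 + 2 * A)\<^sup>2 * (\<kappa> * L\<^sup>2)"
proof -
  have "1 / real n + 2 * (A * L) \<le> (1 + 2 * A) * L"
  proof -
    have "1 / real n \<le> 1" using n by simp
    then show ?thesis using L by (simp add: algebra_simps)
  qed
  then have "(1 / real n + 2 * (A * L))\<^sup>2 \<le> ((1 + 2 * A) * L)\<^sup>2"
    using A L by (intro power_mono add_nonneg_nonneg) auto
  then have "real (m * M) * (1 / real n + 2 * (A * L))\<^sup>2 \<le> (real m * \<kappa>) * ((1 + 2 * A) * L)\<^sup>2"
    unfolding of_nat_mult using M by (intro mult_mono) auto
  moreover have "real n * (1 / real n + H * v)\<^sup>2 \<le> \<kappa> * ((1 + 2 * A) * L)\<^sup>2"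
  proof -
    have "H * v \<le> (A * L) * (2 * e)" using H v A L by (intro mult_mono) auto
    moreover have "e \<le> e * L" using e L mult_left_mono[of 1 L e] by simp
    ultimately have "1 / real n + H * v \<le> e * ((1 + 2 * A) * L)"
      using e by (simp add: algebra_simps)
    then have "(1 / real n + H * v)\<^sup>2 \<le> (e * ((1 + 2 * A) * L))\<^sup>2"
      using H v by (intro power_mono add_nonneg_nonneg mult_nonneg_nonneg) auto
    then have "real n * (1 / real n + H * v)\<^sup>2 \<le> real n * (e * ((1 + 2 * A) * L))\<^sup>2"
      by (intro mult_left_mono) auto
    also have "\<dots> = (real n * e\<^sup>2) * ((1 + 2 * A) * L)\<^sup>2" by (simp only: power_mult_distrib mult.assoc)
    finally show ?thesis using e by simp
  qed
  ultimately have "real (m * M) * (1 / real n + 2 * (A * L))\<^sup>2 + real n * (1 / real n + H * v)\<^sup>2 \<le>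
      (real m * \<kappa>) * ((1 + 2 * A) * L)\<^sup>2 + \<kappa> * ((1 + 2 * A) * L)\<^sup>2"
    by (rule add_mono)
  also have "\<dots> = (real m + 1) * (1 + 2 * A)\<^sup>2 * (\<kappa> * L\<^sup>2)"
  proof -
    have "(real m * \<kappa>) * (u * z) + \<kappa> * (u * z) = (real m + 1) * u * (\<kappa> * z)" for u z :: real
      by (simp add: algebra_simps)
    then show ?thesis unfolding power_mult_distrib .
  qed
  finally show ?thesis .
qed

lemma rate_identities:
  fixes n q :: nat and \<alpha> :: real
  defines "L \<equiv> ln (real n)" and "\<kappa> \<equiv> real n powr (real q / (2 * \<alpha> + real q))"
    and "e \<equiv> real n powr (- \<alpha> / (2 * \<alpha> + real q))" and "N \<equiv> nat \<lfloor>real n powr (1 / (2 * \<alpha> + real q))\<rfloor>"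
  assumes n: "n \<ge> 1" and q: "q \<ge> 1" and \<alpha>: "0 < \<alpha>" "\<alpha> \<le> 1"
  shows "\<kappa> \<ge> 1" "\<kappa> \<le> real n" "ln \<kappa> \<ge> L / 3" "1 / real n \<le> e" "real n * e\<^sup>2 = \<kappa>" "N \<ge> 1"
    "real (N ^ q) \<le> \<kappa>" "(1 / real N) powr \<alpha> \<le> 2 * e"
    "2 \<le> N \<Longrightarrow> real q \<le> 2 * L"
proof -
  define d where "d = 2 * \<alpha> + real q"
  have d: "d > 0" "real q \<le> d" "\<alpha> \<le> d" using \<alpha> q by (auto simp: d_def)
  have n1: "real n \<ge> 1" using n by simp
  have L0: "L \<ge> 0" using n by (simp add: L_def)
  show \<kappa>1: "\<kappa> \<ge> 1" unfolding \<kappa>_def d_def[symmetric] using n1 d by (intro ge_one_powr_ge_zero) auto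
  have "\<kappa> \<le> real n powr 1" unfolding \<kappa>_def d_def[symmetric] using n1 d by (intro powr_mono) auto
  then show \<kappa>n: "\<kappa> \<le> real n" using n by simp
  \<comment> \<open>From \<alpha> \<le> 1 \<le> q. Hence \<kappa> is at least n^(1/3) for every q,
    which makes the Chernoff base of the sieve polynomial in n.\<close>
  have "1 / 3 \<le> real q / d" using d q \<alpha> by (simp add: d_def field_simps)
  then have "1 / 3 * L \<le> real q / d * L" using L0 by (rule mult_right_mono)
  then show "ln \<kappa> \<ge> L / 3" using n by (simp add: \<kappa>_def L_def d_def ln_powr)
  have "real n powr - 1 \<le> real n powr (- \<alpha> / d)" using n1 d by (intro powr_mono) (auto simp: field_simps)
  then show "1 / real n \<le> e" using n by (simp add: e_def d_def powr_minus inverse_eq_divide)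
  have "real n * e\<^sup>2 = real n powr 1 * (real n powr (- \<alpha> / d) * real n powr (- \<alpha> / d))"
    using n by (simp add: e_def d_def power2_eq_square)
  also have "\<dots> = real n powr (1 + (- \<alpha> / d + - \<alpha> / d))" by (simp only: powr_add)
  also have "1 + (- \<alpha> / d + - \<alpha> / d) = real q / d" 
  proof -
    have "1 + (- \<alpha> / d + - \<alpha> / d) = (d - 2 * \<alpha>) / d" using d(1) by (simp add: diff_divide_distrib)
    then show ?thesis by (simp add: d_def)
  qed
  finally show "real n * e\<^sup>2 = \<kappa>" by (simp add: \<kappa>_def d_def)
  define y where "y = real n powr (1 / d)"
  have y1: "y \<ge> 1" unfolding y_def using n1 d by (intro ge_one_powr_ge_zero) auto
  have Ny: "real N \<le> y" "y < real N + 1"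
    unfolding N_def d_def[symmetric] y_def[symmetric] using y1 by linarith+
  show N1: "N \<ge> 1" unfolding N_def d_def[symmetric] y_def[symmetric] using y1 by (simp add: le_nat_iff le_floor_iff)
  have "real (N ^ q) \<le> y ^ q" using Ny by (simp add: power_mono)
  also have "\<dots> = \<kappa>" 
  proof -
    have "y ^ q = y powr real q" using y1 by (simp add: powr_realpow)
    then show ?thesis by (simp add: y_def \<kappa>_def d_def powr_powr)
  qed
  finally show Nq: "real (N ^ q) \<le> \<kappa>" .
  have "1 \<le> real N" using N1 by simp
  \<comment> \<open>Since N \<ge> 1, rounding down loses at most a factor 2, which becomes 2 powr
    \<alpha> \<le> 2 in the bias.\<close>
  then have "y \<le> 2 * real N" using Ny by linarith
  then have "1 / real N \<le> 2 / y" using N1 y1 by (simp add: field_simps)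
  then have "(1 / real N) powr \<alpha> \<le> (2 / y) powr \<alpha>" using \<alpha> N1 by (intro powr_mono2) auto
  also have "\<dots> = 2 powr \<alpha> * (1 / y) powr \<alpha>" using y1 by (simp add: powr_divide)
  also have "(1 / y) powr \<alpha> = e"
    using y1 by (simp add: y_def e_def d_def powr_powr powr_divide powr_minus_divide)
  also have "2 powr \<alpha> * e \<le> 2 * e"
    using powr_mono[of \<alpha> 1 2] \<alpha> by (intro mult_right_mono) (auto simp: e_def)
  finally show "(1 / real N) powr \<alpha> \<le> 2 * e" .
  \<comment> \<open>With at least two intervals per axis the grid has 2^q cubes or more, so N^q
    \<le> \<kappa> \<le> n forces q log 2 \<le> log n; log 2 \<ge> 1/2 rounds the constant.\<close>
  assume N2: "2 \<le> N"
  have "(2::real) ^ q \<le> real (N ^ q)" using N2 by (simp add: power_mono)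
  also have "\<dots> \<le> real n" using Nq \<kappa>n by linarith
  finally have "ln (2 ^ q) \<le> L" unfolding L_def using n by (subst ln_le_cancel_iff) auto
  then have "real q * ln 2 \<le> L" by (simp add: ln_realpow)
  moreover have "real q * (1 / 2) \<le> real q * ln 2" using ln2_ge_two_thirds by (intro mult_left_mono) auto
  ultimately show "real q \<le> 2 * L" by linarith
qed


text \<open>\<open>Ct\<close> adds the exponents of prior mass, squared distance and t = r. With c1
  = (Ct+1) r the sieve must leave out mass of order exp(-(Ct+2) r) only, so \<open>D\<close> meets
  \<open>sieve_bound\<close> with B = Ct + 2. The level G = 4 (8 D + 8) r makes exp(-G/4) beat the
  entropy 8 D + 7 by exp(-r). The condition on \<open>Ms\<close> pushes the numerator below
  exp(-(Ct+1) r). Each exceptional probability is then a multiple of exp(-r).\<close>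

lemma contraction_single_n:
  fixes n p m :: nat and S :: "nat set" and x :: "nat \<Rightarrow> point" and f\<^sub>0 :: "point \<Rightarrow> real" and A a c C\<^sub>T l \<alpha> Ms \<delta> Cbar :: real
  defines "u \<equiv> pmf (num_trees_prior C\<^sub>T) 1" and "L \<equiv> ln (real n)"
    and "\<epsilon> \<equiv> real n powr (- \<alpha> / (2 * \<alpha> + real (card S))) * ln (real n)"
    and "\<kappa> \<equiv> real n powr (real (card S) / (2 * \<alpha> + real (card S)))"
  defines "Ct \<equiv> mass_const A a c l u + (real m + 1) * (1 + 2 * A)\<^sup>2 + 1"
  defines "D \<equiv> Max {1, 2 * (Ct + 2) / a, 6 * (Ct + 3)}"
  assumes n: "n \<ge> 1" and design: "\<And>i. i \<in> {1..n} \<Longrightarrow> x i \<in> cube p"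
    and m: "m \<ge> 1" "m \<le> n" and Cbar: "Cbar\<^sup>2 = real m"
    and hyp: "a > 0" "c > 0" "l > 0" "C\<^sub>T > 0" "u > 0" and \<alpha>: "0 < \<alpha>" "\<alpha> \<le> 1" and A: "A \<ge> 0"
    and S: "S \<subseteq> {1..p}" "S \<noteq> {}" and f: "f\<^sub>0 \<in> holder_class p \<alpha> \<inter> sparse_class p S"
    and p: "p \<ge> 2" and pc: "real p powr (- a / 2) \<le> c" "real p powr (- a / 2) \<le> 1 / 2"
    and fH: "real (card S) * holder_norm p \<alpha> f\<^sub>0 \<le> A * L" and fs: "sup_norm p f\<^sub>0 \<le> A * L"
    and lp: "ln (real p) \<le> A * \<kappa>"
    and L1: "L \<ge> 1" and L2: "L\<^sup>2 \<ge> 2 * l" and big: "(D + 1) * L \<le> real n"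
    and Ms: "Ms \<ge> 0" "Ms\<^sup>2 / 4 \<ge> 4 * (8 * D + 8) + Ct + 1"
    and \<delta>: "2 * exp (- (\<kappa> * L\<^sup>2)) \<le> \<delta>"
  shows "measure (data_law n x f\<^sub>0) {Y \<in> space (data_law n x f\<^sub>0).
      measure (posterior (forest_prior p n x Cbar a c C\<^sub>T l) n x Y)
        {f \<in> forest_functions p n x Cbar. emp_norm n x (\<lambda>z. f\<^sub>0 z - f z) > Ms * \<epsilon>} > \<delta>}
    \<le> (3 + 3 / (u * pmf (tree_size_prior l) 1 / 2)) * exp (- (\<kappa> * L\<^sup>2))"
proof -
  define r where "r = \<kappa> * L\<^sup>2"
  define e where "e = real n powr (- \<alpha> / (2 * \<alpha> + real (card S)))"
  define N where "N = nat \<lfloor>real n powr (1 / (2 * \<alpha> + real (card S)))\<rfloor>"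
  define k where "k = nat \<lceil>D * \<kappa> * L\<rceil>"
  define q where "q = nat \<lfloor>D * (\<kappa> * L\<^sup>2) / ln (real p)\<rfloor>"
  define \<nu> where "\<nu> = u * pmf (tree_size_prior l) 1 / 2"
  define w where "w = exp (- ((A + 3)\<^sup>2 * L\<^sup>2))"
  have fS: "finite S" using S finite_subset by blast
  have q0: "card S \<ge> 1" using fS S by (simp add: Suc_le_eq card_gt_0_iff)
  note rate = rate_identities[OF n q0 \<alpha>, folded \<kappa>_def L_def e_def N_def]
  have p1: "p \<ge> 1" using p by simp
  have pos: "\<nu> > 0" unfolding \<nu>_def using hyp by (simp add: pmf_tree_size_prior)
  have Ct1: "Ct \<ge> 1" unfolding Ct_def mass_const_def using A hyp by simp
  have D: "D \<ge> 1" "D \<ge> 2 * (Ct + 2) / a" "D \<ge> 6 * (Ct + 3)" unfolding D_def by auto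
  have D0: "D > 0" using D by linarith
  have r1: "r \<ge> 1"
  proof -
    have "1 * 1 \<le> \<kappa> * L\<^sup>2" using rate(1) L1 by (intro mult_mono) (auto simp: power2_eq_square mult_ge1_I)
    then show ?thesis by (simp add: r_def)
  qed
  \<comment> \<open>The two conditions on p powr (-a/2) supply the factors 1/2 and c, whose product
    bounds p powr (-a).\<close>
  have half: "sparsity_ratio p a c \<le> 1 / 2"
  proof -
    have "real p powr - a = real p powr (- a / 2) * real p powr (- a / 2)"
      by (simp flip: powr_add)
    also have "\<dots> \<le> 1 / 2 * c" using pc hyp by (intro mult_mono) auto
    finally show ?thesis using hyp by (simp add: sparsity_ratio_def field_simps)
  qed
  have F: "\<bar>f\<^sub>0 z\<bar> \<le> A * L" if "z \<in> cube p" for z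
    using sup_norm_bound[of f\<^sub>0 p \<alpha> z] f p1 \<alpha> that fs by auto
  have k1: "k \<ge> 1"
  proof -
    have "0 < D * \<kappa> * L" using D0 rate(1) L1 by (intro mult_pos_pos) auto
    then show ?thesis unfolding k_def by linarith
  qed
  have wle: "w \<le> 2 * (1 / real n) * normal_density 0 1 (A * L + 1)"
    unfolding w_def using n L_def L1 A by (intro height_density_bound) auto
  have \<rho>: "real (m * N ^ card S) * (1 / real n + 2 * (A * L))\<^sup>2 +
          real n * (1 / real n + real (card S) * holder_norm p \<alpha> f\<^sub>0 * (1 / real N) powr \<alpha>)\<^sup>2
      \<le> (real m + 1) * (1 + 2 * A)\<^sup>2 * r"
    unfolding r_def
    using f p1 by (intro approximation_bound[where e = e] n L1 A rate fH mult_nonneg_nonneg holder_norm_nonneg) (auto simp: e_def)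
  have small: "(exp (4 * (8 * D + 8) * r - real n * (Ms * \<epsilon>)\<^sup>2 / 4) + exp (- ((Ct + 1) * r))) *
      exp (mass_const A a c l u * r + (real m + 1) * (1 + 2 * A)\<^sup>2 * r + r) \<le> \<delta>"
  proof -
    have "real n * (Ms * \<epsilon>)\<^sup>2 = Ms\<^sup>2 * ((real n * e\<^sup>2) * L\<^sup>2)"
      by (simp add: \<epsilon>_def e_def L_def power_mult_distrib)
    then have "real n * (Ms * \<epsilon>)\<^sup>2 / 4 = Ms\<^sup>2 / 4 * r" by (simp add: rate(5) r_def)
    moreover have "(4 * (8 * D + 8) + Ct + 1) * r \<le> Ms\<^sup>2 / 4 * r"
      using Ms(2) r1 by (intro mult_right_mono) auto
    ultimately have "4 * (8 * D + 8) * r - real n * (Ms * \<epsilon>)\<^sup>2 / 4 \<le> - ((Ct + 1) * r)"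
      by (simp only: distrib_right mult_1_left)
    then have "exp (4 * (8 * D + 8) * r - real n * (Ms * \<epsilon>)\<^sup>2 / 4) + exp (- ((Ct + 1) * r)) \<le> 2 * exp (- ((Ct + 1) * r))"
      by simp
    moreover have "mass_const A a c l u * r + (real m + 1) * (1 + 2 * A)\<^sup>2 * r + r = Ct * r"
      by (simp only: Ct_def distrib_right mult_1_left)
    ultimately have "(exp (4 * (8 * D + 8) * r - real n * (Ms * \<epsilon>)\<^sup>2 / 4) + exp (- ((Ct + 1) * r))) *
      exp (mass_const A a c l u * r + (real m + 1) * (1 + 2 * A)\<^sup>2 * r + r) \<le> 2 * exp (- ((Ct + 1) * r)) * exp (Ct * r)"
      by (simp only:) (intro mult_right_mono; simp)
    also have "\<dots> = 2 * exp (- r)" by (simp add: algebra_simps flip: exp_add)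
    finally show ?thesis using \<delta> unfolding r_def by linarith
  qed
  have "measure (data_law n x f\<^sub>0) {Y \<in> space (data_law n x f\<^sub>0).
      measure (posterior (forest_prior p n x Cbar a c C\<^sub>T l) n x Y)
        {f \<in> forest_functions p n x Cbar. emp_norm n x (\<lambda>z. f\<^sub>0 z - f z) > Ms * \<epsilon>} > \<delta>}
    \<le> real (1 + (p + 1) ^ q * (k * k * n) ^ k) * (sqrt 2 ^ (k + 1) * exp (- (4 * (8 * D + 8) * r) / 4)) +
      (2 * sparsity_ratio p a c ^ (q + 1) + exp ((sqrt \<kappa>)\<^sup>2 * l + sqrt \<kappa> * l) / sqrt \<kappa> ^ k) /
        (pmf (num_trees_prior C\<^sub>T) 1 * pmf (tree_size_prior l) 1 / 2) * exp ((Ct + 1) * r) + exp (- r)"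
  proof (rule contraction_finite_sample[where N = N and w = w and F = "A * L" and S = S and \<alpha> = \<alpha> and m = m
        and \<rho> = "(real m + 1) * (1 + 2 * A)\<^sup>2 * r" and \<gamma> = "mass_const A a c l u * r"])
    show "x i \<in> cube p" if "i \<in> {1..n}" for i by (rule design[OF that])
    show "\<bar>f\<^sub>0 z\<bar> \<le> A * L" if "z \<in> cube p" for z by (rule F[OF that])
    show "0 \<le> w" "w \<le> 1" by (auto simp: w_def)
    show "1 \<le> sqrt \<kappa>" using rate(1) by simp
    show "0 \<le> Ms * \<epsilon>" using Ms L1 by (auto simp: \<epsilon>_def L_def)
    show "exp (- (mass_const A a c l u * r)) \<le> sparsity_ratio p a c ^ card J / 2 * (1 / real p ^ card J) * pmf (num_trees_prior C\<^sub>T) 1 *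
           pmf (tree_size_prior l) K / real ((K * card J * n) ^ (K - 1)) * w ^ K"
      if J: "J \<subseteq> S" "card J < K" "J = {} \<Longrightarrow> K = 1" "K \<le> N ^ card S" for K J
      unfolding r_def w_def u_def[symmetric]
    proof (rule mass_bound)
      have "real K \<le> real (N ^ card S)" using J(4) by (rule of_nat_mono)
      then show "real K \<le> \<kappa>" using rate(7) by linarith
      show "card J = 0 \<Longrightarrow> K = 1" using J(1,3) fS finite_subset by (metis card_0_eq)
      show "real (card J) \<le> 2 * L"
      \<comment> \<open>For N = 1 the tree has K = 1 cell, and card J < K leaves no coordinate; this
        covers dimensions that grow faster than log n.\<close>
      proof (cases "2 \<le> N")
        case True
        have "card J \<le> card S" using J(1) fS by (rule card_mono[rotated])
        then show ?thesis using rate(9)[OF True] by linarith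
      next
        case False
        then have "N = 1" using rate(6) by linarith
        then have "card J = 0" using J(2,4) by simp
        then show ?thesis using L1 by simp
      qed
    qed (rule n L1 A rate(1,2) J(2) p lp hyp | simp only: L_def)+
  qed (use hyp p1 half n m Cbar S rate f \<alpha> wle \<rho> k1 small in auto)
  also have "\<dots> \<le> 2 * exp (- r) + 3 / \<nu> * exp (- r) + exp (- r)"
  proof (intro add_mono order_refl)
    have "real (1 + (p + 1) ^ q * (k * k * n) ^ k) * (sqrt 2 ^ (k + 1) * exp (- (4 * (8 * D + 8) * r) / 4)) =
      real (1 + (p + 1) ^ q * (k * k * n) ^ k) * sqrt 2 ^ (k + 1) * exp (- ((8 * D + 8) * r))"
      by (simp only: mult.assoc) simp
    also have "\<dots> \<le> 2 * exp ((8 * D + 7) * (\<kappa> * L\<^sup>2)) * exp (- ((8 * D + 8) * r))"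
      using D0 n rate L1 big p by (intro mult_right_mono entropy_bound) (auto simp: L_def k_def q_def)
    also have "\<dots> = 2 * exp (- r)" unfolding r_def[symmetric] by (simp add: algebra_simps flip: exp_add)
    finally show "real (1 + (p + 1) ^ q * (k * k * n) ^ k) * (sqrt 2 ^ (k + 1) * exp (- (4 * (8 * D + 8) * r) / 4)) \<le> 2 * exp (- r)" .
    have "2 * sparsity_ratio p a c ^ (q + 1) + exp ((sqrt \<kappa>)\<^sup>2 * l + sqrt \<kappa> * l) / sqrt \<kappa> ^ k \<le> 3 * exp (- ((Ct + 2) * (\<kappa> * L\<^sup>2)))"
      using D D0 by (intro sieve_bound[where D = D and L = L and a = a and p = p] L1 L2 rate(1,3) hyp p pc k_def q_def) (auto simp: algebra_simps)
    then have "(2 * sparsity_ratio p a c ^ (q + 1) + exp ((sqrt \<kappa>)\<^sup>2 * l + sqrt \<kappa> * l) / sqrt \<kappa> ^ k) / \<nu> * exp ((Ct + 1) * r)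
      \<le> 3 * exp (- ((Ct + 2) * r)) / \<nu> * exp ((Ct + 1) * r)"
      unfolding r_def[symmetric] using pos by (intro mult_right_mono divide_right_mono) auto
    also have "\<dots> = 3 / \<nu> * (exp (- ((Ct + 2) * r)) * exp ((Ct + 1) * r))" by simp
    also have "exp (- ((Ct + 2) * r)) * exp ((Ct + 1) * r) = exp (- r)" by (simp add: algebra_simps flip: exp_add)
    finally show "(2 * sparsity_ratio p a c ^ (q + 1) + exp ((sqrt \<kappa>)\<^sup>2 * l + sqrt \<kappa> * l) / sqrt \<kappa> ^ k) /
        (pmf (num_trees_prior C\<^sub>T) 1 * pmf (tree_size_prior l) 1 / 2) * exp ((Ct + 1) * r) \<le> 3 / \<nu> * exp (- r)"
      unfolding \<nu>_def u_def .
  qed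
  also have "\<dots> = (3 + 3 / \<nu>) * exp (- r)" by (simp add: distrib_right)
  finally show ?thesis unfolding \<nu>_def r_def .
qed

theorem theorem5p1:
  fixes p :: "nat \<Rightarrow> nat"
    and x :: "nat \<Rightarrow> nat \<Rightarrow> point"
    and f\<^sub>0 :: "nat \<Rightarrow> point \<Rightarrow> real"
    and S\<^sub>0 :: "nat \<Rightarrow> nat set"
    and Mseq :: "nat \<Rightarrow> real"
    and \<alpha> M Cbar a c C\<^sub>T l :: real
  defines "q\<^sub>0 \<equiv> \<lambda>n. card (S\<^sub>0 n)"
    and "\<epsilon> \<equiv> \<lambda>n. real n powr (- \<alpha> / (2 * \<alpha> + real (card (S\<^sub>0 n)))) * ln (real n)"
    and "prior \<equiv> \<lambda>n. forest_prior (p n) n (x n) Cbar a c C\<^sub>T l"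
  assumes p_lim: "filterlim p at_top at_top"
    and design: "\<And>n i. n \<ge> 1 \<Longrightarrow> i \<in> {1..n} \<Longrightarrow> x n i \<in> cube (p n)"
    and alpha: "0 < \<alpha>" "\<alpha> \<le> 1"
    and Cbar: "\<exists>m::nat. m \<ge> 1 \<and> Cbar\<^sup>2 = real m"
    and hyper: "a > 0" "c > 0" "C\<^sub>T > ln 2" "l > 0"
    and S0: "\<And>n. n \<ge> 1 \<Longrightarrow> S\<^sub>0 n \<subseteq> {1..p n}" "\<And>n. n \<ge> 1 \<Longrightarrow> 0 < q\<^sub>0 n"
    and f0: "\<And>n. n \<ge> 1 \<Longrightarrow> f\<^sub>0 n \<in> holder_class (p n) \<alpha> \<inter> sparse_class (p n) (S\<^sub>0 n)"
    and f0_holder: "(\<lambda>n. real (q\<^sub>0 n) * holder_norm (p n) \<alpha> (f\<^sub>0 n)) \<in> O(\<lambda>n. ln (real n))"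
    and f0_sup: "(\<lambda>n. sup_norm (p n) (f\<^sub>0 n)) \<in> O(\<lambda>n. ln (real n))"
    and log_p: "(\<lambda>n. ln (real (p n))) \<in> O(\<lambda>n. real n powr (real (q\<^sub>0 n) / (2 * \<alpha> + real (q\<^sub>0 n))))"
    and regular: "\<And>n. n \<ge> 1 \<Longrightarrow> regular_design (p n) n (x n) Cbar M (S\<^sub>0 n)"
    and Mseq: "filterlim Mseq at_top at_top"
  shows "\<forall>\<delta>>0. (\<lambda>n. measure (data_law n (x n) (f\<^sub>0 n))
            {Y \<in> space (data_law n (x n) (f\<^sub>0 n)).
               measure (posterior (prior n) n (x n) Y)
                 {f \<in> forest_functions (p n) n (x n) Cbar.
                    emp_norm n (x n) (\<lambda>z. f\<^sub>0 n z - f z) > Mseq n * \<epsilon> n} > \<delta>})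
          \<longlonglongrightarrow> 0"
proof (intro allI impI)
  fix \<delta> :: real assume \<delta>: "\<delta> > 0"
  obtain m :: nat where m: "m \<ge> 1" "Cbar\<^sup>2 = real m" using Cbar by blast
  have CT: "C\<^sub>T > 0" using hyper(3) ln2_ge_two_thirds by linarith
  define u where "u = pmf (num_trees_prior C\<^sub>T) 1"
  define L where "L n = ln (real n)" for n :: nat
  define \<kappa> where "\<kappa> n = real n powr (real (card (S\<^sub>0 n)) / (2 * \<alpha> + real (card (S\<^sub>0 n))))" for n
  obtain A1 where A1: "A1 > 0" "\<forall>\<^sub>F n in sequentially. norm (real (q\<^sub>0 n) * holder_norm (p n) \<alpha> (f\<^sub>0 n)) \<le> A1 * norm (ln (real n))"
    using f0_holder by (elim landau_o.bigE)
  obtain A2 where A2: "A2 > 0" "\<forall>\<^sub>F n in sequentially. norm (sup_norm (p n) (f\<^sub>0 n)) \<le> A2 * norm (ln (real n))"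
    using f0_sup by (elim landau_o.bigE)
  obtain A3 where A3: "A3 > 0" "\<forall>\<^sub>F n in sequentially. norm (ln (real (p n))) \<le>
      A3 * norm (real n powr (real (q\<^sub>0 n) / (2 * \<alpha> + real (q\<^sub>0 n))))"
    using log_p by (elim landau_o.bigE)
  \<comment> \<open>One constant dominates the three bounds of order O. All later constants depend
    on it and the hyperparameters, not on n or the dimension, so the eventual conditions below are
    uniform.\<close>
  define A where "A = max A1 (max A2 A3)"
  have A: "A \<ge> 0" "A1 \<le> A" "A2 \<le> A" "A3 \<le> A" using A1 unfolding A_def by auto
  define Ct where "Ct = mass_const A a c l u + (real m + 1) * (1 + 2 * A)\<^sup>2 + 1"
  define D where "D = Max {1, 2 * (Ct + 2) / a, 6 * (Ct + 3)}"
  define W where "W = 3 + 3 / (u * pmf (tree_size_prior l) 1 / 2)"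
  have u: "u > 0" unfolding u_def by (rule num_trees_prior_one_pos[OF CT])
  have W: "W \<ge> 0" unfolding W_def using u by simp
  have D1: "D \<ge> 1" unfolding D_def by auto
  have Ltop: "filterlim L at_top sequentially"
    unfolding L_def by (rule filterlim_compose[OF ln_at_top filterlim_real_sequentially])
  have ptop: "filterlim (\<lambda>n. real (p n)) at_top sequentially"
    by (rule filterlim_compose[OF filterlim_real_sequentially p_lim])
  have p0: "(\<lambda>n. real (p n) powr (- a / 2)) \<longlonglongrightarrow> 0"
    using hyper(1) ptop by (intro tendsto_neg_powr) auto
  have ev: "\<forall>\<^sub>F n in sequentially. n \<ge> 1 \<and> n \<ge> m" "\<forall>\<^sub>F n in sequentially. p n \<ge> 2"
    "\<forall>\<^sub>F n in sequentially. real (p n) powr (- a / 2) < min c (1 / 2)"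
    "\<forall>\<^sub>F n in sequentially. L n \<ge> max 1 (2 * l)"
    "\<forall>\<^sub>F n in sequentially. L n / real n < 1 / (D + 1)"
    "\<forall>\<^sub>F n in sequentially. Mseq n \<ge> max 1 (4 * (4 * (8 * D + 8) + Ct + 1))"
    "\<forall>\<^sub>F n in sequentially. 1 / real n < \<delta> / 2"
  proof -
    show "\<forall>\<^sub>F n in sequentially. n \<ge> 1 \<and> n \<ge> m"
      by (intro eventually_conj eventually_ge_at_top)
    show "\<forall>\<^sub>F n in sequentially. p n \<ge> 2"
      using p_lim by (simp add: filterlim_at_top)
    show "\<forall>\<^sub>F n in sequentially. real (p n) powr (- a / 2) < min c (1 / 2)"
      using p0 hyper(2) by (intro order_tendstoD(2)) auto
    show "\<forall>\<^sub>F n in sequentially. L n \<ge> max 1 (2 * l)"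
      using Ltop by (simp only: filterlim_at_top)
    show "\<forall>\<^sub>F n in sequentially. L n / real n < 1 / (D + 1)"
      unfolding L_def using D1 by (intro order_tendstoD(2)[OF lim_ln_over_n]) auto
    show "\<forall>\<^sub>F n in sequentially. Mseq n \<ge> max 1 (4 * (4 * (8 * D + 8) + Ct + 1))"
      using Mseq by (simp only: filterlim_at_top)
    show "\<forall>\<^sub>F n in sequentially. 1 / real n < \<delta> / 2"
      using \<delta> by (intro order_tendstoD(2)[OF lim_1_over_n]) auto
  qed
  show "(\<lambda>n. measure (data_law n (x n) (f\<^sub>0 n))
            {Y \<in> space (data_law n (x n) (f\<^sub>0 n)).
               measure (posterior (prior n) n (x n) Y)
                 {f \<in> forest_functions (p n) n (x n) Cbar.
                    emp_norm n (x n) (\<lambda>z. f\<^sub>0 n z - f z) > Mseq n * \<epsilon> n} > \<delta>})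
          \<longlonglongrightarrow> 0"
  proof (rule Lim_null_comparison)
    show "(\<lambda>n. W * (1 / real n)) \<longlonglongrightarrow> 0"
      using tendsto_mult_left[OF lim_1_over_n, of W] by simp
    show "\<forall>\<^sub>F n in sequentially. norm (measure (data_law n (x n) (f\<^sub>0 n))
            {Y \<in> space (data_law n (x n) (f\<^sub>0 n)).
               measure (posterior (prior n) n (x n) Y)
                 {f \<in> forest_functions (p n) n (x n) Cbar.
                    emp_norm n (x n) (\<lambda>z. f\<^sub>0 n z - f z) > Mseq n * \<epsilon> n} > \<delta>}) \<le> W * (1 / real n)"
      using ev(1) ev(2) ev(3) ev(4) ev(5) ev(6) ev(7) A1(2) A2(2) A3(2)
    proof eventually_elim
      case (elim n)
      have n: "n \<ge> 1" "m \<le> n" using elim by auto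
      have S: "S\<^sub>0 n \<subseteq> {1..p n}" "S\<^sub>0 n \<noteq> {}" using S0[of n] n unfolding q\<^sub>0_def by auto
      have L: "L n \<ge> 1" "2 * l \<le> L n" using elim by auto
      have L2: "L n \<le> (L n)\<^sup>2" using L by (simp add: power2_eq_square)
      have absL: "\<bar>ln (real n)\<bar> = L n" using L by (simp add: L_def)
      have q1: "card (S\<^sub>0 n) \<ge> 1" using S0(2)[of n] n unfolding q\<^sub>0_def by simp
      have \<kappa>1: "\<kappa> n \<ge> 1" unfolding \<kappa>_def by (rule rate_identities(1)[OF n(1) q1 alpha])
      \<comment> \<open>Using \<kappa> \<ge> 1 alone, the exponent is at least log n; hence the
        probability bound is O(1/n) however the dimension varies with n.\<close>
      have Lr: "L n \<le> \<kappa> n * (L n)\<^sup>2" using mult_mono[of 1 "\<kappa> n" "L n" "(L n)\<^sup>2"] \<kappa>1 L2 L by simp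
      have er: "exp (- (\<kappa> n * (L n)\<^sup>2)) \<le> 1 / real n"
      proof -
        have "exp (- (\<kappa> n * (L n)\<^sup>2)) \<le> exp (- L n)" using Lr by simp
        also have "\<dots> = 1 / real n" using n by (simp add: L_def exp_minus inverse_eq_divide)
        finally show ?thesis .
      qed
      have Ms: "0 \<le> Mseq n" "4 * (8 * D + 8) + Ct + 1 \<le> (Mseq n)\<^sup>2 / 4"
      proof -
        have M: "1 \<le> Mseq n" "4 * (4 * (8 * D + 8) + Ct + 1) \<le> Mseq n" using elim by auto
        have "Mseq n \<le> (Mseq n)\<^sup>2" using M by (simp add: power2_eq_square)
        then have "4 * (4 * (8 * D + 8) + Ct + 1) \<le> (Mseq n)\<^sup>2" using M(2) by (rule order_trans[rotated])
        then show "4 * (8 * D + 8) + Ct + 1 \<le> (Mseq n)\<^sup>2 / 4" by (simp only: le_divide_eq_numeral1 mult.commute)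
        show "0 \<le> Mseq n" using M by linarith
      qed
      have big: "(D + 1) * L n \<le> real n"
        using elim(5) D1 n by (simp add: field_simps)
      have fH: "real (card (S\<^sub>0 n)) * holder_norm (p n) \<alpha> (f\<^sub>0 n) \<le> A * L n"
      proof -
        have "real (card (S\<^sub>0 n)) * holder_norm (p n) \<alpha> (f\<^sub>0 n) \<le> A1 * L n"
          using elim(8) unfolding real_norm_def absL q\<^sub>0_def by linarith
        also have "\<dots> \<le> A * L n" using A L by (intro mult_right_mono) auto
        finally show ?thesis .
      qed
      have fs: "sup_norm (p n) (f\<^sub>0 n) \<le> A * L n"
      proof -
        have "sup_norm (p n) (f\<^sub>0 n) \<le> A2 * L n"
          using elim(9) unfolding real_norm_def absL by linarith
        also have "\<dots> \<le> A * L n" using A L by (intro mult_right_mono) auto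
        finally show ?thesis .
      qed
      have lp: "ln (real (p n)) \<le> A * \<kappa> n"
      proof -
        have "\<bar>\<kappa> n\<bar> = \<kappa> n" using \<kappa>1 by simp
        then have "ln (real (p n)) \<le> A3 * \<kappa> n"
          using elim(10) unfolding q\<^sub>0_def real_norm_def \<kappa>_def[symmetric] by linarith
        also have "\<dots> \<le> A * \<kappa> n" using A \<kappa>1 by (intro mult_right_mono) auto
        finally show ?thesis .
      qed
      have "measure (data_law n (x n) (f\<^sub>0 n))
            {Y \<in> space (data_law n (x n) (f\<^sub>0 n)).
               measure (posterior (forest_prior (p n) n (x n) Cbar a c C\<^sub>T l) n (x n) Y)
                 {f \<in> forest_functions (p n) n (x n) Cbar.
                    emp_norm n (x n) (\<lambda>z. f\<^sub>0 n z - f z) >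
                      Mseq n * (real n powr (- \<alpha> / (2 * \<alpha> + real (card (S\<^sub>0 n)))) * ln (real n))} > \<delta>}
        \<le> (3 + 3 / (pmf (num_trees_prior C\<^sub>T) 1 * pmf (tree_size_prior l) 1 / 2)) * exp (- (\<kappa> n * (L n)\<^sup>2))"
        unfolding \<kappa>_def L_def
      proof (rule contraction_single_n[where A = A and m = m])
        show "x n i \<in> cube (p n)" if "i \<in> {1..n}" for i using design[OF n(1) that] .
        show "(Max {1, 2 * (mass_const A a c l (pmf (num_trees_prior C\<^sub>T) 1) + (real m + 1) * (1 + 2 * A)\<^sup>2 + 1 + 2) / a,
             6 * (mass_const A a c l (pmf (num_trees_prior C\<^sub>T) 1) + (real m + 1) * (1 + 2 * A)\<^sup>2 + 1 + 3)} + 1) * ln (real n) \<le> real n"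
          using big unfolding D_def Ct_def u_def L_def .
        show "4 * (8 * Max {1, 2 * (mass_const A a c l (pmf (num_trees_prior C\<^sub>T) 1) + (real m + 1) * (1 + 2 * A)\<^sup>2 + 1 + 2) / a,
             6 * (mass_const A a c l (pmf (num_trees_prior C\<^sub>T) 1) + (real m + 1) * (1 + 2 * A)\<^sup>2 + 1 + 3)} + 8) +
             (mass_const A a c l (pmf (num_trees_prior C\<^sub>T) 1) + (real m + 1) * (1 + 2 * A)\<^sup>2 + 1) + 1 \<le> (Mseq n)\<^sup>2 / 4"
          using Ms(2) unfolding D_def Ct_def u_def .
        show "pmf (num_trees_prior C\<^sub>T) 1 > 0" using u unfolding u_def .
        show "2 * l \<le> (ln (real n))\<^sup>2" using L L2 unfolding L_def by linarith
        show "1 \<le> ln (real n)" using L unfolding L_def by linarith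
        show "2 * exp (- (real n powr (real (card (S\<^sub>0 n)) / (2 * \<alpha> + real (card (S\<^sub>0 n)))) * (ln (real n))\<^sup>2)) \<le> \<delta>"
          using er elim(7) unfolding \<kappa>_def L_def by linarith
        show "real (card (S\<^sub>0 n)) * holder_norm (p n) \<alpha> (f\<^sub>0 n) \<le> A * ln (real n)" using fH unfolding L_def .
        show "sup_norm (p n) (f\<^sub>0 n) \<le> A * ln (real n)" using fs unfolding L_def .
        show "ln (real (p n)) \<le> A * real n powr (real (card (S\<^sub>0 n)) / (2 * \<alpha> + real (card (S\<^sub>0 n))))"
          using lp unfolding \<kappa>_def .
        show "f\<^sub>0 n \<in> holder_class (p n) \<alpha> \<inter> sparse_class (p n) (S\<^sub>0 n)" by (rule f0[OF n(1)])
        show "real (p n) powr (- a / 2) \<le> c" "real (p n) powr (- a / 2) \<le> 1 / 2" using elim(3) by auto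
      qed (use n m S hyper CT alpha A Ms elim in auto)
      also have "\<dots> = W * exp (- (\<kappa> n * (L n)\<^sup>2))" unfolding W_def u_def ..
      also have "\<dots> \<le> W * (1 / real n)" by (rule mult_left_mono[OF er W])
      finally show ?case unfolding \<epsilon>_def prior_def by simp
    qed
  qed
qed

end
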